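(* Let $L>0$, $\Omega=[0,L]^2$ and $B\in\mathbb{R}^2$ be given, and let the solution space $X$ and the energy $E:X\to(-\infty,+\infty]$ (with lattice constant $a>0$, coefficients $c_1,c_3>0$, $c_2\in\mathbb{R}$, and $\gamma_0=\exp(-c_2/c_1)$) be as defined in the context. Then there exists a global minimizer $h^*\in X$ of $E$, that is, $$E[h^*]=\min_{h\in X}E[h].$$ Moreover, if $\frac{L}{a}<\beta$, where $$\beta=\begin{cases}2\sqrt{\dfrac{3c_3}{c_1}}-\dfrac{3c_3}{c_1}\gamma_0, & \text{if } \sqrt{\dfrac{c_1}{3c_3}}\ge\gamma_0,\\[2ex] \dfrac{1}{\gamma_0}, & \text{otherwise,}\end{cases}$$ then the minimizer of $E$ in $X$ is unique.
   Context: Parameters: $L>0$ (domain size), $a>0$ (lattice constant), $c_1>0$, $c_3>0$, $c_2\in\mathbb{R}$, $\gamma_0=\exp(-c_2/c_1)$, $B\in\mathbb{R}^2$ (average slope). $\Omega=[0,L]^2$ is a periodic cell. $H^1_\#(\Omega)$ denotes the Sobolev space of $\Omega$-periodic functions which, together with their first distributional derivatives, lie in $L^2(\Omega)$. Set $V=\{\tilde h\in H^1_\#(\Omega): \int_\Omega\tilde h\,dx=0\}$ and $X=\{h\in H^1_{\mathrm{loc}}(\mathbb{R}^2): \tilde h(x):=h(x)-B^{\top}x\in V\}$. For $\tilde h\in V$ with Fourier series $\tilde h(x)=\sum_{k\in\mathbb{Z}^2}h_k e^{2\pi i k\cdot x/L}$, define the seminorm $[\tilde h]_{H^{1/2}(\Omega)}=\big(\sum_{k\in\mathbb{Z}^2}|k||h_k|^2\big)^{1/2}$.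 The energy is $$E[h]=-2c_1\pi^2L\,[\tilde h]_{H^{1/2}(\Omega)}^2+\int_\Omega\Psi(\nabla h)\,dx,\qquad \Psi(p)=ac_1|p|\log(|p|+\gamma_0)+ac_2|p|+ac_3|p|^3,\ p\in\mathbb{R}^2,$$ with $\tilde h(x)=h(x)-B^\top x$, and the value $+\infty$ when $\nabla h\notin L^3(\Omega)$. *)

theory Defs
  imports "HOL-Analysis.Analysis"
begin

text \<open>
  Elements of \<open>L\<^sup>p\<close> and Sobolev spaces are represented by functions defined everywhere and measurable
  with respect to the (complete) Lebesgue measure; two functions denote the same element iff they
  agree almost everywhere. All notions below respect this equivalence.
\<close>

definition in_Lp :: "nat \<Rightarrow> (real^'n) set \<Rightarrow> (real^'n \<Rightarrow> 'b::{banach, second_countable_topology}) \<Rightarrow> bool"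
  where "in_Lp p S f \<longleftrightarrow>
    set_borel_measurable lebesgue S f \<and> set_integrable lebesgue S (\<lambda>x. norm (f x) ^ p)"

definition in_Lp_loc :: "nat \<Rightarrow> (real^'n \<Rightarrow> 'b::{banach, second_countable_topology}) \<Rightarrow> bool"
  where "in_Lp_loc p f \<longleftrightarrow> (\<forall>K. compact K \<longrightarrow> in_Lp p K f)"

definition partial_deriv :: "'n \<Rightarrow> (real^'n \<Rightarrow> real) \<Rightarrow> real^'n \<Rightarrow> real"
  where "partial_deriv i f x = frechet_derivative f (at x) (axis i 1)"

primrec Ck :: "nat \<Rightarrow> (real^'n \<Rightarrow> real) \<Rightarrow> bool"
  where
    "Ck 0 f \<longleftrightarrow> continuous_on UNIV f"
  | "Ck (Suc k) f \<longleftrightarrow> (\<forall>x. f differentiable (at x)) \<and> (\<forall>i. Ck k (partial_deriv i f))"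

definition test_function :: "(real^'n \<Rightarrow> real) \<Rightarrow> bool"
  where "test_function \<phi> \<longleftrightarrow> (\<forall>k. Ck k \<phi>) \<and> compact (closure {x. \<phi> x \<noteq> 0})"

definition has_weak_gradient :: "(real^'n \<Rightarrow> real) \<Rightarrow> (real^'n \<Rightarrow> real^'n) \<Rightarrow> bool"
  where "has_weak_gradient f G \<longleftrightarrow>
    in_Lp_loc 1 f \<and> in_Lp_loc 1 G \<and>
    (\<forall>\<phi> i. test_function \<phi> \<longrightarrow>
      (LINT x|lebesgue. f x * partial_deriv i \<phi> x) = - (LINT x|lebesgue. G x $ i * \<phi> x))"

text \<open>The weak gradient is unique up to a null set, so the choice below is immaterial.\<close>

definition weak_gradient :: "(real^'n \<Rightarrow> real) \<Rightarrow> real^'n \<Rightarrow> real^'n"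
  where "weak_gradient f = (SOME G. has_weak_gradient f G)"

definition H1_loc :: "(real^'n \<Rightarrow> real) set"
  where "H1_loc = {f. in_Lp_loc 2 f \<and> (\<exists>G. has_weak_gradient f G \<and> in_Lp_loc 2 G)}"

definition cell :: "real \<Rightarrow> (real^2) set"
  where "cell L = cbox (vec 0) (vec L)"

definition cell_periodic :: "real \<Rightarrow> (real^2 \<Rightarrow> real) \<Rightarrow> bool"
  where "cell_periodic L f \<longleftrightarrow> (\<forall>i. AE x in lebesgue. f (x + L *\<^sub>R axis i 1) = f x)"

text \<open>The distributional gradient is taken on the whole plane, not just inside the cell; this rules
  out jumps of the periodic extension across the boundary of the cell.\<close>

definition H1_per :: "real \<Rightarrow> (real^2 \<Rightarrow> real) set"
  where "H1_per L = {f. cell_periodic L f \<and> in_Lp 2 (cell L) f \<and>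
    (\<exists>G. has_weak_gradient f G \<and> in_Lp 2 (cell L) G)}"

definition V_space :: "real \<Rightarrow> (real^2 \<Rightarrow> real) set"
  where "V_space L = {f \<in> H1_per L. (LINT x:cell L|lebesgue. f x) = 0}"

definition tilt :: "real^2 \<Rightarrow> (real^2 \<Rightarrow> real) \<Rightarrow> real^2 \<Rightarrow> real"
  where "tilt B h x = h x - B \<bullet> x"

definition X_space :: "real \<Rightarrow> real^2 \<Rightarrow> (real^2 \<Rightarrow> real) set"
  where "X_space L B = {h \<in> H1_loc. tilt B h \<in> V_space L}"

definition fourier_coeff :: "real \<Rightarrow> (real^2 \<Rightarrow> real) \<Rightarrow> real^2 \<Rightarrow> complex"
  where "fourier_coeff L f k =
    (LINT x:cell L|lebesgue. of_real (f x) * cis (- (2 * pi * (k \<bullet> x) / L))) / of_real (L\<^sup>2)"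

definition int_lattice :: "(real^2) set"
  where "int_lattice = {k. \<forall>i. k $ i \<in> \<int>}"

text \<open>For functions in \<^const>\<open>V_space\<close> the series converges, since \<open>\<bar>k\<bar> \<le> \<bar>k\<bar>\<^sup>2\<close> on the lattice, so the
  default value of \<^const>\<open>infsum\<close> for divergent series plays no role.\<close>

definition H_half_seminorm :: "real \<Rightarrow> (real^2 \<Rightarrow> real) \<Rightarrow> real"
  where "H_half_seminorm L f =
    sqrt (\<Sum>\<^sub>\<infinity>k\<in>int_lattice. norm k * (cmod (fourier_coeff L f k))\<^sup>2)"

definition gamma0 :: "real \<Rightarrow> real \<Rightarrow> real"
  where "gamma0 c1 c2 = exp (- c2 / c1)"

definition Psi :: "real \<Rightarrow> real \<Rightarrow> real \<Rightarrow> real \<Rightarrow> real^2 \<Rightarrow> real"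
  where "Psi a c1 c2 c3 p =
    a * c1 * norm p * ln (norm p + gamma0 c1 c2) + a * c2 * norm p + a * c3 * norm p ^ 3"

definition energy :: "real \<Rightarrow> real \<Rightarrow> real \<Rightarrow> real \<Rightarrow> real \<Rightarrow> real^2 \<Rightarrow> (real^2 \<Rightarrow> real) \<Rightarrow> ereal"
  where "energy L a c1 c2 c3 B h =
    (if in_Lp 3 (cell L) (weak_gradient h)
     then ereal (- 2 * c1 * pi\<^sup>2 * L * (H_half_seminorm L (tilt B h))\<^sup>2
                 + (LINT x:cell L|lebesgue. Psi a c1 c2 c3 (weak_gradient h x)))
     else \<infinity>)"

definition energy_minimizer ::
    "real \<Rightarrow> real \<Rightarrow> real \<Rightarrow> real \<Rightarrow> real \<Rightarrow> real^2 \<Rightarrow> (real^2 \<Rightarrow> real) \<Rightarrow> bool"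
  where "energy_minimizer L a c1 c2 c3 B h \<longleftrightarrow>
    h \<in> X_space L B \<and> (\<forall>g\<in>X_space L B. energy L a c1 c2 c3 B h \<le> energy L a c1 c2 c3 B g)"

definition beta :: "real \<Rightarrow> real \<Rightarrow> real \<Rightarrow> real"
  where "beta c1 c2 c3 =
    (if sqrt (c1 / (3 * c3)) \<ge> gamma0 c1 c2
     then 2 * sqrt (3 * c3 / c1) - 3 * c3 / c1 * gamma0 c1 c2
     else 1 / gamma0 c1 c2)"

end

theory Submission
  imports Defs "HOL-Complex_Analysis.Great_Picard"
begin

text \<open>
  Write \<open>h(x) = B \<bullet> x + v(x)\<close>. The constant \<open>\<beta>\<close> is the minimum of \<open>1/(s + \<gamma>\<^sub>0) + 3 c\<^sub>3 s / c\<^sub>1\<close> over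
  \<open>s \<ge> 0\<close>, and this is just what makes \<open>\<Psi>(p) - a c\<^sub>1 \<beta> |p|\<^sup>2 / 2\<close> a convex increasing function of \<open>|p|\<close>; so
  \<open>\<Psi>\<close> is strongly convex with modulus \<open>a c\<^sub>1 \<beta> > 0\<close>. Together with the parallelogram identity for the
  \<open>H\<^sup>1\<^sup>/\<^sup>2\<close> seminorm this gives, for \<open>u = (v\<^sub>1 - v\<^sub>2)/2\<close>, that the energy of the midpoint of \<open>h\<^sub>1\<close> and \<open>h\<^sub>2\<close> is at most
  \<open>(E[h\<^sub>1] + E[h\<^sub>2])/2 + 2 c\<^sub>1 \<pi>\<^sup>2 L [u]\<^sup>2 - (a c\<^sub>1 \<beta> / 2) \<parallel>\<nabla>u\<parallel>\<^sup>2\<close>.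

  Uniqueness: Parseval's identity bounds \<open>[u]\<^sup>2\<close> by \<open>\<parallel>\<nabla>u\<parallel>\<^sup>2 / (4\<pi>\<^sup>2)\<close>, because \<open>|k| \<le> |k|\<^sup>2\<close> on the lattice. If
  \<open>L/a < \<beta>\<close>, two minimizers therefore have the same gradient, and they agree by Poincare's inequality.

  Existence: the cubic term makes the energy dominate \<open>\<parallel>\<nabla>v\<parallel>\<^sup>2\<close>, so along a subsequence of a minimizing
  sequence all Fourier coefficients converge. Since the gradients control the high frequencies,
  \<open>[v\<^sub>m - v\<^sub>n]\<close> tends to \<open>0\<close>, and the midpoint inequality forces the gradients to be Cauchy in \<open>L\<^sup>2\<close>. The
  convergence is strong, so Fatou's lemma suffices and no weak compactness is needed.
\<close>

subsection \<open>Functions of class \<open>C\<^sup>k\<close>\<close>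

text \<open>Two settings have to be reconciled: weak gradients are tested on the whole plane, while
  Fourier coefficients live on one cell. A smooth cutoff whose lattice translates sum to 1 links
  them: multiplied by it, a smooth periodic function becomes a test function, and integrals over the
  plane fold back to the cell. The expression minimized by beta comes from the Hessian of
  \<open>Psi\<close>: at |p| = s > 0 both its radial and its tangential eigenvalue are at least a c1
  (1/(s + gamma0) + 3 c3 s / c1). The tangential bound uses c1 ln(gamma0) = - c2, which explains the
  value of gamma0: the radial profile has slope 0 at s = 0. In the midpoint inequality the positive
  term is at most c1 L / 2 times the squared norm of the gradient of u, the negative one is a c1
  beta / 2 times it; comparing the two factors is the condition L/a < beta. For larger L this
  comparison fails. Since beta > 0 always holds, existence only requires that the positive term
  vanish along the sequence, not that it be small relative to the gradient.\<close>

lemma Ck_imp_continuous: "Ck k f \<Longrightarrow> continuous_on UNIV f"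
  by (cases k) (auto simp: continuous_at_imp_continuous_on differentiable_imp_continuous_within)

lemma Ck_SucD: "Ck (Suc k) f \<Longrightarrow> Ck k f"
proof (induction k arbitrary: f)
  case 0
  then show ?case using Ck_imp_continuous[OF 0] by simp
qed auto

lemma partial_deriv_eqI: "(f has_derivative f') (at x) \<Longrightarrow> partial_deriv i f x = f' (axis i 1)"
  unfolding partial_deriv_def using frechet_derivative_at by metis

lemma Ck_differentiable: "Ck (Suc k) f \<Longrightarrow> (f has_derivative frechet_derivative f (at x)) (at x)"
  by (simp add: frechet_derivative_works)

lemma Ck_const: "Ck k (\<lambda>x. c)"
proof (induction k arbitrary: c)
  case (Suc k)
  have "partial_deriv i (\<lambda>x. c) = (\<lambda>x. 0)" for i :: 'a
    by (rule ext, subst partial_deriv_eqI[OF has_derivative_const]) simp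
  with Suc show ?case by simp
qed simp

lemma Ck_add: "Ck k f \<Longrightarrow> Ck k g \<Longrightarrow> Ck k (\<lambda>x. f x + g x)"
proof (induction k arbitrary: f g)
  case (Suc k)
  have d: "((\<lambda>x. f x + g x) has_derivative (\<lambda>h. frechet_derivative f (at x) h + frechet_derivative g (at x) h)) (at x)" for x
    by (intro has_derivative_add Ck_differentiable[OF Suc.prems(1)] Ck_differentiable[OF Suc.prems(2)])
  have "partial_deriv i (\<lambda>x. f x + g x) = (\<lambda>x. partial_deriv i f x + partial_deriv i g x)" for i
    by (rule ext, subst partial_deriv_eqI[OF d]) (simp add: partial_deriv_def)
  with Suc d show ?case by (auto simp: differentiable_def)
qed (auto intro: continuous_intros)

lemma partial_deriv_mult:
  assumes "Ck (Suc k) f" "Ck (Suc k) g"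
  shows "partial_deriv i (\<lambda>x. f x * g x) = (\<lambda>x. f x * partial_deriv i g x + partial_deriv i f x * g x)"
  by (rule ext, subst partial_deriv_eqI[OF has_derivative_mult[OF Ck_differentiable[OF assms(1)] Ck_differentiable[OF assms(2)]]])
     (simp add: partial_deriv_def)

lemma Ck_mult: "Ck k f \<Longrightarrow> Ck k g \<Longrightarrow> Ck k (\<lambda>x. f x * g x)"
proof (induction k arbitrary: f g)
  case (Suc k)
  have "Ck k (partial_deriv i (\<lambda>x. f x * g x))" for i
    unfolding partial_deriv_mult[OF Suc.prems]
    using Suc.prems by (intro Ck_add Suc.IH) (auto intro: Ck_SucD)
  moreover have "(\<lambda>x. f x * g x) differentiable (at x)" for x
    using has_derivative_mult[OF Ck_differentiable[OF Suc.prems(1)] Ck_differentiable[OF Suc.prems(2)]]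
    by (auto simp: differentiable_def)
  ultimately show ?case by simp
qed (auto intro: continuous_intros)

lemma Ck_prod: "(\<And>i. i \<in> I \<Longrightarrow> Ck k (f i)) \<Longrightarrow> Ck k (\<lambda>x. \<Prod>i\<in>I. f i x)"
  by (induction I rule: infinite_finite_induct) (auto intro: Ck_mult Ck_const)

text \<open>The derivative -f'/f^2 is a product of functions of class C^k once 1/f is known to be of
  class C^k, so the induction closes.\<close>

lemma Ck_inverse:
  assumes "Ck k f" "\<And>x. f x \<noteq> 0"
  shows "Ck k (\<lambda>x. inverse (f x))"
  using assms(1)
proof (induction k)
  case 0
  with assms(2) show ?case by (auto intro!: continuous_intros)
next
  case (Suc k)
  have d: "((\<lambda>x. inverse (f x)) has_derivative (\<lambda>h. - (inverse (f x) * frechet_derivative f (at x) h * inverse (f x)))) (at x)" for x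
    by (rule Deriv.has_derivative_inverse[OF assms(2) Ck_differentiable[OF Suc.prems]])
  have pd: "partial_deriv i (\<lambda>x. inverse (f x)) = (\<lambda>x. (-1) * (inverse (f x) * partial_deriv i f x * inverse (f x)))" for i
    by (rule ext, subst partial_deriv_eqI[OF d]) (simp add: partial_deriv_def)
  have "Ck k (partial_deriv i (\<lambda>x. inverse (f x)))" for i
    unfolding pd using Suc.prems Suc.IH[OF Ck_SucD[OF Suc.prems]]
    by (intro Ck_mult Ck_const) auto
  with d show ?case by (auto simp: differentiable_def)
qed

text \<open>Coordinates, plane waves and cutoffs are all assembled from ridge functions, which
  depend on x through a single linear form. Their partial derivatives reduce to derivatives in one
  variable.\<close>

lemma ridge_has_derivative:
  fixes \<kappa> :: "real^'n"
  assumes "(f has_real_derivative f') (at (\<kappa> \<bullet> x + d))"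
  shows "((\<lambda>x. f (\<kappa> \<bullet> x + d)) has_derivative (\<lambda>h. f' * (\<kappa> \<bullet> h))) (at x)"
proof -
  have "((\<lambda>x. \<kappa> \<bullet> x + d) has_derivative (\<lambda>h. \<kappa> \<bullet> h)) (at x)"
    by (auto intro!: derivative_eq_intros)
  from has_derivative_compose[OF this assms[unfolded has_field_derivative_def]] show ?thesis .
qed

lemma partial_deriv_ridge:
  fixes \<kappa> :: "real^'n"
  assumes "\<And>t. (f has_real_derivative f' t) (at t)"
  shows "partial_deriv i (\<lambda>x. f (\<kappa> \<bullet> x + d)) = (\<lambda>x. \<kappa> $ i * f' (\<kappa> \<bullet> x + d))"
  by (rule ext, subst partial_deriv_eqI[OF ridge_has_derivative[OF assms]]) (simp add: inner_axis)

text \<open>The map \<open>D\<close> on parameters represents differentiation inside the family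
  \<open>F\<close>. Keeping p arbitrary in the induction gives smoothness without a formula for the
  k-th derivative. The parameters are coefficient pairs for cosine and sine, and polynomials for
  \<open>exp_flat\<close>.\<close>

lemma Ck_ridge:
  fixes \<kappa> :: "real^'n"
  assumes "\<And>p t. (F p has_real_derivative F (D p) t) (at t)"
  shows "Ck k (\<lambda>x. F p (\<kappa> \<bullet> x + d))"
proof (induction k arbitrary: p)
  case 0
  have F: "continuous_on UNIV (F p)"
    using assms by (meson DERIV_isCont continuous_at_imp_continuous_on)
  have l: "continuous_on UNIV (\<lambda>x. \<kappa> \<bullet> x + d)" by (intro continuous_intros)
  show ?case
    unfolding Ck.simps by (rule continuous_on_compose2[OF F l]) simp
next
  case (Suc k)
  have "(\<lambda>x. F p (\<kappa> \<bullet> x + d)) differentiable (at x)" for x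
    using ridge_has_derivative[OF assms] differentiableI by blast
  with Suc show ?case
    by (simp add: partial_deriv_ridge[OF assms] Ck_mult Ck_const)
qed

lemma Ck_cos: "Ck k (\<lambda>x::real^'n. cos (\<kappa> \<bullet> x))"
  and Ck_sin: "Ck k (\<lambda>x::real^'n. sin (\<kappa> \<bullet> x))"
proof -
  have "((\<lambda>t. a * cos t + b * sin t) has_real_derivative b * cos t + (- a) * sin t) (at t)" for a b t :: real
    by (auto intro!: derivative_eq_intros)
  then have *: "Ck k (\<lambda>x::real^'n. fst p * cos (\<kappa> \<bullet> x + 0) + snd p * sin (\<kappa> \<bullet> x + 0))" for p
    by (intro Ck_ridge[where F = "\<lambda>p t. fst p * cos t + snd p * sin t" and D = "\<lambda>p. (snd p, - fst p)"]) auto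
  from *[of "(1,0)"] *[of "(0,1)"] show "Ck k (\<lambda>x::real^'n. cos (\<kappa> \<bullet> x))" "Ck k (\<lambda>x::real^'n. sin (\<kappa> \<bullet> x))"
    by auto
qed

lemma Ck_component: "Ck k (\<lambda>x::real^'n. x $ i)"
proof -
  have "((\<lambda>t. fst p * t + snd p) has_real_derivative fst (0, fst p) * t + snd (0, fst p)) (at t)" for p :: "real \<times> real" and t
    by (auto intro!: derivative_eq_intros)
  from Ck_ridge[where F = "\<lambda>p t. fst p * t + snd p" and D = "\<lambda>p. (0, fst p)" and p = "(1,0)" and \<kappa> = "axis i 1" and d = 0 and k = k, OF this]
  show ?thesis by (simp add: inner_axis' )
qed

lemma partial_deriv_component: "partial_deriv i (\<lambda>x::real^'n. x $ j) = (\<lambda>x. if i = j then 1 else 0)"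
proof -
  have "((\<lambda>x::real^'n. x $ j) has_derivative (\<lambda>h. h $ j)) (at x)" for x
    by (rule bounded_linear_imp_has_derivative) (rule bounded_linear_vec_nth)
  from partial_deriv_eqI[OF this] show ?thesis by (auto simp: axis_def)
qed

text \<open>An equivalence rather than an implication, so that it rewrites under the choice operator
  inside \<open>frechet_derivative\<close>; \<open>partial_deriv_translation\<close> then holds for
  arbitrary f.\<close>

lemma translation_has_derivative:
  "(f has_derivative f') (at (x + a)) \<longleftrightarrow> ((\<lambda>x. f (x + a)) has_derivative f') (at x)"
proof
  have s: "((\<lambda>x. x + a) has_derivative (\<lambda>h. h)) (at x)" for x a :: 'a
    by (auto intro!: derivative_eq_intros)
  show "(f has_derivative f') (at (x + a)) \<Longrightarrow> ((\<lambda>x. f (x + a)) has_derivative f') (at x)"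
    using has_derivative_compose[OF s] by auto
  assume "((\<lambda>x. f (x + a)) has_derivative f') (at x)"
  then have "((\<lambda>x. f (x + a)) has_derivative f') (at ((x + a) + - a))" by simp
  from has_derivative_compose[OF s this] show "(f has_derivative f') (at (x + a))" by simp
qed

lemma partial_deriv_translation:
  "partial_deriv i (\<lambda>x. f (x + a)) = (\<lambda>x. partial_deriv i f (x + a))"
  unfolding partial_deriv_def frechet_derivative_def translation_has_derivative by simp

lemma Ck_translation: "Ck k f \<Longrightarrow> Ck k (\<lambda>x. f (x + a))"
proof (induction k arbitrary: f)
  case 0
  have l: "continuous_on UNIV (\<lambda>x. x + a)" by (intro continuous_intros)
  show ?case
    using continuous_on_compose2[OF Ck_imp_continuous[OF 0] l] by simp
next
  case (Suc k)
  then show ?case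
    by (auto simp: partial_deriv_translation differentiable_def translation_has_derivative[symmetric])
qed

subsection \<open>Smooth cutoff functions\<close>

text \<open>This family contains \<open>exp (- 1/t)\<close> and is closed under differentiation, which gives smoothness
  at \<open>0\<close> from a single difference quotient.\<close>

definition exp_flat :: "real poly \<Rightarrow> real \<Rightarrow> real"
  where "exp_flat p t = (if t > 0 then poly p (inverse t) * exp (- inverse t) else 0)"

lemma poly_times_exp_neg_tendsto_0: "((\<lambda>t::real. poly p t * exp (- t)) \<longlongrightarrow> 0) at_top"
proof -
  have "((\<lambda>t. \<Sum>i\<le>degree p. coeff p i * (t ^ i / exp t)) \<longlongrightarrow> 0) at_top"
    by (rule tendsto_null_sum) (use tendsto_mult_right_zero[OF tendsto_power_div_exp_0] in simp)
  then show ?thesis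
    by (simp add: poly_altdef sum_distrib_right exp_minus divide_inverse mult.assoc)
qed

text \<open>For t > 0 the derivative of P(1/t) exp(-1/t) is t^(-2) (P - P')(1/t) exp(-1/t), and
  multiplication by \<open>[:0,0,1:]\<close> supplies the factor t^(-2).\<close>

lemma exp_flat_has_derivative:
  "(exp_flat p has_real_derivative exp_flat ([:0,0,1:] * (p - pderiv p)) t) (at t)"
proof -
  consider "t > 0" | "t < 0" | "t = 0" by linarith
  then show ?thesis
  proof cases
    case 1
    have "((\<lambda>t. poly p (inverse t) * exp (- inverse t)) has_real_derivative exp_flat ([:0,0,1:] * (p - pderiv p)) t) (at t)"
      using 1
      by (auto intro!: derivative_eq_intros DERIV_chain2[OF poly_DERIV] simp: exp_flat_def field_simps power2_eq_square)
    then show ?thesis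
      by (rule has_field_derivative_transform_within_open[of _ _ _ "{0<..}"]) (use 1 in \<open>auto simp: exp_flat_def\<close>)
  next
    case 2
    have "((\<lambda>t. 0) has_real_derivative 0) (at t)" by simp
    then have "(exp_flat p has_real_derivative 0) (at t)"
      by (rule has_field_derivative_transform_within_open[of _ _ _ "{..<0}"]) (use 2 in \<open>auto simp: exp_flat_def\<close>)
    then show ?thesis using 2 by (simp add: exp_flat_def)
  next
    case 3
    \<comment> \<open>The difference quotient at 0 is again of the form Q(1/h) exp(-1/h), with Q = X
      P: dividing by h multiplies the polynomial by its variable.\<close>
    have "((\<lambda>h. poly (pCons 0 p) (inverse h) * exp (- inverse h)) \<longlongrightarrow> 0) (at_right 0)"
      by (rule filterlim_compose[OF poly_times_exp_neg_tendsto_0 filterlim_inverse_at_top_right])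
    then have r: "((\<lambda>h. exp_flat p h / h) \<longlongrightarrow> 0) (at_right 0)"
      by (rule Lim_transform_eventually)
         (auto simp: exp_flat_def eventually_at_right_field field_simps intro!: exI[of _ 1])
    have "((\<lambda>h. exp_flat p h / h) \<longlongrightarrow> 0) (at_left 0)"
      by (rule Lim_transform_eventually[OF tendsto_const])
         (auto simp: exp_flat_def eventually_at_left_field intro!: exI[of _ "-1"])
    with r have "((\<lambda>h. exp_flat p h / h) \<longlongrightarrow> 0) (at 0)"
      by (simp add: filterlim_at_split)
    then show ?thesis using 3 by (simp add: DERIV_def exp_flat_def)
  qed
qed

lemma exp_flat_1: "exp_flat 1 t = (if t > 0 then exp (- inverse t) else 0)"
  by (simp add: exp_flat_def)

lemma exp_flat_1_bounds: "0 \<le> exp_flat 1 t" "exp_flat 1 t \<le> 1"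
  by (auto simp: exp_flat_1)

lemma Ck_exp_flat: "Ck k (\<lambda>x. exp_flat p (\<kappa> \<bullet> x + d))"
  by (rule Ck_ridge[where F = exp_flat, OF exp_flat_has_derivative])

text \<open>The standard smooth transition from 0 (for t at most 0) to 1 (for t at least 1). The
  denominator never vanishes because t or 1 - t is positive.\<close>

definition smooth_step :: "real \<Rightarrow> real"
  where "smooth_step t = exp_flat 1 t * inverse (exp_flat 1 t + exp_flat 1 (1 - t))"

lemma smooth_step_eq_0: "t \<le> 0 \<Longrightarrow> smooth_step t = 0"
  by (simp add: smooth_step_def exp_flat_1)

lemma smooth_step_eq_1: "t \<ge> 1 \<Longrightarrow> smooth_step t = 1"
  by (simp add: smooth_step_def exp_flat_1)

lemma Ck_smooth_step: "Ck k (\<lambda>x. smooth_step (\<kappa> \<bullet> x + d))"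
proof -
  have nz: "exp_flat 1 t + exp_flat 1 (1 - t) \<noteq> 0" for t
    by (cases "t > 0"; cases "1 - t > 0") (simp_all add: exp_flat_1 add_pos_pos less_imp_neq[symmetric])
  have "1 - (\<kappa> \<bullet> x + d) = (- \<kappa>) \<bullet> x + (1 - d)" for x by (simp add: algebra_simps)
  then have "Ck k (\<lambda>x. exp_flat 1 (1 - (\<kappa> \<bullet> x + d)))"
    using Ck_exp_flat[of k 1 "- \<kappa>" "1 - d"] by (simp only:)
  then show ?thesis
    unfolding smooth_step_def by (intro Ck_mult Ck_inverse Ck_add Ck_exp_flat nz)
qed

subsection \<open>Test functions\<close>

lemma test_function_Ck: "test_function \<phi> \<Longrightarrow> Ck k \<phi>"
  by (simp add: test_function_def)

lemma test_function_continuous: "test_function \<phi> \<Longrightarrow> continuous_on UNIV \<phi>"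
  using Ck_imp_continuous test_function_Ck by blast

lemma test_functionI:
  assumes "\<And>k. Ck k \<phi>" "\<And>x. x \<notin> cbox a b \<Longrightarrow> \<phi> x = 0"
  shows "test_function \<phi>"
proof -
  have "{x. \<phi> x \<noteq> 0} \<subseteq> cbox a b" using assms(2) by blast
  then have "closure {x. \<phi> x \<noteq> 0} \<subseteq> cbox a b" by (rule closure_minimal) (rule closed_cbox)
  then show ?thesis
    using assms(1) compact_Int_closed[OF compact_cbox[of a b] closed_closure[of "{x. \<phi> x \<noteq> 0}"]]
    by (simp add: test_function_def inf.absorb2)
qed

lemma test_function_support:
  assumes "test_function \<phi>"
  shows "\<exists>a b. \<forall>x. x \<notin> cbox a b \<longrightarrow> \<phi> x = 0"
proof -
  have "bounded {x. \<phi> x \<noteq> 0}"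
    using assms unfolding test_function_def by (meson bounded_subset closure_subset compact_imp_bounded)
  then obtain a where "{x. \<phi> x \<noteq> 0} \<subseteq> cbox (- a) a" using bounded_subset_cbox_symmetric by metis
  then show ?thesis by blast
qed

lemma test_function_mult:
  assumes "test_function \<phi>" "\<And>k. Ck k u"
  shows "test_function (\<lambda>x. u x * \<phi> x)"
proof -
  obtain a b where ab: "\<forall>x. x \<notin> cbox a b \<longrightarrow> \<phi> x = 0" using test_function_support[OF assms(1)] by (elim exE)
  show ?thesis
    by (rule test_functionI[of _ a b]) (auto simp: ab Ck_mult assms test_function_Ck)
qed

lemma test_function_partial_deriv:
  assumes "test_function \<phi>"
  shows "test_function (partial_deriv i \<phi>)"
proof -
  obtain a b where ab: "\<forall>x. x \<notin> cbox a b \<longrightarrow> \<phi> x = 0" using test_function_support[OF assms(1)] by (elim exE)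
  have "partial_deriv i \<phi> x = 0" if "x \<notin> cbox a b" for x
  proof -
    have "((\<lambda>x. 0::real) has_derivative (\<lambda>h. 0)) (at x)" by simp
    then have "(\<phi> has_derivative (\<lambda>h. 0)) (at x)"
      by (rule has_derivative_transform_within_open[of _ _ _ _ "- cbox a b"]) (use that ab in auto)
    then show ?thesis by (rule partial_deriv_eqI)
  qed
  moreover have "Ck k (partial_deriv i \<phi>)" for k
    using test_function_Ck[OF assms, of "Suc k"] by simp
  ultimately show ?thesis by (rule test_functionI[rotated])
qed

lemma test_function_translation:
  assumes "test_function \<phi>"
  shows "test_function (\<lambda>x. \<phi> (x + c))"
proof -
  obtain a b where ab: "\<forall>x. x \<notin> cbox a b \<longrightarrow> \<phi> x = 0" using test_function_support[OF assms(1)] by (elim exE)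
  have "x + c \<notin> cbox a b" if "x \<notin> cbox (a - c) (b - c)" for x
    using that by (simp add: mem_box inner_diff_left inner_add_left algebra_simps)
  then show ?thesis
    by (intro test_functionI[of _ "a - c" "b - c"] Ck_translation test_function_Ck[OF assms]) (use ab in blast)
qed

text \<open>Two flat exponentials per coordinate, one for each face, steepened as n grows. Values in
  [0, 1] and pointwise convergence to the indicator of the open box let dominated convergence turn
  identities for test functions into identities for integrals over boxes.\<close>

definition box_cutoff :: "nat \<Rightarrow> real^'n \<Rightarrow> real^'n \<Rightarrow> real^'n \<Rightarrow> real"
  where "box_cutoff n a b x =
    (\<Prod>i\<in>UNIV. exp_flat 1 (real (Suc n) * (x $ i - a $ i)) * exp_flat 1 (real (Suc n) * (b $ i - x $ i)))"

lemma box_cutoff_eq_0: "x \<notin> box a b \<Longrightarrow> box_cutoff n a b x = 0"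
  by (auto simp: box_cutoff_def exp_flat_1 mem_box_cart zero_less_mult_iff)

lemma test_function_box_cutoff: "test_function (box_cutoff n a b)"
proof (rule test_functionI[of _ a b])
  show "box_cutoff n a b x = 0" if "x \<notin> cbox a b" for x
    using that box_cutoff_eq_0 box_subset_cbox by blast
  have 1: "real (Suc n) * (x $ i - a $ i) = (Suc n *\<^sub>R axis i 1) \<bullet> x + (- (Suc n * a $ i))" for x i
    by (simp add: inner_axis' algebra_simps)
  have 2: "real (Suc n) * (b $ i - x $ i) = (- (Suc n *\<^sub>R axis i 1)) \<bullet> x + Suc n * b $ i" for x i
    by (simp add: inner_axis' algebra_simps)
  show "Ck k (box_cutoff n a b)" for k
    unfolding box_cutoff_def 1 2 by (intro Ck_prod Ck_mult Ck_exp_flat)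
qed

lemma box_cutoff_bounds: "0 \<le> box_cutoff n a b x" "box_cutoff n a b x \<le> 1"
  unfolding box_cutoff_def
  by (auto intro!: prod_nonneg prod_le_1 mult_le_one mult_nonneg_nonneg exp_flat_1_bounds)

lemma box_cutoff_tendsto: "(\<lambda>n. box_cutoff n a b x) \<longlonglongrightarrow> indicator (box a b) x"
proof (cases "x \<in> box a b")
  case True
  have e: "(\<lambda>n. exp_flat 1 (real (Suc n) * s)) \<longlonglongrightarrow> 1" if "s > 0" for s :: real
  proof -
    have "(\<lambda>n. exp (- (inverse s * inverse (real (Suc n))))) \<longlonglongrightarrow> exp (- (inverse s * 0))"
      by (intro tendsto_intros LIMSEQ_inverse_real_of_nat)
    moreover have "exp_flat 1 (real (Suc n) * s) = exp (- (inverse s * inverse (real (Suc n))))" for n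
      using that unfolding exp_flat_1 by (simp add: field_simps add_pos_nonneg)
    ultimately show ?thesis by simp
  qed
  have "(\<lambda>n. box_cutoff n a b x) \<longlonglongrightarrow> (\<Prod>i\<in>(UNIV::'a set). 1 * 1)"
    unfolding box_cutoff_def using True by (intro tendsto_intros e) (auto simp: mem_box_cart)
  then show ?thesis using True by simp
qed (simp add: box_cutoff_eq_0)

subsection \<open>Translations and local integrability\<close>

lemma
  fixes a :: "'a::euclidean_space"
  shows measurable_lebesgue_translation: "(\<lambda>x. x + a) \<in> lebesgue \<rightarrow>\<^sub>M lebesgue"
    and distr_lebesgue_translation: "distr lebesgue lebesgue (\<lambda>x. x + a) = lebesgue"
proof -
  \<comment> \<open>Presents the translation as the affine map with unit scaling along every basis
    vector; its determinant factor is 1.\<close>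
  have T: "(\<lambda>x. a + (\<Sum>j\<in>Basis. (1 * (x \<bullet> j)) *\<^sub>R j)) = (\<lambda>x. x + a)"
    by (simp add: euclidean_representation add.commute)
  show "(\<lambda>x. x + a) \<in> lebesgue \<rightarrow>\<^sub>M lebesgue"
    using lebesgue_affine_measurable[of "\<lambda>_. 1" a] unfolding T by simp
  show "distr lebesgue lebesgue (\<lambda>x. x + a) = lebesgue"
    using lebesgue_affine_euclidean[of "\<lambda>_. 1" a] unfolding T by (simp add: density_1)
qed

lemma measurable_lebesgue_compose_translation:
  fixes a :: "'a::euclidean_space"
  shows "f \<in> lebesgue \<rightarrow>\<^sub>M N \<Longrightarrow> (\<lambda>x. f (x + a)) \<in> lebesgue \<rightarrow>\<^sub>M N"
  by (rule measurable_compose[OF measurable_lebesgue_translation])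

lemma AE_lebesgue_translation:
  fixes a :: "'a::euclidean_space"
  shows "AE x in lebesgue. P x \<Longrightarrow> AE x in lebesgue. P (x + a)"
  using AE_distrD[OF measurable_lebesgue_translation[of a], of P] unfolding distr_lebesgue_translation .

lemma nn_integral_lebesgue_translation:
  fixes a :: "'a::euclidean_space"
  assumes "f \<in> borel_measurable lebesgue"
  shows "(\<integral>\<^sup>+x. f (x + a) \<partial>lebesgue) = (\<integral>\<^sup>+x. f x \<partial>lebesgue)"
  using nn_integral_distr[OF measurable_lebesgue_translation[of a], of f] assms
  unfolding distr_lebesgue_translation by simp

lemma integral_lebesgue_translation:
  fixes a :: "'a::euclidean_space" and f :: "'a \<Rightarrow> 'b::{banach, second_countable_topology}"
  assumes "f \<in> borel_measurable lebesgue"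
  shows "(LINT x|lebesgue. f (x + a)) = (LINT x|lebesgue. f x)"
  using integral_distr[OF measurable_lebesgue_translation[of a] assms]
  unfolding distr_lebesgue_translation by simp

lemma integrable_lebesgue_translation:
  fixes a :: "'a::euclidean_space" and f :: "'a \<Rightarrow> 'b::{banach, second_countable_topology}"
  assumes "integrable lebesgue f"
  shows "integrable lebesgue (\<lambda>x. f (x + a))"
  using integrable_distr[OF measurable_lebesgue_translation[of a], of f] assms
  unfolding distr_lebesgue_translation by simp

lemma in_Lp_1_iff: "in_Lp 1 S f \<longleftrightarrow> set_integrable lebesgue S f"
proof -
  have "norm (indicator S x *\<^sub>R f x) = indicator S x *\<^sub>R norm (f x)" for x
    by (simp add: indicator_def)
  then show ?thesis
    unfolding in_Lp_def set_integrable_def set_borel_measurable_def power_one_right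
    using integrable_norm_iff[of "\<lambda>x. indicator S x *\<^sub>R f x" lebesgue]
    by (auto intro: borel_measurable_integrable)
qed

text \<open>f is the pointwise limit of its restrictions to growing cubes; at each point the
  sequence is eventually constant.\<close>

lemma borel_measurable_lebesgue_local:
  fixes f :: "'a::euclidean_space \<Rightarrow> 'b::{banach, second_countable_topology}"
  assumes "\<And>a b. set_borel_measurable lebesgue (cbox a b) f"
  shows "f \<in> borel_measurable lebesgue"
proof (rule borel_measurable_LIMSEQ_metric)
  show "(\<lambda>x. indicator (cbox (- real n *\<^sub>R One) (real n *\<^sub>R One)) x *\<^sub>R f x) \<in> borel_measurable lebesgue" for n
    using assms by (simp add: set_borel_measurable_def)
  show "(\<lambda>n. indicator (cbox (- real n *\<^sub>R One) (real n *\<^sub>R One)) x *\<^sub>R f x) \<longlonglongrightarrow> f x" for x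
  proof -
    obtain m :: nat where m: "norm x \<le> m" using real_arch_simple by blast
    have "x \<in> cbox (- real n *\<^sub>R One) (real n *\<^sub>R One)" if "n \<ge> m" for n
    proof -
      have "\<bar>x \<bullet> i\<bar> \<le> real n" if "i \<in> Basis" for i
        using Basis_le_norm[OF that, of x] m \<open>n \<ge> m\<close> by linarith
      then show ?thesis by (auto simp: mem_box abs_le_iff minus_le_iff)
    qed
    then have "eventually (\<lambda>n. indicator (cbox (- real n *\<^sub>R One) (real n *\<^sub>R One)) x *\<^sub>R f x = f x) sequentially"
      by (auto simp: eventually_sequentially intro!: exI[of _ m])
    then show ?thesis by (rule tendsto_eventually)
  qed
qed

text \<open>Every compact set lies in a box, so boxes suffice, and measurability on all boxes is
  measurability on the whole space.\<close>

lemma in_Lp_loc_iff: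
  "in_Lp_loc p f \<longleftrightarrow> f \<in> borel_measurable lebesgue \<and>
    (\<forall>a b. set_integrable lebesgue (cbox a b) (\<lambda>x. norm (f x) ^ p))"
proof safe
  assume f: "in_Lp_loc p f"
  then have *: "in_Lp p (cbox a b) f" for a b
    by (simp add: in_Lp_loc_def)
  then show "f \<in> borel_measurable lebesgue" "set_integrable lebesgue (cbox a b) (\<lambda>x. norm (f x) ^ p)" for a b
    by (auto simp: in_Lp_def intro: borel_measurable_lebesgue_local)
next
  assume f: "f \<in> borel_measurable lebesgue" "\<forall>a b. set_integrable lebesgue (cbox a b) (\<lambda>x. norm (f x) ^ p)"
  show "in_Lp_loc p f"
    unfolding in_Lp_loc_def in_Lp_def
  proof (intro allI impI conjI)
    fix K :: "(real^'a) set" assume K: "compact K"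
    then have s: "K \<in> sets lebesgue" by (simp add: borel_compact)
    then show "set_borel_measurable lebesgue K f"
      using f(1) by (simp add: set_borel_measurable_def)
    obtain a where "K \<subseteq> cbox (- a) a" using K bounded_subset_cbox_symmetric compact_imp_bounded by metis
    then show "set_integrable lebesgue K (\<lambda>x. norm (f x) ^ p)"
      using f(2) s set_integrable_subset by blast
  qed
qed

lemma in_Lp_loc_measurable: "in_Lp_loc p f \<Longrightarrow> f \<in> borel_measurable lebesgue"
  by (simp add: in_Lp_loc_iff)

lemma in_Lp_loc_1_iff: "in_Lp_loc 1 f \<longleftrightarrow> (\<forall>a b. set_integrable lebesgue (cbox a b) f)"
proof
  show "\<forall>a b. set_integrable lebesgue (cbox a b) f" if "in_Lp_loc 1 f"
    using that compact_cbox unfolding in_Lp_loc_def in_Lp_1_iff by metis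
  assume f: "\<forall>a b. set_integrable lebesgue (cbox a b) f"
  then have *: "in_Lp 1 (cbox a b) f" for a b by (simp only: in_Lp_1_iff)
  then have "f \<in> borel_measurable lebesgue"
    by (intro borel_measurable_lebesgue_local) (simp add: in_Lp_def)
  with * show "in_Lp_loc 1 f"
    unfolding in_Lp_loc_iff in_Lp_def by simp
qed

lemma in_Lp_loc_1_add: "in_Lp_loc 1 f \<Longrightarrow> in_Lp_loc 1 g \<Longrightarrow> in_Lp_loc 1 (\<lambda>x. f x + g x)"
  unfolding in_Lp_loc_1_iff by auto

lemma in_Lp_loc_1_scaleR: "in_Lp_loc 1 f \<Longrightarrow> in_Lp_loc 1 (\<lambda>x. c *\<^sub>R f x)"
  unfolding in_Lp_loc_1_iff by auto

lemma in_Lp_loc_1_continuous: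
  assumes "continuous_on UNIV f"
  shows "in_Lp_loc 1 f"
  unfolding in_Lp_loc_1_iff
proof (intro allI)
  fix a b :: "real^'a"
  have "set_integrable lborel (cbox a b) f"
    unfolding set_integrable_def
    by (rule borel_integrable_compact) (use assms continuous_on_subset in auto)
  then show "set_integrable lebesgue (cbox a b) f"
    unfolding set_integrable_def by (simp add: integrable_completion borel_measurable_integrable)
qed

lemma in_Lp_loc_1_component:
  fixes G :: "real^'n \<Rightarrow> real^'m"
  shows "in_Lp_loc 1 G \<Longrightarrow> in_Lp_loc 1 (\<lambda>x. G x $ i)"
proof -
  assume "in_Lp_loc 1 G"
  moreover have "integrable lebesgue (\<lambda>x. (indicator (cbox a b) x *\<^sub>R G x) $ i)"
    if "integrable lebesgue (\<lambda>x. indicator (cbox a b) x *\<^sub>R G x)" for a b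
    using integrable_bounded_linear[OF bounded_linear_vec_nth that] by simp
  ultimately show ?thesis
    unfolding in_Lp_loc_1_iff set_integrable_def by simp
qed

lemma in_Lp_loc_1_translation:
  assumes "in_Lp_loc 1 f"
  shows "in_Lp_loc 1 (\<lambda>x. f (x + c))"
  unfolding in_Lp_loc_1_iff
proof (intro allI)
  fix a b
  have "set_integrable lebesgue (cbox (a + c) (b + c)) f"
    using assms unfolding in_Lp_loc_1_iff by blast
  moreover have "x + c \<in> cbox (a + c) (b + c) \<longleftrightarrow> x \<in> cbox a b" for x
    by (simp add: mem_box inner_add_left)
  ultimately show "set_integrable lebesgue (cbox a b) (\<lambda>x. f (x + c))"
    using integrable_lebesgue_translation[where a = c and f = "\<lambda>x. indicator (cbox (a + c) (b + c)) x *\<^sub>R f x"]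
    by (simp add: set_integrable_def indicator_def)
qed

lemma integrable_mult_bounded_support:
  assumes f: "in_Lp_loc 1 f" and z: "\<zeta> \<in> borel_measurable lebesgue" "\<And>x. \<bar>\<zeta> x\<bar> \<le> M"
    "\<And>x. x \<notin> cbox a b \<Longrightarrow> \<zeta> x = 0"
  shows "integrable lebesgue (\<lambda>x. \<zeta> x *\<^sub>R f x)"
proof (rule Bochner_Integration.integrable_bound)
  show "integrable lebesgue (\<lambda>x. M *\<^sub>R (indicator (cbox a b) x *\<^sub>R f x))"
    using f unfolding in_Lp_loc_1_iff set_integrable_def by (intro integrable_scaleR_right) blast
  show "(\<lambda>x. \<zeta> x *\<^sub>R f x) \<in> borel_measurable lebesgue"
    using z(1) in_Lp_loc_measurable[OF f] by simp
  have "norm (\<zeta> x *\<^sub>R f x) \<le> norm (M *\<^sub>R indicat_real (cbox a b) x *\<^sub>R f x)" for x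
    using z(2)[of x] z(3)[of x] by (auto simp: indicator_def intro!: mult_right_mono)
  then show "AE x in lebesgue. norm (\<zeta> x *\<^sub>R f x) \<le> norm (M *\<^sub>R indicat_real (cbox a b) x *\<^sub>R f x)"
    by simp
qed

lemma continuous_measurable_lebesgue:
  fixes f :: "'a::euclidean_space \<Rightarrow> 'b::real_normed_vector"
  shows "continuous_on UNIV f \<Longrightarrow> f \<in> borel_measurable lebesgue"
  by (rule measurable_completion) (simp add: borel_measurable_continuous_onI)

lemma test_function_measurable: "test_function \<phi> \<Longrightarrow> \<phi> \<in> borel_measurable lebesgue"
  by (rule continuous_measurable_lebesgue[OF test_function_continuous])

lemma test_function_bounded:
  assumes "test_function \<phi>"
  shows "\<exists>M. \<forall>x. \<bar>\<phi> x\<bar> \<le> M"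
proof -
  obtain a b where ab: "\<forall>x. x \<notin> cbox a b \<longrightarrow> \<phi> x = 0" using test_function_support[OF assms] by blast
  have "compact (\<phi> ` cbox a b)"
    using test_function_continuous[OF assms] continuous_on_subset by (blast intro: compact_continuous_image compact_cbox)
  then obtain M where M: "\<forall>y\<in>\<phi> ` cbox a b. \<bar>y\<bar> \<le> M" using compact_imp_bounded bounded_real by metis
  have "\<bar>\<phi> x\<bar> \<le> max M 0" for x using ab M by (cases "x \<in> cbox a b") (auto simp: le_max_iff_disj)
  then show ?thesis by blast
qed

lemma integrable_test_function_mult:
  assumes "in_Lp_loc 1 f" "test_function \<phi>"
  shows "integrable lebesgue (\<lambda>x. \<phi> x *\<^sub>R f x)"
proof -
  obtain a b where ab: "\<forall>x. x \<notin> cbox a b \<longrightarrow> \<phi> x = 0" using test_function_support[OF assms(2)] by blast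
  obtain M where "\<forall>x. \<bar>\<phi> x\<bar> \<le> M" using test_function_bounded[OF assms(2)] by blast
  with ab show ?thesis
    using integrable_mult_bounded_support[OF assms(1) test_function_measurable[OF assms(2)]] by blast
qed

lemma integrable_mult_test_function:
  fixes f :: "real^'n \<Rightarrow> real"
  shows "in_Lp_loc 1 f \<Longrightarrow> test_function \<phi> \<Longrightarrow> integrable lebesgue (\<lambda>x. f x * \<phi> x)"
  using integrable_test_function_mult[of f \<phi>] by (simp add: mult.commute)

subsection \<open>Weak gradients\<close>

text \<open>Testing with \<open>box_cutoff\<close> and passing to the limit makes the integral of f
  over every box vanish. By Lebesgue differentiation the averages over cubes with corner x converge
  to f x outside a negligible set; as these averages are all 0, so is f x.\<close>

lemma fundamental_lemma:
  fixes f :: "real^'n \<Rightarrow> real"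
  assumes f: "in_Lp_loc 1 f" and 0: "\<And>\<phi>. test_function \<phi> \<Longrightarrow> (LINT x|lebesgue. f x * \<phi> x) = 0"
  shows "AE x in lebesgue. f x = 0"
proof -
  have i: "set_integrable lebesgue (cbox a b) f" for a b
    using f unfolding in_Lp_loc_1_iff by blast
  have ib: "set_integrable lebesgue (box a b) f" for a b
    by (rule set_integrable_subset[OF i[of a b]]) (auto simp: box_subset_cbox)
  have z: "integral (cbox a b) f = 0" for a b
  proof -
    have "(\<lambda>n. LINT x|lebesgue. f x * box_cutoff n a b x) \<longlonglongrightarrow> (LINT x|lebesgue. indicator (box a b) x *\<^sub>R f x)"
    proof (rule integral_dominated_convergence)
      show "(\<lambda>x. f x * box_cutoff n a b x) \<in> borel_measurable lebesgue" for n
        by (intro borel_measurable_times in_Lp_loc_measurable[OF f] test_function_measurable[OF test_function_box_cutoff])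
      show "(\<lambda>x. indicator (box a b) x *\<^sub>R f x) \<in> borel_measurable lebesgue"
        by (intro borel_measurable_scaleR borel_measurable_indicator in_Lp_loc_measurable[OF f]) simp
      show "integrable lebesgue (\<lambda>x. norm (indicator (box a b) x *\<^sub>R f x))"
        using ib unfolding set_integrable_def by (rule integrable_norm)
      show "AE x in lebesgue. (\<lambda>n. f x * box_cutoff n a b x) \<longlonglongrightarrow> indicator (box a b) x *\<^sub>R f x"
        by (rule AE_I2, subst real_scaleR_def, subst mult.commute) (intro tendsto_intros box_cutoff_tendsto)
      show "AE x in lebesgue. norm (f x * box_cutoff n a b x) \<le> norm (indicator (box a b) x *\<^sub>R f x)" for n
      proof (rule AE_I2)
        fix x
        show "norm (f x * box_cutoff n a b x) \<le> norm (indicator (box a b) x *\<^sub>R f x)"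
          using box_cutoff_bounds[of n a b x] box_cutoff_eq_0[of x a b n]
          by (cases "x \<in> box a b") (auto simp: abs_mult intro!: mult_left_le)
      qed
    qed
    then have "(LINT x:box a b|lebesgue. f x) = 0"
      using 0[OF test_function_box_cutoff] by (simp add: LIMSEQ_const_iff set_lebesgue_integral_def)
    then show ?thesis
      using set_lebesgue_integral_eq_integral(2)[OF ib] by (simp add: integral_open_interval)
  qed
  have "f integrable_on cbox a b" for a b
    using set_lebesgue_integral_eq_integral(1)[OF i] .
  then obtain N where N: "negligible N"
    "\<And>x e. x \<notin> N \<Longrightarrow> 0 < e \<Longrightarrow> \<exists>d>0. \<forall>h. 0 < h \<and> h < d \<longrightarrow>
       norm (integral (cbox x (x + h *\<^sub>R One)) f /\<^sub>R h ^ DIM(real^'n) - f x) < e"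
    by (rule integrable_ccontinuous_explicit) blast
  have "f x = 0" if "x \<notin> N" for x
  proof (rule ccontr)
    assume "f x \<noteq> 0"
    with N(2)[OF that, of "\<bar>f x\<bar>"] obtain d where "d > 0" and
      d: "\<And>h. 0 < h \<and> h < d \<Longrightarrow> norm (integral (cbox x (x + h *\<^sub>R One)) f /\<^sub>R h ^ DIM(real^'n) - f x) < \<bar>f x\<bar>"
      by auto
    from d[of "d/2"] \<open>d > 0\<close> show False by (simp add: z)
  qed
  then have "{x. f x \<noteq> 0} \<subseteq> N" by blast
  then show ?thesis
    using N(1) AE_I'[of N lebesgue "\<lambda>x. f x = 0"] by (simp add: negligible_iff_null_sets)
qed

lemma AE_vec_eqI:
  fixes G G' :: "'a \<Rightarrow> 'b^'n"
  assumes "\<And>i. AE x in M. G x $ i = G' x $ i"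
  shows "AE x in M. G x = G' x"
proof -
  have "AE x in M. \<forall>i\<in>UNIV. G x $ i = G' x $ i"
    by (rule AE_finite_allI) (auto simp: assms)
  then show ?thesis by (simp add: vec_eq_iff)
qed

lemma has_weak_gradientD:
  assumes "has_weak_gradient f G"
  shows "in_Lp_loc 1 f" "in_Lp_loc 1 G"
    "test_function \<phi> \<Longrightarrow> (LINT x|lebesgue. f x * partial_deriv i \<phi> x) = - (LINT x|lebesgue. G x $ i * \<phi> x)"
  using assms unfolding has_weak_gradient_def by auto

lemma weak_gradient_unique:
  assumes "has_weak_gradient f G" "has_weak_gradient f G'"
  shows "AE x in lebesgue. G x = G' x"
proof (rule AE_vec_eqI)
  fix i
  note c = has_weak_gradientD(2)[OF assms(1), THEN in_Lp_loc_1_component, of i]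
    has_weak_gradientD(2)[OF assms(2), THEN in_Lp_loc_1_component, of i]
  have "in_Lp_loc 1 (\<lambda>x. G x $ i - G' x $ i)"
    using in_Lp_loc_1_add[OF c(1) in_Lp_loc_1_scaleR[OF c(2), of "-1"]] by simp
  moreover have "(LINT x|lebesgue. (G x $ i - G' x $ i) * \<phi> x) = 0" if "test_function \<phi>" for \<phi>
    using has_weak_gradientD(3)[OF assms(1) that, of i] has_weak_gradientD(3)[OF assms(2) that, of i]
      integrable_mult_test_function[OF c(1) that] integrable_mult_test_function[OF c(2) that]
    by (simp add: left_diff_distrib)
  ultimately have "AE x in lebesgue. G x $ i - G' x $ i = 0"
    by (rule fundamental_lemma)
  then show "AE x in lebesgue. G x $ i = G' x $ i" by simp
qed

lemma has_weak_gradient_weak_gradient: "has_weak_gradient f G \<Longrightarrow> has_weak_gradient f (weak_gradient f)"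
  unfolding weak_gradient_def by (rule someI[where P = "has_weak_gradient f"])

lemma has_weak_gradient_add:
  assumes "has_weak_gradient f F" "has_weak_gradient g G"
  shows "has_weak_gradient (\<lambda>x. f x + g x) (\<lambda>x. F x + G x)"
  unfolding has_weak_gradient_def
proof (intro conjI allI impI)
  fix \<phi> :: "real^'a \<Rightarrow> real" and i assume \<phi>: "test_function \<phi>"
  note d\<phi> = test_function_partial_deriv[OF \<phi>, of i]
  note D1 = has_weak_gradientD[OF assms(1)] and D2 = has_weak_gradientD[OF assms(2)]
  show "(LINT x|lebesgue. (f x + g x) * partial_deriv i \<phi> x) = - (LINT x|lebesgue. (F x + G x) $ i * \<phi> x)"
    using D1(3)[OF \<phi>, of i] D2(3)[OF \<phi>, of i]
      integrable_mult_test_function[OF D1(1) d\<phi>] integrable_mult_test_function[OF D2(1) d\<phi>]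
      integrable_mult_test_function[OF in_Lp_loc_1_component[OF D1(2)] \<phi>, of i]
      integrable_mult_test_function[OF in_Lp_loc_1_component[OF D2(2)] \<phi>, of i]
    by (simp add: distrib_right)
qed (use assms in_Lp_loc_1_add has_weak_gradientD in blast)+

lemma has_weak_gradient_cmult:
  assumes "has_weak_gradient f F"
  shows "has_weak_gradient (\<lambda>x. c * f x) (\<lambda>x. c *\<^sub>R F x)"
  unfolding has_weak_gradient_def
  using has_weak_gradientD[OF assms] in_Lp_loc_1_scaleR[of f c] in_Lp_loc_1_scaleR[of F c]
  by (auto simp: mult.assoc)

lemma has_weak_gradient_cong:
  assumes "has_weak_gradient f G" "AE x in lebesgue. f x = f' x" "in_Lp_loc 1 f'"
  shows "has_weak_gradient f' G"
proof -
  have "(LINT x|lebesgue. f' x * partial_deriv i \<phi> x) = (LINT x|lebesgue. f x * partial_deriv i \<phi> x)"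
    if "test_function \<phi>" for \<phi> i
  proof (rule integral_cong_AE)
    show "(\<lambda>x. f' x * partial_deriv i \<phi> x) \<in> borel_measurable lebesgue"
      "(\<lambda>x. f x * partial_deriv i \<phi> x) \<in> borel_measurable lebesgue"
      using assms in_Lp_loc_measurable has_weak_gradientD(1) test_function_measurable[OF test_function_partial_deriv[OF that]]
      by (auto intro!: borel_measurable_times)
    show "AE x in lebesgue. f' x * partial_deriv i \<phi> x = f x * partial_deriv i \<phi> x"
      using assms(2) by eventually_elim simp
  qed
  then show ?thesis
    using assms(3) has_weak_gradientD[OF assms(1)] unfolding has_weak_gradient_def by simp
qed

lemma has_weak_gradient_translation:
  assumes "has_weak_gradient f G"
  shows "has_weak_gradient (\<lambda>x. f (x + c)) (\<lambda>x. G (x + c))"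
  unfolding has_weak_gradient_def
proof (intro conjI allI impI)
  note D = has_weak_gradientD[OF assms]
  show "in_Lp_loc 1 (\<lambda>x. f (x + c))" "in_Lp_loc 1 (\<lambda>x. G (x + c))"
    by (intro in_Lp_loc_1_translation D)+
  fix \<phi> :: "real^'a \<Rightarrow> real" and i assume \<phi>: "test_function \<phi>"
  define \<psi> where "\<psi> = (\<lambda>x. \<phi> (x + - c))"
  have \<psi>: "test_function \<psi>" unfolding \<psi>_def by (rule test_function_translation[OF \<phi>])
  have p: "partial_deriv i \<psi> (x + c) = partial_deriv i \<phi> x" "\<psi> (x + c) = \<phi> x" for x
    unfolding \<psi>_def partial_deriv_translation by simp_all
  have "(LINT x|lebesgue. f (x + c) * partial_deriv i \<phi> x) = (LINT x|lebesgue. f x * partial_deriv i \<psi> x)"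
    using integral_lebesgue_translation[of "\<lambda>x. f x * partial_deriv i \<psi> x" c]
      integrable_mult_test_function[OF D(1) test_function_partial_deriv[OF \<psi>]]
    by (simp add: p borel_measurable_integrable)
  moreover have "(LINT x|lebesgue. G (x + c) $ i * \<phi> x) = (LINT x|lebesgue. G x $ i * \<psi> x)"
    using integral_lebesgue_translation[of "\<lambda>x. G x $ i * \<psi> x" c]
      integrable_mult_test_function[OF in_Lp_loc_1_component[OF D(2)] \<psi>]
    by (simp add: p borel_measurable_integrable)
  ultimately show "(LINT x|lebesgue. f (x + c) * partial_deriv i \<phi> x) = - (LINT x|lebesgue. G (x + c) $ i * \<phi> x)"
    using D(3)[OF \<psi>] by simp
qed

text \<open>Difference quotients have integral 0 by translation invariance. They converge to the
  partial derivative and, by the mean value theorem, are bounded by its maximum on a fixed box, so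
  dominated convergence applies.\<close>

lemma integral_partial_deriv_test_function:
  assumes \<phi>: "test_function \<phi>"
  shows "(LINT x|lebesgue. partial_deriv i \<phi> x) = 0"
proof -
  define e :: "real^'a" where "e = axis i 1"
  define h where "h n = inverse (real (Suc n))" for n
  have h: "h n > 0" "h n \<le> 1" "h \<longlonglongrightarrow> 0" for n
    using LIMSEQ_inverse_real_of_nat by (auto simp: h_def[abs_def] field_simps)
  have int: "integrable lebesgue \<psi>" if "test_function \<psi>" for \<psi> :: "real^'a \<Rightarrow> real"
    using integrable_mult_test_function[OF in_Lp_loc_1_continuous that, of "\<lambda>_. 1"] by simp
  have z: "(LINT x|lebesgue. (\<phi> (x + h n *\<^sub>R e) - \<phi> x) / h n) = 0" for n
    using int[OF test_function_translation[OF \<phi>]] int[OF \<phi>]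
      integral_lebesgue_translation[OF test_function_measurable[OF \<phi>]] by simp
  have line: "((\<lambda>t. \<phi> (x + t *\<^sub>R e)) has_real_derivative partial_deriv i \<phi> (x + t *\<^sub>R e)) (at t)" for x t
  proof -
    have 1: "((\<lambda>t. x + t *\<^sub>R e) has_derivative (\<lambda>s. s *\<^sub>R e)) (at t)"
      by (auto intro!: derivative_eq_intros)
    note d = Ck_differentiable[OF test_function_Ck[OF \<phi>], of "x + t *\<^sub>R e"]
    have "linear (frechet_derivative \<phi> (at (x + t *\<^sub>R e)))"
      using d has_derivative_linear by blast
    then have "(\<lambda>s. frechet_derivative \<phi> (at (x + t *\<^sub>R e)) (s *\<^sub>R e)) = (*) (partial_deriv i \<phi> (x + t *\<^sub>R e))"
      by (auto simp: partial_deriv_def e_def linear_scale)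
    with has_derivative_compose[OF 1 d] show ?thesis by (simp add: has_field_derivative_def)
  qed
  obtain a b where ab: "\<forall>x. x \<notin> cbox a b \<longrightarrow> \<phi> x = 0" using test_function_support[OF \<phi>] by blast
  obtain M where M: "\<forall>x. \<bar>partial_deriv i \<phi> x\<bar> \<le> M"
    using test_function_bounded[OF test_function_partial_deriv[OF \<phi>]] by blast
  have "(\<lambda>n. LINT x|lebesgue. (\<phi> (x + h n *\<^sub>R e) - \<phi> x) / h n) \<longlonglongrightarrow> (LINT x|lebesgue. partial_deriv i \<phi> x)"
  proof (rule integral_dominated_convergence)
    show "(\<lambda>x. (\<phi> (x + h n *\<^sub>R e) - \<phi> x) / h n) \<in> borel_measurable lebesgue" for n
      using test_function_measurable[OF test_function_translation[OF \<phi>]] test_function_measurable[OF \<phi>] by simp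
    show "partial_deriv i \<phi> \<in> borel_measurable lebesgue"
      by (rule test_function_measurable[OF test_function_partial_deriv[OF \<phi>]])
    \<comment> \<open>The box is extended downward by \<open>e\<close> because the shift by
      \<open>h n *\<^sub>R e\<close> with \<open>h n \<le> 1\<close> can reach the support from at
      most one unit below it.\<close>
    show "integrable lebesgue (\<lambda>x. M * indicator (cbox (a - e) b) x)"
      by (intro integrable_mult_right integrable_real_indicator) (simp_all add: emeasure_lborel_cbox_finite[unfolded infinity_ennreal_def])
    show "AE x in lebesgue. (\<lambda>n. (\<phi> (x + h n *\<^sub>R e) - \<phi> x) / h n) \<longlonglongrightarrow> partial_deriv i \<phi> x"
    proof (rule AE_I2)
      fix x
      have "((\<lambda>s. (\<phi> (x + s *\<^sub>R e) - \<phi> x) / s) \<longlongrightarrow> partial_deriv i \<phi> x) (at 0)"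
        using line[of x 0] by (simp add: DERIV_def)
      moreover have "filterlim h (at 0) sequentially"
        using h by (auto simp: filterlim_at eventually_sequentially less_imp_neq[symmetric])
      ultimately show "(\<lambda>n. (\<phi> (x + h n *\<^sub>R e) - \<phi> x) / h n) \<longlonglongrightarrow> partial_deriv i \<phi> x"
        by (rule filterlim_compose)
    qed
    show "AE x in lebesgue. norm ((\<phi> (x + h n *\<^sub>R e) - \<phi> x) / h n) \<le> M * indicator (cbox (a - e) b) x" for n
    proof (rule AE_I2)
      fix x
      obtain t where "\<phi> (x + h n *\<^sub>R e) - \<phi> (x + 0 *\<^sub>R e) = (h n - 0) * partial_deriv i \<phi> (x + t *\<^sub>R e)"
        using MVT2[of 0 "h n" "\<lambda>t. \<phi> (x + t *\<^sub>R e)", OF h(1) line] by blast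
      then have le: "\<bar>(\<phi> (x + h n *\<^sub>R e) - \<phi> x) / h n\<bar> \<le> M"
        using M h(1)[of n] by simp
      moreover have "\<phi> (x + h n *\<^sub>R e) = 0 \<and> \<phi> x = 0" if out: "x \<notin> cbox (a - e) b"
      proof -
        have "x \<notin> cbox a b" "x + h n *\<^sub>R e \<notin> cbox a b"
        proof -
          obtain j where j: "x $ j < a $ j - e $ j \<or> x $ j > b $ j"
            using out unfolding mem_box_cart vector_minus_component by (metis not_le)
          have e: "0 \<le> h n * e $ j" "h n * e $ j \<le> e $ j" "0 \<le> e $ j"
            using h(1,2)[of n] by (auto simp: e_def axis_def)
          have "x $ j < a $ j \<or> x $ j > b $ j" "(x + h n *\<^sub>R e) $ j < a $ j \<or> (x + h n *\<^sub>R e) $ j > b $ j"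
            using j e by auto
          then show "x \<notin> cbox a b" "x + h n *\<^sub>R e \<notin> cbox a b"
            unfolding mem_box_cart by (meson not_le)+
        qed
        then show ?thesis using ab by blast
      qed
      ultimately show "norm ((\<phi> (x + h n *\<^sub>R e) - \<phi> x) / h n) \<le> M * indicator (cbox (a - e) b) x"
        by (cases "x \<in> cbox (a - e) b") auto
    qed
  qed
  then show ?thesis unfolding z by (simp add: LIMSEQ_const_iff)
qed

lemma has_weak_gradient_const: "has_weak_gradient (\<lambda>x. c) (\<lambda>x. 0)"
  unfolding has_weak_gradient_def
  by (intro conjI in_Lp_loc_1_continuous) (auto simp: integral_partial_deriv_test_function)

text \<open>The function x_j \<phi>(x) is itself a test function, so the integrals of its partial
  derivatives vanish; the product rule turns this into the defining identity for the coordinate x_j.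
  Linear combination gives the general case.\<close>

lemma has_weak_gradient_inner: "has_weak_gradient (\<lambda>x. B \<bullet> x) (\<lambda>x::real^'n. B)"
proof -
  have 1: "has_weak_gradient (\<lambda>x::real^'n. x $ j) (\<lambda>x. axis j 1)" for j
    unfolding has_weak_gradient_def
  proof (intro conjI allI impI)
    show "in_Lp_loc 1 (\<lambda>x::real^'n. x $ j)" "in_Lp_loc 1 (\<lambda>x::real^'n. axis j 1 :: real^'n)"
      by (intro in_Lp_loc_1_continuous continuous_intros)+
    fix \<phi> :: "real^'n \<Rightarrow> real" and i assume \<phi>: "test_function \<phi>"
    have pd: "partial_deriv i (\<lambda>x. x $ j * \<phi> x) = (\<lambda>x. x $ j * partial_deriv i \<phi> x + (if i = j then 1 else 0) * \<phi> x)"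
      by (subst partial_deriv_mult[OF Ck_component test_function_Ck[OF \<phi>]]) (simp add: partial_deriv_component)
    have "(LINT x|lebesgue. x $ j * partial_deriv i \<phi> x + (if i = j then 1 else 0) * \<phi> x) = 0"
      using integral_partial_deriv_test_function[OF test_function_mult[OF \<phi> Ck_component], of i j] unfolding pd .
    moreover have "integrable lebesgue (\<lambda>x. x $ j * partial_deriv i \<phi> x)" "integrable lebesgue (\<lambda>x. (if i = j then 1 else 0) * \<phi> x)"
      by (intro integrable_mult_test_function in_Lp_loc_1_continuous continuous_intros test_function_partial_deriv \<phi>)+
    ultimately show "(LINT x|lebesgue. x $ j * partial_deriv i \<phi> x) = - (LINT x|lebesgue. axis j 1 $ i * \<phi> x)"
      by (auto simp: axis_def)
  qed
  have "has_weak_gradient (\<lambda>x::real^'n. \<Sum>j\<in>J. B $ j * x $ j) (\<lambda>x. \<Sum>j\<in>J. B $ j *\<^sub>R axis j 1)" for J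
    by (induction J rule: infinite_finite_induct)
       (auto intro!: has_weak_gradient_const has_weak_gradient_add has_weak_gradient_cmult 1)
  from this[of UNIV] show ?thesis
    by (simp add: inner_vec_def basis_expansion flip: scalar_mult_eq_scaleR)
qed

subsection \<open>Integrals of periodic functions\<close>

lemma int_lattice_iff_range: "int_lattice = range (\<lambda>(m, n). vector [real_of_int m, real_of_int n])"
proof (intro equalityI subsetI)
  fix k :: "real^2" assume "k \<in> int_lattice"
  then have "k $ 1 \<in> \<int>" "k $ 2 \<in> \<int>" by (auto simp: int_lattice_def)
  then obtain m n where "k $ 1 = of_int m" "k $ 2 = of_int n" by (auto elim!: Ints_cases)
  then have "k = (\<lambda>(m, n). vector [real_of_int m, real_of_int n]) (m, n)"
    by (simp add: vec_eq_iff forall_2)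
  then show "k \<in> range (\<lambda>(m, n). vector [real_of_int m, real_of_int n])" by blast
qed (auto simp: int_lattice_def forall_2)

lemma countable_int_lattice: "countable int_lattice"
  unfolding int_lattice_iff_range by (rule countable_image) simp

lemma finite_int_lattice_cbox: "finite (int_lattice \<inter> cbox a b)"
proof (rule finite_subset)
  show "int_lattice \<inter> cbox a b \<subseteq>
    (\<lambda>(m, n). vector [real_of_int m, real_of_int n]) ` ({\<lceil>a $ 1\<rceil>..\<lfloor>b $ 1\<rfloor>} \<times> {\<lceil>a $ 2\<rceil>..\<lfloor>b $ 2\<rfloor>})"
  proof
    fix k assume "k \<in> int_lattice \<inter> cbox a b"
    then obtain m n where k: "k = vector [real_of_int m, real_of_int n]" and "k \<in> cbox a b"
      by (auto simp: int_lattice_iff_range)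
    then have "m \<in> {\<lceil>a $ 1\<rceil>..\<lfloor>b $ 1\<rfloor>}" "n \<in> {\<lceil>a $ 2\<rceil>..\<lfloor>b $ 2\<rfloor>}"
      by (auto simp: mem_box_cart forall_2 le_floor_iff ceiling_le_iff)
    with k show "k \<in> (\<lambda>(m, n). vector [real_of_int m, real_of_int n]) ` ({\<lceil>a $ 1\<rceil>..\<lfloor>b $ 1\<rfloor>} \<times> {\<lceil>a $ 2\<rceil>..\<lfloor>b $ 2\<rfloor>})"
      by force
  qed
qed auto

lemma finite_int_lattice_norm_le: "finite {k \<in> int_lattice. norm k \<le> R}"
proof (rule finite_subset[OF _ finite_int_lattice_cbox])
  have "k \<in> cbox (vec (- R)) (vec R)" if "norm k \<le> R" for k :: "real^2"
  proof -
    have "\<bar>k $ i\<bar> \<le> R" for i using component_le_norm_cart[of k i] that by linarith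
    then show ?thesis by (simp add: mem_box_cart abs_le_iff minus_le_iff)
  qed
  then show "{k \<in> int_lattice. norm k \<le> R} \<subseteq> int_lattice \<inter> cbox (vec (- R)) (vec R)" by auto
qed

lemma int_lattice_norm_ge_1:
  assumes "k \<in> int_lattice" "k \<noteq> 0"
  shows "norm k \<ge> 1"
proof -
  obtain i where i: "k $ i \<noteq> 0" using assms(2) by (auto simp: vec_eq_iff)
  with assms(1) have "\<bar>k $ i\<bar> \<ge> 1"
    unfolding int_lattice_def using Ints_nonzero_abs_ge1 by blast
  then show ?thesis using component_le_norm_cart[of k i] by linarith
qed

lemma int_lattice_add: "k \<in> int_lattice \<Longrightarrow> l \<in> int_lattice \<Longrightarrow> k + l \<in> int_lattice"
  and int_lattice_uminus: "k \<in> int_lattice \<Longrightarrow> - k \<in> int_lattice"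
  and int_lattice_0: "0 \<in> int_lattice"
  and int_lattice_axis: "axis i 1 \<in> int_lattice"
  by (auto simp: int_lattice_def axis_def)

section \<open>Periodicity up to null sets\<close>

text \<open>Polymorphic in the codomain, unlike \<open>cell_periodic\<close>, so that it also covers
  gradients and \<open>ennreal\<close>-valued integrands.\<close>

definition periodic_AE :: "real \<Rightarrow> (real^2 \<Rightarrow> 'b) \<Rightarrow> bool"
  where "periodic_AE L f \<longleftrightarrow> (\<forall>i. AE x in lebesgue. f (x + L *\<^sub>R axis i 1) = f x)"

lemma cell_periodic_eq: "cell_periodic L f \<longleftrightarrow> periodic_AE L f"
  by (simp add: cell_periodic_def periodic_AE_def)

lemma periodic_AE_compose: "periodic_AE L f \<Longrightarrow> periodic_AE L (\<lambda>x. g (f x))"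
  unfolding periodic_AE_def
proof
  fix i assume "\<forall>i. AE x in lebesgue. f (x + L *\<^sub>R axis i 1) = f x"
  then have "AE x in lebesgue. f (x + L *\<^sub>R axis i 1) = f x" by blast
  then show "AE x in lebesgue. g (f (x + L *\<^sub>R axis i 1)) = g (f x)"
    by eventually_elim simp
qed

lemma periodic_AE_compose2: "periodic_AE L f \<Longrightarrow> periodic_AE L f' \<Longrightarrow> periodic_AE L (\<lambda>x. g (f x) (f' x))"
  unfolding periodic_AE_def
proof
  fix i assume "\<forall>i. AE x in lebesgue. f (x + L *\<^sub>R axis i 1) = f x" "\<forall>i. AE x in lebesgue. f' (x + L *\<^sub>R axis i 1) = f' x"
  then have "AE x in lebesgue. f (x + L *\<^sub>R axis i 1) = f x" "AE x in lebesgue. f' (x + L *\<^sub>R axis i 1) = f' x" by auto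
  then show "AE x in lebesgue. g (f (x + L *\<^sub>R axis i 1)) (f' (x + L *\<^sub>R axis i 1)) = g (f x) (f' x)"
    by eventually_elim simp
qed

text \<open>The exceptional set of the first identity has to be moved by w, and translations
  preserve null sets.\<close>

lemma AE_shift_add:
  fixes f :: "'a::euclidean_space \<Rightarrow> 'b"
  assumes "AE x in lebesgue. f (x + v) = f x" "AE x in lebesgue. f (x + w) = f x"
  shows "AE x in lebesgue. f (x + (v + w)) = f x"
  using AE_lebesgue_translation[OF assms(1), of w] assms(2)
  by eventually_elim (simp add: ac_simps)

lemma AE_shift_uminus:
  fixes f :: "'a::euclidean_space \<Rightarrow> 'b"
  assumes "AE x in lebesgue. f (x + v) = f x"
  shows "AE x in lebesgue. f (x + - v) = f x"
  using AE_lebesgue_translation[OF assms, of "- v"] by eventually_elim simp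

lemma AE_shift_of_int:
  fixes f :: "'a::euclidean_space \<Rightarrow> 'b"
  assumes v: "AE x in lebesgue. f (x + v) = f x"
  shows "AE x in lebesgue. f (x + of_int n *\<^sub>R v) = f x"
proof (induction n rule: int_induct[of _ 0])
  case (step1 i)
  show ?case using AE_shift_add[OF step1(2) v] by (simp add: algebra_simps)
next
  case (step2 i)
  show ?case using AE_shift_add[OF step2(2) AE_shift_uminus[OF v]] by (simp add: algebra_simps)
qed simp

lemma vec2_eq_axis: "(k::real^2) = (k $ 1) *\<^sub>R axis 1 1 + (k $ 2) *\<^sub>R axis 2 1"
  by (simp add: vec_eq_iff forall_2 axis_def)

lemma periodic_AE_lattice:
  assumes "periodic_AE L f" "k \<in> int_lattice"
  shows "AE x in lebesgue. f (x + L *\<^sub>R k) = f x"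
proof -
  have "k $ 1 \<in> \<int>" "k $ 2 \<in> \<int>" using assms(2) by (auto simp: int_lattice_def)
  then obtain m n where mn: "k $ 1 = of_int m" "k $ 2 = of_int n" by (auto elim!: Ints_cases)
  have "L *\<^sub>R k = of_int m *\<^sub>R (L *\<^sub>R axis 1 1) + of_int n *\<^sub>R (L *\<^sub>R axis 2 1)"
    by (subst vec2_eq_axis[of k]) (simp add: mn algebra_simps)
  moreover have "AE x in lebesgue. f (x + L *\<^sub>R axis i 1) = f x" for i
    using assms(1) unfolding periodic_AE_def by blast
  ultimately show ?thesis by (simp only:) (intro AE_shift_add AE_shift_of_int)
qed

lemma cell_measurable [measurable]: "cell L \<in> sets lebesgue" "cell L \<in> sets borel"
  by (auto simp: cell_def)

text \<open>Finitely many lattice translates of the cell cover the box, and each contributes the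
  integral over the cell. The number N is chosen before f; this uniformity is what the passage to
  limits of weak gradients relies on.\<close>

lemma nn_integral_periodic_le:
  assumes L: "L > 0"
  shows "\<exists>N::nat. \<forall>f::real^2 \<Rightarrow> ennreal. f \<in> borel_measurable lebesgue \<longrightarrow> periodic_AE L f \<longrightarrow>
    (\<integral>\<^sup>+x\<in>cbox a b. f x \<partial>lebesgue) \<le> of_nat N * (\<integral>\<^sup>+x\<in>cell L. f x \<partial>lebesgue)"
proof -
  \<comment> \<open>Indices k with k_i the floor of x_i / L for some x in the box; the floor can
    fall below a_i / L by at most 1, hence the lower corner.\<close>
  define F where "F = int_lattice \<inter> cbox (\<chi> i. a $ i / L - 1) (\<chi> i. b $ i / L)"
  have fin: "finite F" unfolding F_def by (rule finite_int_lattice_cbox)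
  show ?thesis
  proof (intro exI[of _ "card F"] allI impI)
    fix f :: "real^2 \<Rightarrow> ennreal"
    assume f[measurable]: "f \<in> borel_measurable lebesgue" and p: "periodic_AE L f"
    have le: "f x * indicator (cbox a b) x \<le> (\<Sum>k\<in>F. f x * indicator (cell L) (x - L *\<^sub>R k))" for x
    proof (cases "x \<in> cbox a b")
      case True
      define k :: "real^2" where "k = (\<chi> i. of_int \<lfloor>x $ i / L\<rfloor>)"
      have xL: "of_int \<lfloor>x $ i / L\<rfloor> \<le> x $ i / L" "x $ i / L < of_int \<lfloor>x $ i / L\<rfloor> + 1" for i by linarith+
      have *: "a $ i / L \<le> x $ i / L" "x $ i / L \<le> b $ i / L" for i
        using True L by (auto simp: mem_box_cart divide_right_mono)
      have "k \<in> F"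
        unfolding F_def by (auto simp: int_lattice_def k_def mem_box_cart) (use xL * in \<open>smt (verit)\<close>)+
      moreover have "x - L *\<^sub>R k \<in> cell L"
        using floor_divide_lower[OF L, of "x $ _"] floor_divide_upper[OF L, of "x $ _"]
        by (auto simp: cell_def mem_box_cart k_def algebra_simps less_imp_le)
      ultimately show ?thesis
        using member_le_sum[of k F "\<lambda>k. f x * indicator (cell L) (x - L *\<^sub>R k)"] fin True by simp
    qed simp
    have eq: "(\<integral>\<^sup>+x. f x * indicator (cell L) (x - L *\<^sub>R k) \<partial>lebesgue) = (\<integral>\<^sup>+x\<in>cell L. f x \<partial>lebesgue)" if "k \<in> F" for k
    proof -
      have "(\<lambda>x. indicator (cell L) (x - L *\<^sub>R k) :: ennreal) \<in> borel_measurable lebesgue"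
        using measurable_lebesgue_compose_translation[of "indicator (cell L)" borel "- (L *\<^sub>R k)"] by simp
      then have "(\<integral>\<^sup>+x. f x * indicator (cell L) (x - L *\<^sub>R k) \<partial>lebesgue)
          = (\<integral>\<^sup>+x. f (x + L *\<^sub>R k) * indicator (cell L) x \<partial>lebesgue)"
        using nn_integral_lebesgue_translation[of "\<lambda>x. f x * indicator (cell L) (x - L *\<^sub>R k)" "L *\<^sub>R k"] by simp
      also have "\<dots> = (\<integral>\<^sup>+x\<in>cell L. f x \<partial>lebesgue)"
        by (rule nn_integral_cong_AE) (use periodic_AE_lattice[OF p, of k] that in \<open>auto simp: F_def elim!: eventually_mono\<close>)
      finally show ?thesis .
    qed
    have m: "(\<lambda>x. f x * indicator (cell L) (x - L *\<^sub>R k)) \<in> borel_measurable lebesgue" for k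
      using measurable_lebesgue_compose_translation[of "indicator (cell L)" borel "- (L *\<^sub>R k)"]
      by (auto intro!: borel_measurable_times_ennreal)
    have "(\<integral>\<^sup>+x\<in>cbox a b. f x \<partial>lebesgue) \<le> (\<integral>\<^sup>+x. (\<Sum>k\<in>F. f x * indicator (cell L) (x - L *\<^sub>R k)) \<partial>lebesgue)"
      by (intro nn_integral_mono le)
    also have "\<dots> = (\<Sum>k\<in>F. \<integral>\<^sup>+x\<in>cell L. f x \<partial>lebesgue)"
      by (subst nn_integral_sum) (auto simp: m eq)
    finally show "(\<integral>\<^sup>+x\<in>cbox a b. f x \<partial>lebesgue) \<le> of_nat (card F) * (\<integral>\<^sup>+x\<in>cell L. f x \<partial>lebesgue)" by simp
  qed
qed

lemma set_integrable_periodic: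
  fixes f :: "real^2 \<Rightarrow> 'b::{banach, second_countable_topology}"
  assumes L: "L > 0" and f: "f \<in> borel_measurable lebesgue" and p: "periodic_AE L f"
    and i: "set_integrable lebesgue (cell L) f"
  shows "set_integrable lebesgue (cbox a b) f"
proof -
  have s: "set_integrable lebesgue A f \<longleftrightarrow> (\<integral>\<^sup>+x\<in>A. ennreal (norm (f x)) \<partial>lebesgue) < \<infinity>" if "A \<in> sets lebesgue" for A
  proof -
    have "(\<lambda>x. indicator A x *\<^sub>R f x) \<in> borel_measurable lebesgue" using f that by simp
    moreover have "ennreal (norm (indicator A x *\<^sub>R f x)) = ennreal (norm (f x)) * indicator A x" for x
      by (simp add: indicator_def)
    ultimately show ?thesis
      unfolding set_integrable_def by (subst Bochner_Integration.integrable_iff_bounded) (simp only: simp_thms)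
  qed
  obtain N :: nat where N: "\<And>f::real^2 \<Rightarrow> ennreal. f \<in> borel_measurable lebesgue \<Longrightarrow> periodic_AE L f \<Longrightarrow>
    (\<integral>\<^sup>+x\<in>cbox a b. f x \<partial>lebesgue) \<le> of_nat N * (\<integral>\<^sup>+x\<in>cell L. f x \<partial>lebesgue)"
    using nn_integral_periodic_le[OF L, of a b] by blast
  have "(\<integral>\<^sup>+x\<in>cbox a b. ennreal (norm (f x)) \<partial>lebesgue) \<le> of_nat N * (\<integral>\<^sup>+x\<in>cell L. ennreal (norm (f x)) \<partial>lebesgue)"
    using f periodic_AE_compose[OF p, of "\<lambda>y. ennreal (norm y)"] by (intro N) auto
  also have "\<dots> < \<infinity>"
    using i by (simp add: s ennreal_mult_less_top of_nat_less_top)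
  finally show ?thesis by (simp add: s)
qed

section \<open>Folding integrals over the plane back to the cell\<close>

text \<open>The translates of the half-open cell tile the plane without overlap, so their indicators
  sum to 1 at every point and not only almost everywhere.\<close>

definition half_open_cell :: "real \<Rightarrow> (real^2) set"
  where "half_open_cell L = {x. \<forall>i. 0 \<le> x $ i \<and> x $ i < L}"

lemma half_open_cell_measurable: "half_open_cell L \<in> sets lebesgue"
proof -
  have "half_open_cell L = (\<Inter>i. {x. 0 \<le> x $ i} \<inter> {x. x $ i < L})"
    by (auto simp: half_open_cell_def)
  also have "\<dots> \<in> sets borel"
    by (intro sets.finite_INT sets.Int) (auto intro!: closed_halfspace_component_ge_cart open_halfspace_component_lt_cart borel_open borel_closed)
  finally show ?thesis by simp
qed

lemma AE_cell_open: "AE x in lebesgue. x \<in> cell L \<longrightarrow> x \<in> box (vec 0) (vec L)"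
proof (rule AE_I')
  show "cell L - box (vec 0) (vec L) \<in> null_sets lebesgue"
    unfolding cell_def using negligible_frontier_interval negligible_iff_null_sets by blast
qed (auto simp: cell_def)

text \<open>The support of \<zeta> is covered by four cells. Shifting each piece to the base cell
  leaves f unchanged by periodicity and collects the four translates of \<zeta>, whose sum is c. Two
  cases are used: c = 1 for the cutoff and c = 0 for its partial derivatives.\<close>

lemma integral_unfold_periodic:
  fixes f :: "real^2 \<Rightarrow> real"
  assumes L: "L > 0" and f: "in_Lp_loc 1 f" and p: "periodic_AE L f"
    and z: "test_function \<zeta>" "\<And>x. (\<exists>i. x $ i \<le> 0 \<or> x $ i \<ge> 2 * L) \<Longrightarrow> \<zeta> x = 0"
    and c: "\<And>x. x \<in> box (vec 0) (vec L) \<Longrightarrow>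
      (\<Sum>m\<in>{0,1::nat}. \<Sum>n\<in>{0,1::nat}. \<zeta> (x + L *\<^sub>R vector [real m, real n])) = c"
  shows "(LINT x|lebesgue. f x * \<zeta> x) = c * (LINT x:cell L|lebesgue. f x)"
proof -
  define C where "C = half_open_cell L"
  define d :: "nat \<Rightarrow> nat \<Rightarrow> real^2" where "d m n = L *\<^sub>R vector [real m, real n]" for m n
  have C: "C \<in> sets lebesgue" unfolding C_def by (rule half_open_cell_measurable)
  have int: "integrable lebesgue (\<lambda>x. f x * \<zeta> x)"
    by (rule integrable_mult_test_function[OF f z(1)])
  \<comment> \<open>Where \<zeta> may be nonzero, all coordinates lie strictly between 0 and 2L, and
    x belongs to exactly one of the four translates.\<close>
  have sum: "f x * \<zeta> x = (\<Sum>m\<in>{0,1}. \<Sum>n\<in>{0,1}. f x * \<zeta> x * indicator C (x - d m n))" for x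
  proof (cases "\<exists>i. x $ i \<le> 0 \<or> x $ i \<ge> 2 * L")
    case False
    then have "0 < x $ 1" "x $ 1 < 2 * L" "0 < x $ 2" "x $ 2 < 2 * L" by (auto simp: not_le)
    then have "(\<Sum>m\<in>{0,1}. \<Sum>n\<in>{0,1}. indicator C (x - d m n) :: real) = 1"
      by (cases "x $ 1 < L"; cases "x $ 2 < L")
         (auto simp: C_def half_open_cell_def d_def forall_2 indicator_def)
    then show ?thesis by (simp flip: sum_distrib_left distrib_left)
  qed (simp add: z)
  have mC: "(\<lambda>x. indicator C (x - d m n) :: real) \<in> borel_measurable lebesgue" for m n
    using measurable_lebesgue_compose_translation[of "indicator C" borel "- d m n"] C by simp
  have int': "integrable lebesgue (\<lambda>x. f x * \<zeta> x * indicator C (x - d m n))" for m n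
    by (rule Bochner_Integration.integrable_bound[OF int])
       (use mC int in \<open>auto simp: indicator_def borel_measurable_integrable\<close>)
  have dl: "vector [real m, real n] \<in> int_lattice" for m n :: nat
    by (auto simp: int_lattice_def forall_2)
  have per: "AE x in lebesgue. f (x + d m n) = f x" for m n
    using periodic_AE_lattice[OF p dl] by (simp add: d_def)
  have shift: "(LINT x|lebesgue. f x * \<zeta> x * indicator C (x - d m n))
      = (LINT x|lebesgue. f x * \<zeta> (x + d m n) * indicator C x)"
    and int'': "integrable lebesgue (\<lambda>x. f x * \<zeta> (x + d m n) * indicator C x)" for m n
  proof -
    have i: "integrable lebesgue (\<lambda>x. f (x + d m n) * \<zeta> (x + d m n) * indicator C x)"
      using integrable_lebesgue_translation[OF int'[of m n], of "d m n"] by simp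
    have m: "(\<lambda>x. f x * \<zeta> (x + d m n) * indicator C x) \<in> borel_measurable lebesgue"
      using in_Lp_loc_measurable[OF f] test_function_measurable[OF test_function_translation[OF z(1)]] C by simp
    have ae: "AE x in lebesgue. f (x + d m n) * \<zeta> (x + d m n) * indicator C x = f x * \<zeta> (x + d m n) * indicator C x"
      using per[of m n] by eventually_elim simp
    show "integrable lebesgue (\<lambda>x. f x * \<zeta> (x + d m n) * indicator C x)"
      using integrable_cong_AE[OF borel_measurable_integrable[OF i] m ae] i by blast
    have "(LINT x|lebesgue. f x * \<zeta> x * indicator C (x - d m n)) = (LINT x|lebesgue. f (x + d m n) * \<zeta> (x + d m n) * indicator C x)"
      using integral_lebesgue_translation[OF borel_measurable_integrable[OF int'[of m n]], of "d m n"] by simp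
    also have "\<dots> = (LINT x|lebesgue. f x * \<zeta> (x + d m n) * indicator C x)"
      by (rule integral_cong_AE[OF borel_measurable_integrable[OF i] m ae])
    finally show "(LINT x|lebesgue. f x * \<zeta> x * indicator C (x - d m n))
      = (LINT x|lebesgue. f x * \<zeta> (x + d m n) * indicator C x)" .
  qed
  have "(LINT x|lebesgue. f x * \<zeta> x) = (LINT x|lebesgue. (\<Sum>m\<in>{0,1}. \<Sum>n\<in>{0,1}. f x * \<zeta> x * indicator C (x - d m n)))"
    by (subst sum) (rule refl)
  also have "\<dots> = (\<Sum>m\<in>{0,1}. \<Sum>n\<in>{0,1}. (LINT x|lebesgue. f x * \<zeta> x * indicator C (x - d m n)))"
    by (subst Bochner_Integration.integral_sum, intro Bochner_Integration.integrable_sum int',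
        intro sum.cong refl, subst Bochner_Integration.integral_sum, rule int', rule refl)
  also have "\<dots> = (LINT x|lebesgue. (\<Sum>m\<in>{0,1}. \<Sum>n\<in>{0,1}. f x * \<zeta> (x + d m n) * indicator C x))"
    unfolding shift
    by (subst Bochner_Integration.integral_sum, intro Bochner_Integration.integrable_sum int'',
        intro sum.cong refl, subst Bochner_Integration.integral_sum, rule int'', rule refl)
  also have "\<dots> = (LINT x|lebesgue. c * (indicator (cell L) x *\<^sub>R f x))"
  proof (rule integral_cong_AE)
    show "(\<lambda>x. \<Sum>m\<in>{0,1}. \<Sum>n\<in>{0,1}. f x * \<zeta> (x + d m n) * indicator C x) \<in> borel_measurable lebesgue"
      using int'' by (intro borel_measurable_sum borel_measurable_integrable)
    show "(\<lambda>x. c * (indicator (cell L) x *\<^sub>R f x)) \<in> borel_measurable lebesgue"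
      using in_Lp_loc_measurable[OF f] by simp
    show "AE x in lebesgue. (\<Sum>m\<in>{0,1}. \<Sum>n\<in>{0,1}. f x * \<zeta> (x + d m n) * indicator C x) = c * (indicator (cell L) x *\<^sub>R f x)"
      using AE_cell_open[of L]
    proof eventually_elim
      case (elim x)
      show ?case
      proof (cases "x \<in> cell L")
        case True
        with elim have x: "x \<in> box (vec 0) (vec L)" by blast
        then have "x \<in> C" unfolding C_def half_open_cell_def by (auto simp: mem_box_cart less_imp_le)
        have "(\<Sum>m\<in>{0,1}. \<Sum>n\<in>{0,1}. f x * \<zeta> (x + d m n) * indicator C x) = f x * (\<Sum>m\<in>{0,1}. \<Sum>n\<in>{0,1}. \<zeta> (x + d m n))"
          using \<open>x \<in> C\<close> by (simp add: algebra_simps)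
        then show ?thesis using c[OF x] True unfolding d_def by simp
      next
        case False
        then have "x \<notin> C" unfolding C_def half_open_cell_def cell_def mem_box_cart
          by simp (meson less_imp_le)
        with False show ?thesis by simp
      qed
    qed
  qed
  finally show ?thesis by (simp add: set_lebesgue_integral_def)
qed

text \<open>The lattice translates of \<open>periodic_cutoff\<close> form a smooth partition of unity; multiplying by it
  turns smooth periodic functions into test functions.\<close>

definition hat :: "real \<Rightarrow> real"
  where "hat t = smooth_step t - smooth_step (t - 1)"

definition periodic_cutoff :: "real \<Rightarrow> real^2 \<Rightarrow> real"
  where "periodic_cutoff L x = hat (x $ 1 / L) * hat (x $ 2 / L)"

lemma hat_eq_0: "t \<le> 0 \<or> t \<ge> 2 \<Longrightarrow> hat t = 0"
  by (auto simp: hat_def smooth_step_eq_0 smooth_step_eq_1)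

lemma hat_sum: "0 \<le> t \<Longrightarrow> t \<le> 1 \<Longrightarrow> hat t + hat (t + 1) = 1"
  by (simp add: hat_def smooth_step_eq_0 smooth_step_eq_1)

lemma periodic_cutoff_eq_0:
  assumes "L > 0" "\<exists>i. x $ i \<le> 0 \<or> x $ i \<ge> 2 * L"
  shows "periodic_cutoff L x = 0"
proof -
  have "\<exists>i. x $ i / L \<le> 0 \<or> x $ i / L \<ge> 2"
    using assms by (auto simp: divide_le_0_iff le_divide_eq)
  then obtain i where "hat (x $ i / L) = 0" using hat_eq_0 by blast
  then show ?thesis using exhaust_2[of i] by (auto simp: periodic_cutoff_def)
qed

lemma periodic_cutoff_sum:
  assumes "L > 0" "x \<in> box (vec 0) (vec L)"
  shows "(\<Sum>m\<in>{0,1::nat}. \<Sum>n\<in>{0,1::nat}. periodic_cutoff L (x + L *\<^sub>R vector [real m, real n])) = 1"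
proof -
  have h: "hat (x $ i / L) + hat (x $ i / L + 1) = 1" for i
    using assms by (intro hat_sum) (auto simp: mem_box_cart less_imp_le)
  have "(\<Sum>m\<in>{0,1::nat}. \<Sum>n\<in>{0,1::nat}. periodic_cutoff L (x + L *\<^sub>R vector [real m, real n]))
    = (hat (x $ 1 / L) + hat (x $ 1 / L + 1)) * (hat (x $ 2 / L) + hat (x $ 2 / L + 1))"
    using assms(1) by (simp add: periodic_cutoff_def add_divide_distrib algebra_simps)
  then show ?thesis by (simp add: h)
qed

lemma test_function_periodic_cutoff:
  assumes "L > 0"
  shows "test_function (periodic_cutoff L)"
proof (rule test_functionI[of _ "vec 0" "vec (2 * L)"])
  have "Ck k (\<lambda>x::real^2. hat (x $ i / L))" for k i
  proof -
    have "smooth_step (x $ i / L) + (-1) * smooth_step (x $ i / L - 1)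
      = smooth_step ((axis i 1 /\<^sub>R L) \<bullet> x + 0) + (-1) * smooth_step ((axis i 1 /\<^sub>R L) \<bullet> x + (-1))" for x :: "real^2"
      by (simp add: inner_axis' divide_inverse mult.commute)
    then have "(\<lambda>x::real^2. hat (x $ i / L)) = (\<lambda>x. smooth_step ((axis i 1 /\<^sub>R L) \<bullet> x + 0) + (-1) * smooth_step ((axis i 1 /\<^sub>R L) \<bullet> x + (-1)))"
      by (simp add: hat_def)
    then show ?thesis by (simp only:) (intro Ck_add Ck_mult Ck_const Ck_smooth_step)
  qed
  then show "Ck k (periodic_cutoff L)" for k
    unfolding periodic_cutoff_def[abs_def] by (intro Ck_mult)
  show "periodic_cutoff L x = 0" if "x \<notin> cbox (vec 0) (vec (2 * L))" for x
    using that by (intro periodic_cutoff_eq_0[OF assms]) (auto simp: mem_box_cart not_le, (meson less_imp_le)+)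
qed

lemma partial_deriv_locally_zero:
  assumes "open S" "x \<in> S" "\<And>y. y \<in> S \<Longrightarrow> f y = c"
  shows "partial_deriv i f x = 0"
proof -
  have "((\<lambda>x. c) has_derivative (\<lambda>h. 0)) (at x)" by simp
  then have "(f has_derivative (\<lambda>h. 0)) (at x)"
    by (rule has_derivative_transform_within_open[of _ _ _ _ S]) (use assms in auto)
  then show ?thesis by (rule partial_deriv_eqI)
qed

text \<open>Outside the closed square the cutoff is locally 0. On its boundary the cutoff is not
  locally constant, so the value there comes from continuity of the derivative and the closure of
  the complement.\<close>

lemma partial_deriv_periodic_cutoff_eq_0:
  assumes L: "L > 0" and "\<exists>i. x $ i \<le> 0 \<or> x $ i \<ge> 2 * L"
  shows "partial_deriv j (periodic_cutoff L) x = 0"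
proof -
  define \<eta>' where "\<eta>' = partial_deriv j (periodic_cutoff L)"
  have cont: "continuous_on UNIV \<eta>'"
    unfolding \<eta>'_def by (intro test_function_continuous test_function_partial_deriv test_function_periodic_cutoff L)
  have out: "\<eta>' y = 0" if "y \<in> - cbox (vec 0) (vec (2 * L))" for y
    unfolding \<eta>'_def
  proof (rule partial_deriv_locally_zero[OF _ that])
    show "periodic_cutoff L y = 0" if "y \<in> - cbox (vec 0) (vec (2 * L))" for y
      using that by (intro periodic_cutoff_eq_0[OF L]) (auto simp: mem_box_cart not_le, (meson less_imp_le)+)
  qed auto
  obtain i where "x $ i \<le> 0 \<or> x $ i \<ge> 2 * L" using assms(2) by blast
  then have "x \<notin> box (vec 0) (vec (2 * L))" by (auto simp: mem_box_cart not_less)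
  then have "x \<in> closure (- cbox (vec 0) (vec (2 * L)))"
    by (simp add: closure_complement)
  from continuous_constant_on_closure[OF continuous_on_subset[OF cont subset_UNIV] out this]
  show ?thesis unfolding \<eta>'_def .
qed

text \<open>The four translates of the cutoff sum to the constant 1 on the open cell; differentiate
  this identity.\<close>

lemma partial_deriv_periodic_cutoff_sum:
  assumes L: "L > 0" and x: "x \<in> box (vec 0) (vec L)"
  shows "(\<Sum>m\<in>{0,1::nat}. \<Sum>n\<in>{0,1::nat}. partial_deriv j (periodic_cutoff L) (x + L *\<^sub>R vector [real m, real n])) = 0"
proof -
  let ?d = "\<lambda>m n. L *\<^sub>R vector [real m, real n] :: real^2"
  have d: "((\<lambda>x. periodic_cutoff L (x + v)) has_derivative frechet_derivative (periodic_cutoff L) (at (x + v))) (at x)" for v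
    using Ck_differentiable[OF test_function_Ck[OF test_function_periodic_cutoff[OF L]]]
    by (simp flip: translation_has_derivative)
  have "((\<lambda>x. \<Sum>m\<in>{0,1::nat}. \<Sum>n\<in>{0,1::nat}. periodic_cutoff L (x + ?d m n)) has_derivative
      (\<lambda>h. \<Sum>m\<in>{0,1::nat}. \<Sum>n\<in>{0,1::nat}. frechet_derivative (periodic_cutoff L) (at (x + ?d m n)) h)) (at x)"
    by (intro has_derivative_sum d)
  then have e: "partial_deriv j (\<lambda>x. \<Sum>m\<in>{0,1::nat}. \<Sum>n\<in>{0,1::nat}. periodic_cutoff L (x + ?d m n)) x
      = (\<Sum>m\<in>{0,1::nat}. \<Sum>n\<in>{0,1::nat}. partial_deriv j (periodic_cutoff L) (x + ?d m n))"
    unfolding partial_deriv_def[of j "periodic_cutoff L"] by (rule partial_deriv_eqI)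
  show ?thesis
    unfolding e[symmetric] by (rule partial_deriv_locally_zero[OF open_box x periodic_cutoff_sum[OF L]])
qed

section \<open>Integration by parts on the cell against smooth periodic functions\<close>

lemma in_Lp_loc_1_mult_continuous:
  fixes f :: "real^'n \<Rightarrow> real"
  assumes f: "in_Lp_loc 1 f" and u: "continuous_on UNIV u"
  shows "in_Lp_loc 1 (\<lambda>x. f x * u x)"
  unfolding in_Lp_loc_1_iff
proof (intro allI)
  fix a b
  have "compact (u ` cbox a b)"
    using u continuous_on_subset by (blast intro: compact_continuous_image compact_cbox)
  then obtain M where M: "\<forall>y\<in>u ` cbox a b. \<bar>y\<bar> \<le> M" using compact_imp_bounded bounded_real by metis
  have "integrable lebesgue (\<lambda>x. (indicator (cbox a b) x * u x) *\<^sub>R f x)"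
  proof (rule integrable_mult_bounded_support[OF f])
    show "(\<lambda>x. indicator (cbox a b) x * u x) \<in> borel_measurable lebesgue"
      by (intro borel_measurable_times borel_measurable_indicator continuous_measurable_lebesgue[OF u]) simp
    show "\<bar>indicator (cbox a b) x * u x\<bar> \<le> max M 0" for x
      using M by (cases "x \<in> cbox a b") (auto simp: le_max_iff_disj)
    show "indicator (cbox a b) x * u x = 0" if "x \<notin> cbox a b" for x using that by simp
  qed
  then show "set_integrable lebesgue (cbox a b) (\<lambda>x. f x * u x)"
    by (simp add: set_integrable_def algebra_simps)
qed

text \<open>Translating by a period yields another weak gradient of the same function, and weak
  gradients are unique almost everywhere.\<close>

lemma weak_gradient_periodic:
  assumes "periodic_AE L v" "has_weak_gradient v G"
  shows "periodic_AE L G"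
  unfolding periodic_AE_def
proof
  fix i
  have "has_weak_gradient v (\<lambda>x. G (x + L *\<^sub>R axis i 1))"
    by (rule has_weak_gradient_cong[OF has_weak_gradient_translation[OF assms(2), of "L *\<^sub>R axis i 1"]])
       (use assms has_weak_gradientD in \<open>auto simp: periodic_AE_def\<close>)
  from weak_gradient_unique[OF this assms(2)]
  show "AE x in lebesgue. G (x + L *\<^sub>R axis i 1) = G x" .
qed

text \<open>Test the weak gradient with u times the cutoff. The term with the derivative of the
  cutoff folds to 0, and the other two fold to integrals over the cell; no boundary terms
  appear.\<close>

lemma integral_by_parts_periodic:
  assumes L: "L > 0" and v: "periodic_AE L v" "has_weak_gradient v G"
    and u: "\<And>k. Ck k u" "\<And>x i. u (x + L *\<^sub>R axis i 1) = u x"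
  shows "(LINT x:cell L|lebesgue. v x * partial_deriv j u x) = - (LINT x:cell L|lebesgue. G x $ j * u x)"
proof -
  let ?\<eta> = "periodic_cutoff L"
  note D = has_weak_gradientD[OF v(2)]
  have cu: "continuous_on UNIV u" "continuous_on UNIV (partial_deriv j u)"
    using u(1)[of 0] u(1)[of 1] by auto
  have pu: "periodic_AE L u" "periodic_AE L (partial_deriv j u)"
    using partial_deriv_translation[of j u, symmetric] u(2) unfolding periodic_AE_def
    by (simp_all add: fun_cong[OF partial_deriv_translation[of j u], symmetric])
  have \<eta>: "test_function ?\<eta>" by (rule test_function_periodic_cutoff[OF L])
  note loc = in_Lp_loc_1_mult_continuous
  note un = integral_unfold_periodic[OF L]
  have 1: "(LINT x|lebesgue. (v x * u x) * partial_deriv j ?\<eta> x) = 0 * (LINT x:cell L|lebesgue. v x * u x)"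
    by (rule un[OF loc[OF D(1) cu(1)] periodic_AE_compose2[OF v(1) pu(1), of "(*)"] test_function_partial_deriv[OF \<eta>]])
       (use partial_deriv_periodic_cutoff_eq_0[OF L] partial_deriv_periodic_cutoff_sum[OF L] in auto)
  have 2: "(LINT x|lebesgue. (v x * partial_deriv j u x) * ?\<eta> x) = 1 * (LINT x:cell L|lebesgue. v x * partial_deriv j u x)"
    by (rule un[OF loc[OF D(1) cu(2)] periodic_AE_compose2[OF v(1) pu(2), of "(*)"] \<eta>])
       (use periodic_cutoff_eq_0[OF L] periodic_cutoff_sum[OF L] in auto)
  have 3: "(LINT x|lebesgue. (G x $ j * u x) * ?\<eta> x) = 1 * (LINT x:cell L|lebesgue. G x $ j * u x)"
    by (rule un[OF loc[OF in_Lp_loc_1_component[OF D(2)] cu(1)]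
          periodic_AE_compose2[OF weak_gradient_periodic[OF v] pu(1), of "\<lambda>g y. g $ j * y"] \<eta>])
       (use periodic_cutoff_eq_0[OF L] periodic_cutoff_sum[OF L] in auto)
  have pd: "partial_deriv j (\<lambda>x. u x * ?\<eta> x) = (\<lambda>x. u x * partial_deriv j ?\<eta> x + partial_deriv j u x * ?\<eta> x)"
    by (rule partial_deriv_mult[OF u(1) test_function_Ck[OF \<eta>]])
  have "(LINT x|lebesgue. v x * (u x * partial_deriv j ?\<eta> x + partial_deriv j u x * ?\<eta> x))
      = - (LINT x|lebesgue. G x $ j * (u x * ?\<eta> x))"
    using D(3)[OF test_function_mult[OF \<eta> u(1)], of j] unfolding pd .
  moreover have "(LINT x|lebesgue. v x * (u x * partial_deriv j ?\<eta> x + partial_deriv j u x * ?\<eta> x))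
      = (LINT x|lebesgue. (v x * u x) * partial_deriv j ?\<eta> x) + (LINT x|lebesgue. (v x * partial_deriv j u x) * ?\<eta> x)"
    using integrable_mult_test_function[OF loc[OF D(1) cu(1)] test_function_partial_deriv[OF \<eta>, of j]]
      integrable_mult_test_function[OF loc[OF D(1) cu(2)] \<eta>]
    by (subst Bochner_Integration.integral_add[symmetric]) (auto simp: algebra_simps)
  ultimately show ?thesis using 1 2 3 by (simp add: mult.assoc)
qed

subsection \<open>Fourier series on the cell\<close>

abbreviation cellM :: "real \<Rightarrow> (real^2) measure"
  where "cellM L \<equiv> lebesgue_on (cell L)"

lemma set_lebesgue_integral_cell:
  fixes f :: "real^2 \<Rightarrow> 'b::{banach, second_countable_topology}"
  shows "(LINT x:cell L|lebesgue. f x) = (LINT x|cellM L. f x)"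
  by (simp add: set_lebesgue_integral_def integral_restrict_space)

lemma set_integrable_cell:
  fixes f :: "real^2 \<Rightarrow> 'b::{banach, second_countable_topology}"
  shows "set_integrable lebesgue (cell L) f \<longleftrightarrow> integrable (cellM L) f"
  by (simp add: set_integrable_def integrable_restrict_space)

lemma in_Lp_cell_iff:
  "in_Lp p (cell L) f \<longleftrightarrow> f \<in> borel_measurable (cellM L) \<and> integrable (cellM L) (\<lambda>x. norm (f x) ^ p)"
  unfolding in_Lp_def set_integrable_cell set_borel_measurable_def
  by (subst borel_measurable_restrict_space_iff) auto

lemma finite_measure_cellM: "finite_measure (cellM L)"
  by (rule finite_measure_lebesgue_on) (simp add: cell_def lmeasurable_cbox)

lemma integrable_cellM_const: "integrable (cellM L) (\<lambda>x. c :: 'b::{banach, second_countable_topology})"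
  using finite_measure.integrable_const[OF finite_measure_cellM] .

lemma measure_cellM: "L \<ge> 0 \<Longrightarrow> measure (cellM L) (cell L) = L\<^sup>2"
proof -
  assume L: "L \<ge> 0"
  have "measure (cellM L) (cell L) = measure lebesgue (cbox (vec 0 :: real^2) (vec L))"
    by (simp add: measure_restrict_space cell_def)
  also have "\<dots> = L\<^sup>2"
    using L by (simp add: content_cbox_cart interval_eq_empty_cart power2_eq_square)
  finally show ?thesis .
qed

lemma integral_cellM_const: "L \<ge> 0 \<Longrightarrow> (LINT x|cellM L. c :: real) = L\<^sup>2 * c"
  by (simp add: measure_cellM)

lemma measurable_cellM: "f \<in> lebesgue \<rightarrow>\<^sub>M N \<Longrightarrow> f \<in> cellM L \<rightarrow>\<^sub>M N"
  by (rule measurable_restrict_space1)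

lemma AE_cellM: "AE x in lebesgue. P x \<Longrightarrow> AE x in cellM L. P x"
  by (subst AE_restrict_space_iff) (auto elim: eventually_mono)

lemma integrable_cellM_bounded:
  fixes f :: "real^2 \<Rightarrow> 'b::{banach, second_countable_topology}"
  assumes "f \<in> borel_measurable (cellM L)" "\<And>x. x \<in> cell L \<Longrightarrow> norm (f x) \<le> M"
  shows "integrable (cellM L) f"
  by (rule Bochner_Integration.integrable_bound[OF integrable_cellM_const[of L M] assms(1)])
     (use assms(2) in \<open>force intro: AE_I2\<close>)

lemma in_Lp_le:
  fixes f :: "real^2 \<Rightarrow> 'b::{banach, second_countable_topology}"
  assumes "in_Lp q (cell L) f" "p \<le> q"
  shows "in_Lp p (cell L) f"
proof -
  have f: "f \<in> borel_measurable (cellM L)" "integrable (cellM L) (\<lambda>x. norm (f x) ^ q)"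
    using assms by (auto simp: in_Lp_cell_iff)
  have "norm (f x) ^ p \<le> 1 + norm (f x) ^ q" for x
  proof (cases "norm (f x) \<le> 1")
    case True
    then show ?thesis by (simp add: power_le_one add_increasing2)
  next
    case False
    then have "norm (f x) ^ p \<le> norm (f x) ^ q" by (intro power_increasing assms) auto
    then show ?thesis by linarith
  qed
  then have "integrable (cellM L) (\<lambda>x. norm (f x) ^ p)"
    by (intro Bochner_Integration.integrable_bound[OF Bochner_Integration.integrable_add[OF integrable_cellM_const[of L "1::real"] f(2)]])
       (use f(1) in auto)
  with f(1) show ?thesis by (simp add: in_Lp_cell_iff)
qed

lemma in_Lp_integrable:
  fixes f :: "real^2 \<Rightarrow> 'b::{banach, second_countable_topology}"
  assumes "in_Lp p (cell L) f" "p \<ge> 1"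
  shows "integrable (cellM L) f"
  using in_Lp_le[OF assms] by (simp add: in_Lp_1_iff set_integrable_cell flip: One_nat_def)

section \<open>Plane waves and Fourier coefficients of weak gradients\<close>

definition plane_wave :: "real \<Rightarrow> real^2 \<Rightarrow> real^2 \<Rightarrow> complex"
  where "plane_wave L k x = cis (2 * pi * (k \<bullet> x) / L)"

lemma norm_plane_wave [simp]: "norm (plane_wave L k x) = 1"
  by (simp add: plane_wave_def)

lemma plane_wave_mult: "plane_wave L k x * plane_wave L l x = plane_wave L (k + l) x"
  by (simp add: plane_wave_def cis_mult inner_add_left add_divide_distrib distrib_left)

lemma cnj_plane_wave: "cnj (plane_wave L k x) = plane_wave L (- k) x"
  by (simp add: plane_wave_def cis_cnj)

lemma plane_wave_0 [simp]: "plane_wave L 0 x = 1"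
  by (simp add: plane_wave_def)

lemma continuous_on_plane_wave: "continuous_on S (plane_wave L k)"
  unfolding plane_wave_def[abs_def] divide_inverse by (intro continuous_intros)

lemma plane_wave_measurable: "plane_wave L k \<in> borel_measurable (cellM L)"
  by (intro measurable_cellM continuous_measurable_lebesgue continuous_on_plane_wave)

lemma integrable_mult_plane_wave:
  assumes "integrable (cellM L) f"
  shows "integrable (cellM L) (\<lambda>x. complex_of_real (f x) * plane_wave L k x)"
  by (rule Bochner_Integration.integrable_bound[OF assms])
     (use assms plane_wave_measurable in \<open>auto simp: norm_mult intro!: borel_measurable_times borel_measurable_of_real borel_measurable_integrable\<close>)

lemma fourier_coeff_eq:
  "fourier_coeff L f k = (LINT x|cellM L. complex_of_real (f x) * plane_wave L (- k) x) / of_real (L\<^sup>2)"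
  unfolding fourier_coeff_def set_lebesgue_integral_cell plane_wave_def by simp

text \<open>Integration by parts is available for real-valued functions, so cosine and sine are
  treated separately. Lattice frequencies make both periodic with period L in each
  coordinate.\<close>

lemma plane_wave_parts:
  assumes L: "L > 0" and v: "periodic_AE L v" "has_weak_gradient v G" and k: "k \<in> int_lattice"
  shows "(LINT x|cellM L. G x $ j * cos (2 * pi * (k \<bullet> x) / L)) = 2 * pi * k $ j / L * (LINT x|cellM L. v x * sin (2 * pi * (k \<bullet> x) / L))"
    and "(LINT x|cellM L. G x $ j * sin (2 * pi * (k \<bullet> x) / L)) = - (2 * pi * k $ j / L) * (LINT x|cellM L. v x * cos (2 * pi * (k \<bullet> x) / L))"
proof -
  define \<kappa> where "\<kappa> = (2 * pi / L) *\<^sub>R k"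
  have \<kappa>: "2 * pi * (k \<bullet> x) / L = \<kappa> \<bullet> x" for x by (simp add: \<kappa>_def)
  have kj: "2 * pi * k $ j / L = \<kappa> $ j" by (simp add: \<kappa>_def)
  have pd: "partial_deriv j (\<lambda>x. cos (\<kappa> \<bullet> x)) = (\<lambda>x. \<kappa> $ j * (- sin (\<kappa> \<bullet> x)))"
    "partial_deriv j (\<lambda>x. sin (\<kappa> \<bullet> x)) = (\<lambda>x. \<kappa> $ j * cos (\<kappa> \<bullet> x))"
    using partial_deriv_ridge[where f = cos and f' = "\<lambda>t. - sin t" and d = 0 and \<kappa> = \<kappa> and i = j]
      partial_deriv_ridge[where f = sin and f' = cos and d = 0 and \<kappa> = \<kappa> and i = j]
    by (auto intro!: derivative_eq_intros)
  have per: "cos (\<kappa> \<bullet> (x + L *\<^sub>R axis i 1)) = cos (\<kappa> \<bullet> x)" "sin (\<kappa> \<bullet> (x + L *\<^sub>R axis i 1)) = sin (\<kappa> \<bullet> x)" for x i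
  proof -
    have "k $ i \<in> \<int>" using k by (auto simp: int_lattice_def)
    then obtain n where n: "k $ i = of_int n" by (auto elim: Ints_cases)
    have "\<kappa> \<bullet> (x + L *\<^sub>R axis i 1) = \<kappa> \<bullet> x + of_int n * (2 * pi)"
      using L by (simp add: inner_add_right inner_axis \<kappa>_def n)
    then show "cos (\<kappa> \<bullet> (x + L *\<^sub>R axis i 1)) = cos (\<kappa> \<bullet> x)" "sin (\<kappa> \<bullet> (x + L *\<^sub>R axis i 1)) = sin (\<kappa> \<bullet> x)"
      by (simp_all only: cos_add sin_add) (simp_all add: mult.commute[of "of_int n"] sin_int_2pin cos_int_2pin)
  qed
  have lin: "(LINT x|cellM L. v x * (c * u x)) = c * (LINT x|cellM L. v x * u x)" for c and u :: "real^2 \<Rightarrow> real"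
    by (simp only: mult.left_commute[of _ c] integral_mult_right_zero)
  note ip = integral_by_parts_periodic[OF L v, of _ j, unfolded set_lebesgue_integral_cell]
  from ip[of "\<lambda>x. cos (\<kappa> \<bullet> x)", OF Ck_cos per(1)] ip[of "\<lambda>x. sin (\<kappa> \<bullet> x)", OF Ck_sin per(2)]
  show "(LINT x|cellM L. G x $ j * cos (2 * pi * (k \<bullet> x) / L)) = 2 * pi * k $ j / L * (LINT x|cellM L. v x * sin (2 * pi * (k \<bullet> x) / L))"
    "(LINT x|cellM L. G x $ j * sin (2 * pi * (k \<bullet> x) / L)) = - (2 * pi * k $ j / L) * (LINT x|cellM L. v x * cos (2 * pi * (k \<bullet> x) / L))"
    unfolding pd lin \<kappa> kj by simp_all
qed

lemma integral_mult_plane_wave: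
  assumes "integrable (cellM L) f"
  shows "(LINT x|cellM L. complex_of_real (f x) * plane_wave L (- k) x) =
    Complex (LINT x|cellM L. f x * cos (2 * pi * (k \<bullet> x) / L)) (- (LINT x|cellM L. f x * sin (2 * pi * (k \<bullet> x) / L)))"
proof (rule complex_eqI)
  note i = integrable_mult_plane_wave[OF assms, of "- k"]
  have "Re (LINT x|cellM L. complex_of_real (f x) * plane_wave L (- k) x) = (LINT x|cellM L. Re (complex_of_real (f x) * plane_wave L (- k) x))"
    by (rule integral_Re[OF i, symmetric])
  then show "Re (LINT x|cellM L. complex_of_real (f x) * plane_wave L (- k) x) =
    Re (Complex (LINT x|cellM L. f x * cos (2 * pi * (k \<bullet> x) / L)) (- (LINT x|cellM L. f x * sin (2 * pi * (k \<bullet> x) / L))))"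
    by (simp add: plane_wave_def)
  have "Im (LINT x|cellM L. complex_of_real (f x) * plane_wave L (- k) x) = (LINT x|cellM L. Im (complex_of_real (f x) * plane_wave L (- k) x))"
    by (rule integral_Im[OF i, symmetric])
  then show "Im (LINT x|cellM L. complex_of_real (f x) * plane_wave L (- k) x) =
    Im (Complex (LINT x|cellM L. f x * cos (2 * pi * (k \<bullet> x) / L)) (- (LINT x|cellM L. f x * sin (2 * pi * (k \<bullet> x) / L))))"
    by (simp add: plane_wave_def)
qed

lemma has_weak_gradient_integrable_cell:
  assumes "has_weak_gradient v G"
  shows "integrable (cellM L) v" "integrable (cellM L) (\<lambda>x. G x $ j)"
  using has_weak_gradientD(1)[OF assms] in_Lp_loc_1_component[OF has_weak_gradientD(2)[OF assms], of j]
  unfolding in_Lp_loc_1_iff cell_def set_integrable_cell[unfolded cell_def, symmetric] by blast+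

lemma fourier_coeff_weak_gradient:
  assumes "L > 0" "periodic_AE L v" "has_weak_gradient v G" "k \<in> int_lattice"
  shows "fourier_coeff L (\<lambda>x. G x $ j) k = \<i> * of_real (2 * pi * k $ j / L) * fourier_coeff L v k"
proof -
  have "(LINT x|cellM L. complex_of_real (G x $ j) * plane_wave L (- k) x)
      = \<i> * of_real (2 * pi * k $ j / L) * (LINT x|cellM L. complex_of_real (v x) * plane_wave L (- k) x)"
    unfolding integral_mult_plane_wave[OF has_weak_gradient_integrable_cell(1)[OF assms(3)]]
      integral_mult_plane_wave[OF has_weak_gradient_integrable_cell(2)[OF assms(3)]] plane_wave_parts[OF assms]
    by (simp add: complex_eq_iff)
  then show ?thesis by (simp add: fourier_coeff_eq)
qed

text \<open>No integral has to be computed: the constant 1 has weak gradient 0, so the formula for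
  coefficients of gradients forces k_j times its k-th coefficient to vanish for every j. The sign of
  k changes because \<open>fourier_coeff\<close> integrates against the conjugate wave.\<close>

lemma integral_plane_wave:
  assumes L: "L > 0" and k: "k \<in> int_lattice"
  shows "(LINT x|cellM L. plane_wave L k x) = (if k = 0 then of_real (L\<^sup>2) else 0)"
proof (cases "k = 0")
  case True
  then show ?thesis using L by (simp add: measure_cellM scaleR_conv_of_real)
next
  case False
  then obtain j where j: "k $ j \<noteq> 0" by (auto simp: vec_eq_iff)
  have per: "periodic_AE L (\<lambda>x. 1::real)" by (simp add: periodic_AE_def)
  have "fourier_coeff L (\<lambda>x. (0 :: real^2) $ j) (- k) = \<i> * of_real (2 * pi * (- k) $ j / L) * fourier_coeff L (\<lambda>x. 1) (- k)"
    by (rule fourier_coeff_weak_gradient[OF L per has_weak_gradient_const int_lattice_uminus[OF k]])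
  then have "fourier_coeff L (\<lambda>x. 1) (- k) = 0"
    using j L by (simp add: fourier_coeff_eq)
  then show ?thesis using False L by (simp add: fourier_coeff_eq)
qed

section \<open>Trigonometric polynomials and their density in L^2 of the cell\<close>

definition trig_poly :: "real \<Rightarrow> (real^2 \<Rightarrow> complex) \<Rightarrow> bool"
  where "trig_poly L u \<longleftrightarrow> (\<exists>F c. finite F \<and> F \<subseteq> int_lattice \<and> u = (\<lambda>x. \<Sum>k\<in>F. c k * plane_wave L k x))"

lemma trig_poly_plane_wave: "k \<in> int_lattice \<Longrightarrow> trig_poly L (\<lambda>x. c * plane_wave L k x)"
  unfolding trig_poly_def by (rule exI[of _ "{k}"], rule exI[of _ "\<lambda>_. c"]) auto

lemma trig_poly_add:
  assumes "trig_poly L u" "trig_poly L v"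
  shows "trig_poly L (\<lambda>x. u x + v x)"
proof -
  obtain F c where F: "finite F" "F \<subseteq> int_lattice" "u = (\<lambda>x. \<Sum>k\<in>F. c k * plane_wave L k x)"
    using assms(1) unfolding trig_poly_def by blast
  obtain H d where H: "finite H" "H \<subseteq> int_lattice" "v = (\<lambda>x. \<Sum>k\<in>H. d k * plane_wave L k x)"
    using assms(2) unfolding trig_poly_def by blast
  define c' where "c' k = (if k \<in> F then c k else 0) + (if k \<in> H then d k else 0)" for k
  have "(\<Sum>k\<in>F \<union> H. c' k * plane_wave L k x) = u x + v x" for x
  proof -
    have "(\<Sum>k\<in>F \<union> H. c' k * plane_wave L k x)
      = (\<Sum>k\<in>F \<union> H. if k \<in> F then c k * plane_wave L k x else 0) + (\<Sum>k\<in>F \<union> H. if k \<in> H then d k * plane_wave L k x else 0)"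
      unfolding sum.distrib[symmetric] by (rule sum.cong) (auto simp: c'_def algebra_simps)
    also have "\<dots> = u x + v x"
      using F(1) H(1) unfolding F(3) H(3)
      by (intro arg_cong2[of _ _ _ _ "(+)"] sum.mono_neutral_cong_right) auto
    finally show ?thesis .
  qed
  then show ?thesis
    unfolding trig_poly_def using F H by (intro exI[of _ "F \<union> H"] exI[of _ c']) auto
qed

lemma trig_poly_sum: "(\<And>i. i \<in> I \<Longrightarrow> trig_poly L (u i)) \<Longrightarrow> trig_poly L (\<lambda>x. \<Sum>i\<in>I. u i x)"
proof (induction I rule: infinite_finite_induct)
  case empty
  then show ?case unfolding trig_poly_def by (intro exI[of _ "{}"]) auto
next
  case (infinite I)
  then show ?case unfolding trig_poly_def by (intro exI[of _ "{}"]) auto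
next
  case (insert i I)
  then have "trig_poly L (\<lambda>x. u i x + (\<Sum>i\<in>I. u i x))" by (intro trig_poly_add) auto
  then show ?case using insert by simp
qed

lemma trig_poly_mult:
  assumes "trig_poly L u" "trig_poly L v"
  shows "trig_poly L (\<lambda>x. u x * v x)"
proof -
  obtain F c where F: "finite F" "F \<subseteq> int_lattice" "u = (\<lambda>x. \<Sum>k\<in>F. c k * plane_wave L k x)"
    using assms(1) unfolding trig_poly_def by blast
  obtain H d where H: "finite H" "H \<subseteq> int_lattice" "v = (\<lambda>x. \<Sum>k\<in>H. d k * plane_wave L k x)"
    using assms(2) unfolding trig_poly_def by blast
  have "u x * v x = (\<Sum>k\<in>F. \<Sum>l\<in>H. (c k * d l) * plane_wave L (k + l) x)" for x
    unfolding F(3) H(3) sum_product by (simp add: plane_wave_mult[symmetric] ac_simps)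
  moreover have "trig_poly L (\<lambda>x. \<Sum>k\<in>F. \<Sum>l\<in>H. (c k * d l) * plane_wave L (k + l) x)"
    using F H by (intro trig_poly_sum trig_poly_plane_wave int_lattice_add) auto
  ultimately show ?thesis by simp
qed

text \<open>Expand the square, use orthogonality of the waves and complete the square in the
  coefficients. Choosing c as the Fourier coefficients gives Bessel's inequality; a general c shows
  that this choice is the best approximation on F.\<close>

lemma integral_norm_diff_trig_poly:
  fixes c :: "real^2 \<Rightarrow> complex"
  assumes L: "L > 0" and f: "in_Lp 2 (cell L) f" and F: "finite F" "F \<subseteq> int_lattice"
  defines "P \<equiv> \<lambda>x. \<Sum>k\<in>F. c k * plane_wave L k x"
  shows "(LINT x|cellM L. (cmod (complex_of_real (f x) - P x))\<^sup>2) =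
    (LINT x|cellM L. (f x)\<^sup>2) - L\<^sup>2 * (\<Sum>k\<in>F. (cmod (fourier_coeff L f k))\<^sup>2)
      + L\<^sup>2 * (\<Sum>k\<in>F. (cmod (c k - fourier_coeff L f k))\<^sup>2)"
proof -
  let ?a = "fourier_coeff L f"
  have f1: "integrable (cellM L) f" by (rule in_Lp_integrable[OF f]) simp
  have f2: "integrable (cellM L) (\<lambda>x. (f x)\<^sup>2)" using f by (simp add: in_Lp_cell_iff)
  have fw: "(LINT x|cellM L. complex_of_real (f x) * plane_wave L (- k) x) = of_real (L\<^sup>2) * ?a k" for k
    using L by (simp add: fourier_coeff_eq)
  note iw = integrable_mult_plane_wave[OF f1]
  have cP: "cnj (P x) = (\<Sum>k\<in>F. cnj (c k) * plane_wave L (- k) x)" for x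
    by (simp add: P_def cnj_plane_wave)
  have fP: "complex_of_real (f x) * cnj (P x) = (\<Sum>k\<in>F. cnj (c k) * (complex_of_real (f x) * plane_wave L (- k) x))" for x
    unfolding cP sum_distrib_left by (simp add: ac_simps)
  have PP: "P x * cnj (P x) = (\<Sum>k\<in>F. \<Sum>l\<in>F. (c k * cnj (c l)) * plane_wave L (k - l) x)" for x
    unfolding cP unfolding P_def sum_product
    using plane_wave_mult[of L _ x "- _"] by (simp add: ac_simps flip: plane_wave_mult)
  have i1: "integrable (cellM L) (\<lambda>x. complex_of_real (f x) * cnj (P x))"
    unfolding fP by (intro Bochner_Integration.integrable_sum integrable_mult_right iw)
  have iwv: "integrable (cellM L) (plane_wave L k)" for k
    by (rule integrable_cellM_bounded[OF plane_wave_measurable, of _ _ 1]) simp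
  have i2: "integrable (cellM L) (\<lambda>x. P x * cnj (P x))"
    unfolding PP by (intro Bochner_Integration.integrable_sum integrable_mult_right iwv)
  have e1: "(LINT x|cellM L. complex_of_real (f x) * cnj (P x)) = of_real (L\<^sup>2) * (\<Sum>k\<in>F. cnj (c k) * ?a k)"
    unfolding fP by (subst Bochner_Integration.integral_sum) (auto simp: iw fw sum_distrib_left ac_simps intro!: integrable_mult_right)
  have e2: "(LINT x|cellM L. P x * cnj (P x)) = of_real (L\<^sup>2) * (\<Sum>k\<in>F. c k * cnj (c k))"
  proof -
    have "(LINT x|cellM L. P x * cnj (P x)) = (\<Sum>k\<in>F. \<Sum>l\<in>F. (c k * cnj (c l)) * (LINT x|cellM L. plane_wave L (k - l) x))"
      unfolding PP
      by (subst Bochner_Integration.integral_sum, intro Bochner_Integration.integrable_sum integrable_mult_right iwv,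
          intro sum.cong refl, subst Bochner_Integration.integral_sum, intro integrable_mult_right iwv, simp)
    also have "\<dots> = (\<Sum>k\<in>F. \<Sum>l\<in>F. if l = k then (c k * cnj (c k)) * of_real (L\<^sup>2) else 0)"
    proof (intro sum.cong refl)
      fix k l assume "k \<in> F" "l \<in> F"
      then have "k - l \<in> int_lattice"
        using F int_lattice_add[OF _ int_lattice_uminus, of k l] by auto
      then show "c k * cnj (c l) * (LINT x|cellM L. plane_wave L (k - l) x) = (if l = k then c k * cnj (c k) * of_real (L\<^sup>2) else 0)"
        by (simp add: integral_plane_wave[OF L])
    qed
    also have "\<dots> = of_real (L\<^sup>2) * (\<Sum>k\<in>F. c k * cnj (c k))"
      using F(1) by (simp add: sum_distrib_left ac_simps)
    finally show ?thesis .
  qed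
  have r: "Re (of_real s * z) = s * Re z" for s z by simp
  have pt: "(cmod (complex_of_real (f x) - P x))\<^sup>2 = (f x)\<^sup>2 - 2 * Re (complex_of_real (f x) * cnj (P x)) + Re (P x * cnj (P x))" for x
    unfolding cmod_power2 by (simp add: power2_eq_square algebra_simps)
  have "(LINT x|cellM L. (cmod (complex_of_real (f x) - P x))\<^sup>2) = (LINT x|cellM L. (f x)\<^sup>2)
      - 2 * (LINT x|cellM L. Re (complex_of_real (f x) * cnj (P x))) + (LINT x|cellM L. Re (P x * cnj (P x)))"
    unfolding pt using f2 integrable_Re[OF i1] integrable_Re[OF i2] by (simp del: complex_mult_cnj)
  also have "\<dots> = (LINT x|cellM L. (f x)\<^sup>2) - 2 * Re (of_real (L\<^sup>2) * (\<Sum>k\<in>F. cnj (c k) * ?a k)) + Re (of_real (L\<^sup>2) * (\<Sum>k\<in>F. c k * cnj (c k)))"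
    by (simp only: integral_Re[OF i1] integral_Re[OF i2] e1 e2)
  also have "\<dots> = (LINT x|cellM L. (f x)\<^sup>2) + L\<^sup>2 * (\<Sum>k\<in>F. - 2 * Re (cnj (c k) * ?a k) + Re (c k * cnj (c k)))"
    by (simp only: sum.distrib sum_distrib_left[symmetric] r Re_sum) (simp add: algebra_simps)
  also have "(\<Sum>k\<in>F. - 2 * Re (cnj (c k) * ?a k) + Re (c k * cnj (c k)))
      = (\<Sum>k\<in>F. (cmod (c k - ?a k))\<^sup>2 - (cmod (?a k))\<^sup>2)"
    unfolding cmod_power2 by (rule sum.cong) (auto simp: power2_eq_square algebra_simps)
  finally show ?thesis by (simp add: sum_subtractf algebra_simps)
qed

text \<open>Polynomials in the coordinates of the embedded torus pull back to trigonometric polynomials, so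
  Stone--Weierstrass on the torus yields their density.\<close>

definition torus_embedding :: "real \<Rightarrow> real^2 \<Rightarrow> complex \<times> complex"
  where "torus_embedding L x = (plane_wave L (axis 1 1) x, plane_wave L (axis 2 1) x)"

text \<open>Real polynomial functions are generated by linear functionals. On the torus these are
  combinations of Re and Im of two unit complex numbers, hence of the numbers and their conjugates:
  four plane waves. The identity a Re z + b Im z = (a - ib)/2 z + (a + ib)/2 conj z supplies the
  coefficients.\<close>

lemma trig_poly_real_polynomial_function:
  assumes "real_polynomial_function g"
  shows "trig_poly L (\<lambda>x. of_real (g (torus_embedding L x)))"
  using assms
proof induction
  case (linear f)
  have lin: "f (z, w) = Re z * f (1, 0) + Im z * f (\<i>, 0) + Re w * f (0, 1) + Im w * f (0, \<i>)" for z w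
  proof -
    interpret f: bounded_linear f by (rule linear)
    have "(z, w) = Re z *\<^sub>R (1, 0) + Im z *\<^sub>R (\<i>, 0) + Re w *\<^sub>R (0, 1) + Im w *\<^sub>R (0, \<i>)"
      by (simp add: complex_eq_iff)
    then have "f (z, w) = f (Re z *\<^sub>R (1, 0) + Im z *\<^sub>R (\<i>, 0) + Re w *\<^sub>R (0, 1) + Im w *\<^sub>R (0, \<i>))"
      by (rule arg_cong)
    then show ?thesis by (simp only: f.add f.scaleR real_scaleR_def)
  qed
  have cplx: "complex_of_real (Re z * a + Im z * b + Re w * c + Im w * d) =
      Complex (a / 2) (- b / 2) * z + Complex (a / 2) (b / 2) * cnj z
      + Complex (c / 2) (- d / 2) * w + Complex (c / 2) (d / 2) * cnj w" for a b c d z w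
    by (simp add: complex_eq_iff)
  have *: "of_real (f (torus_embedding L x)) =
      Complex (f (1, 0) / 2) (- f (\<i>, 0) / 2) * plane_wave L (axis 1 1) x
      + Complex (f (1, 0) / 2) (f (\<i>, 0) / 2) * plane_wave L (- axis 1 1) x
      + Complex (f (0, 1) / 2) (- f (0, \<i>) / 2) * plane_wave L (axis 2 1) x
      + Complex (f (0, 1) / 2) (f (0, \<i>) / 2) * plane_wave L (- axis 2 1) x" for x
    unfolding torus_embedding_def lin[of "plane_wave L (axis 1 1) x" "plane_wave L (axis 2 1) x"] cplx cnj_plane_wave ..
  show ?case
    unfolding * by (intro trig_poly_add trig_poly_plane_wave int_lattice_uminus int_lattice_axis)
next
  case (const c)
  then show ?case using trig_poly_plane_wave[OF int_lattice_0, of L "of_real c"] by simp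
next
  case (add f g)
  then show ?case by (simp add: trig_poly_add)
next
  case (mult f g)
  then show ?case by (simp add: trig_poly_mult)
qed

text \<open>In a coordinate where the two points differ, they do so by a nonzero multiple of L,
  which inside the closed cell is possible only between opposite sides. So a function that is 0 on
  the boundary is constant on the fibres of the embedding.\<close>

lemma torus_embedding_eq_imp:
  assumes L: "L > 0" and "x \<in> cell L" "y \<in> cell L" "torus_embedding L x = torus_embedding L y" "x \<noteq> y"
  shows "x \<notin> box (vec 0) (vec L) \<and> y \<notin> box (vec 0) (vec L)"
proof -
  obtain i where i: "x $ i \<noteq> y $ i" using assms(5) by (auto simp: vec_eq_iff)
  have "plane_wave L (axis i 1) x = plane_wave L (axis i 1) y"
    using assms(4) exhaust_2[of i] by (auto simp: torus_embedding_def)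
  then have "cis (2 * pi * (x $ i) / L) = cis (2 * pi * (y $ i) / L)"
    by (simp add: plane_wave_def inner_axis')
  then have "sin (2 * pi * (x $ i) / L) = sin (2 * pi * (y $ i) / L) \<and> cos (2 * pi * (x $ i) / L) = cos (2 * pi * (y $ i) / L)"
    by (simp add: complex_eq_iff)
  then obtain n where n: "2 * pi * (x $ i) / L = 2 * pi * (y $ i) / L + 2 * pi * of_int n"
    using sin_cos_eq_iff by metis
  have eq: "x $ i - y $ i = L * of_int n"
  proof -
    have "2 * pi * (x $ i - y $ i) = 2 * pi * (L * of_int n)" using n L by (simp add: field_simps)
    then show ?thesis by simp
  qed
  have b: "0 \<le> x $ i" "x $ i \<le> L" "0 \<le> y $ i" "y $ i \<le> L"
    using assms(2,3) by (auto simp: cell_def mem_box_cart)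
  have "n \<noteq> 0" using eq i by auto
  then have "\<bar>real_of_int n\<bar> \<ge> 1" by linarith
  then have "L \<le> L * \<bar>real_of_int n\<bar>" using L by simp
  then have "L \<le> \<bar>x $ i - y $ i\<bar>" unfolding eq using L by (simp add: abs_mult)
  then have "x $ i = 0 \<and> y $ i = L \<or> x $ i = L \<and> y $ i = 0" using b by linarith
  then show ?thesis by (auto simp: mem_box_cart) (metis less_irrefl)+
qed

text \<open>Because h vanishes on the boundary it factors through the embedding. A continuous map
  from a compact space onto a Hausdorff image is a quotient map, so the factor is continuous on the
  torus and Stone--Weierstrass applies to it.\<close>

lemma trig_poly_approx_uniform:
  assumes L: "L > 0" and h: "continuous_on (cell L) h"
    and bd: "\<And>x. x \<in> cell L \<Longrightarrow> x \<notin> box (vec 0) (vec L) \<Longrightarrow> h x = (0::real)" and "e > 0"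
  shows "\<exists>u. trig_poly L u \<and> (\<forall>x\<in>cell L. cmod (complex_of_real (h x) - u x) < e)"
proof -
  let ?E = "torus_embedding L" and ?T = "torus_embedding L ` cell L"
  have cE: "continuous_on (cell L) ?E"
    unfolding torus_embedding_def by (intro continuous_intros continuous_on_plane_wave)
  have cc: "compact (cell L)" by (simp add: cell_def compact_cbox)
  have q: "quotient_map (top_of_set (cell L)) (top_of_set ?T) ?E"
    by (rule T1_Spaces.continuous_imp_quotient_map) (use cE cc in \<open>auto simp: compact_space_subtopology Hausdorff_space_subtopology\<close>)
  obtain g where g: "continuous_map (top_of_set ?T) euclideanreal g" "\<And>x. x \<in> cell L \<Longrightarrow> g (?E x) = h x"
  proof (rule quotient_map_lift_exists[OF q, of euclideanreal h])
    show "continuous_map (top_of_set (cell L)) euclideanreal h" using h by simp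
    show "h x = h y" if "x \<in> topspace (top_of_set (cell L))" "y \<in> topspace (top_of_set (cell L))" "?E x = ?E y" for x y
      using torus_embedding_eq_imp[OF L, of x y] bd that by (cases "x = y") auto
  qed auto
  have "compact ?T" using cE cc by (rule compact_continuous_image)
  moreover have "continuous_on ?T g" using g(1) by simp
  ultimately obtain p where p: "real_polynomial_function p" "\<And>x. x \<in> ?T \<Longrightarrow> \<bar>g x - p x\<bar> < e"
    using Stone_Weierstrass_real_polynomial_function \<open>e > 0\<close> by metis
  have "cmod (complex_of_real (h x) - complex_of_real (p (?E x))) < e" if "x \<in> cell L" for x
    using p(2)[of "?E x"] g(2)[OF that] that by (simp flip: of_real_diff)
  with trig_poly_real_polynomial_function[OF p(1)] show ?thesis by blast
qed


lemma square_sum3_le: "(a + b + c)\<^sup>2 \<le> 3 * (a\<^sup>2 + b\<^sup>2 + c\<^sup>2)" for a b c :: real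
proof -
  have "0 \<le> (a - b)\<^sup>2 + (b - c)\<^sup>2 + (a - c)\<^sup>2" by simp
  then show ?thesis by (simp add: power2_eq_square algebra_simps)
qed

lemma continuous_approx_bounded:
  assumes L: "L > 0" and f: "f \<in> borel_measurable (cellM L)" and M: "\<And>x. \<bar>f x\<bar> \<le> M" and "e > 0"
  shows "\<exists>h. continuous_on UNIV h \<and> (\<forall>x. x \<notin> box (vec 0) (vec L) \<longrightarrow> h x = 0) \<and> (LINT x|cellM L. (f x - h x)\<^sup>2) < (e::real)"
proof -
  have "f measurable_on cell L"
    using f measurable_on_iff_borel_measurable[of "cell L" f] by simp
  then obtain N g where N: "negligible N" and g: "\<And>n. continuous_on UNIV (g n)"
    "\<And>x. x \<notin> N \<Longrightarrow> (\<lambda>n. g n x) \<longlonglongrightarrow> (if x \<in> cell L then f x else 0)"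
    unfolding measurable_on_def by blast
  have M0: "M \<ge> 0" using M[of undefined] by linarith
  \<comment> \<open>\<open>w\<close> is the distance to the nearest side inside the cell and 0
    outside. The factor \<open>min 1 (real n * w x)\<close> forces \<open>h n\<close> to vanish on
    the boundary, yet tends to 1 at every interior point; clamping to [-M, M] gives the bound for
    dominated convergence.\<close>
  define w :: "real^2 \<Rightarrow> real" where "w x = max 0 (min (min (x $ 1) (L - x $ 1)) (min (x $ 2) (L - x $ 2)))" for x
  define h where "h n x = min 1 (real n * w x) * max (- M) (min M (g n x))" for n x
  have w: "w x > 0 \<longleftrightarrow> x \<in> box (vec 0) (vec L)" "w x \<ge> 0" for x
    by (auto simp: w_def mem_box_cart forall_2)
  have ch: "continuous_on UNIV (h n)" for n
    unfolding h_def w_def by (intro continuous_intros g)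
  have h0: "h n x = 0" if "x \<notin> box (vec 0) (vec L)" for n x
    using w[of x] that by (simp add: h_def order_le_less)
  have hM: "\<bar>h n x\<bar> \<le> M" for n x
  proof -
    have "\<bar>min 1 (real n * w x)\<bar> \<le> 1" using w(2)[of x] by (simp add: abs_le_iff min_def)
    moreover have "\<bar>max (- M) (min M (g n x))\<bar> \<le> M" using M0 by auto
    ultimately show ?thesis
      unfolding h_def abs_mult using mult_mono[of _ 1 _ M] M0 by fastforce
  qed
  have "(\<lambda>n. LINT x|cellM L. (f x - h n x)\<^sup>2) \<longlonglongrightarrow> (LINT x|cellM L. 0)"
  proof (rule integral_dominated_convergence)
    show "(\<lambda>x. (f x - h n x)\<^sup>2) \<in> borel_measurable (cellM L)" for n
      by (intro borel_measurable_power borel_measurable_diff f measurable_cellM continuous_measurable_lebesgue ch)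
    show "integrable (cellM L) (\<lambda>x. (2 * M)\<^sup>2)" by (rule integrable_cellM_const)
    show "AE x in cellM L. norm ((f x - h n x)\<^sup>2) \<le> (2 * M)\<^sup>2" for n
    proof (rule AE_I2)
      fix x
      have "\<bar>f x - h n x\<bar> \<le> 2 * M" using M[of x] hM[of n x] by linarith
      then have "\<bar>f x - h n x\<bar>\<^sup>2 \<le> (2 * M)\<^sup>2" by (intro power_mono) auto
      then show "norm ((f x - h n x)\<^sup>2) \<le> (2 * M)\<^sup>2" by simp
    qed
    have "AE x in cellM L. x \<in> box (vec 0) (vec L)"
      by (subst AE_restrict_space_iff) (use AE_cell_open[of L] in auto)
    moreover have "AE x in cellM L. x \<notin> N"
      using N by (intro AE_cellM AE_not_in) (simp add: negligible_iff_null_sets)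
    ultimately show "AE x in cellM L. (\<lambda>n. (f x - h n x)\<^sup>2) \<longlonglongrightarrow> 0"
    proof eventually_elim
      case (elim x)
      then have "x \<in> cell L" unfolding cell_def using box_subset_cbox by blast
      with g(2)[OF elim(2)] have "(\<lambda>n. max (- M) (min M (g n x))) \<longlonglongrightarrow> max (- M) (min M (f x))"
        by (auto intro!: tendsto_intros)
      moreover have "max (- M) (min M (f x)) = f x" using M[of x] by (auto simp: abs_le_iff)
      moreover have "(\<lambda>n. min 1 (real n * w x)) \<longlonglongrightarrow> 1"
      proof (rule tendsto_eventually)
        have "filterlim (\<lambda>n. real n * w x) at_top sequentially"
          using w(1)[of x] elim(1) filterlim_real_sequentially
          by (intro filterlim_at_top_mult_tendsto_pos[OF tendsto_const]) auto
        then have "eventually (\<lambda>n. 1 \<le> real n * w x) sequentially"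
          by (simp add: filterlim_at_top)
        then show "eventually (\<lambda>n. min 1 (real n * w x) = 1) sequentially" by eventually_elim simp
      qed
      ultimately have "(\<lambda>n. h n x) \<longlonglongrightarrow> 1 * f x" unfolding h_def by (metis tendsto_mult)
      then have "(\<lambda>n. (f x - h n x)\<^sup>2) \<longlonglongrightarrow> (f x - 1 * f x)\<^sup>2" by (intro tendsto_intros)
      then show ?case by simp
    qed
  qed simp
  then have "eventually (\<lambda>n. (LINT x|cellM L. (f x - h n x)\<^sup>2) < e) sequentially"
    using \<open>e > 0\<close> by (intro order_tendstoD(2)) auto
  then obtain n where "(LINT x|cellM L. (f x - h n x)\<^sup>2) < e"
    by (auto simp: eventually_sequentially)
  with ch h0 show ?thesis by blast
qed

lemma truncation_approx:
  assumes f: "in_Lp 2 (cell L) f" and "e > 0"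
  shows "\<exists>n::nat. (LINT x|cellM L. (f x - max (- real n) (min (real n) (f x)))\<^sup>2) < e"
proof -
  define t where "t n x = max (- real n) (min (real n) (f x))" for n :: nat and x
  have fm: "f \<in> borel_measurable (cellM L)" and f2: "integrable (cellM L) (\<lambda>x. (f x)\<^sup>2)"
    using f by (auto simp: in_Lp_cell_iff)
  have "(\<lambda>n. LINT x|cellM L. (f x - t n x)\<^sup>2) \<longlonglongrightarrow> (LINT x|cellM L. 0)"
  proof (rule integral_dominated_convergence[OF _ _ f2])
    show "(\<lambda>x. (f x - t n x)\<^sup>2) \<in> borel_measurable (cellM L)" for n
      unfolding t_def using fm by simp
    show "AE x in cellM L. norm ((f x - t n x)\<^sup>2) \<le> (f x)\<^sup>2" for n
    proof (rule AE_I2)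
      fix x
      have "\<bar>f x - t n x\<bar> \<le> \<bar>f x\<bar>" by (auto simp: t_def)
      then show "norm ((f x - t n x)\<^sup>2) \<le> (f x)\<^sup>2" by (simp add: abs_le_square_iff)
    qed
    show "AE x in cellM L. (\<lambda>n. (f x - t n x)\<^sup>2) \<longlonglongrightarrow> 0"
    proof (rule AE_I2, rule tendsto_eventually)
      fix x
      obtain m :: nat where "\<bar>f x\<bar> \<le> real m" using real_arch_simple by blast
      then have "(f x - t n x)\<^sup>2 = 0" if "n \<ge> m" for n
        using that by (auto simp: t_def max_def min_def)
      then show "eventually (\<lambda>n. (f x - t n x)\<^sup>2 = 0) sequentially"
        by (auto simp: eventually_sequentially)
    qed
  qed simp
  then have "eventually (\<lambda>n. (LINT x|cellM L. (f x - t n x)\<^sup>2) < e) sequentially"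
    using \<open>e > 0\<close> by (intro order_tendstoD(2)) auto
  then show ?thesis unfolding t_def by (auto simp: eventually_sequentially)
qed

text \<open>Three successive approximations: truncation, a continuous function vanishing on the
  boundary, a trigonometric polynomial. \<open>square_sum3_le\<close> costs a factor 3, so each
  squared error may use e/9, and d is chosen so that the uniform error also stays below it after
  integration over the cell.\<close>

lemma trig_poly_dense:
  assumes L: "L > 0" and f: "in_Lp 2 (cell L) f" and e: "e > 0"
  shows "\<exists>u. trig_poly L u \<and> (LINT x|cellM L. (cmod (complex_of_real (f x) - u x))\<^sup>2) < e"
proof -
  have fm: "f \<in> borel_measurable (cellM L)" and f2: "integrable (cellM L) (\<lambda>x. (f x)\<^sup>2)"
    using f by (auto simp: in_Lp_cell_iff)
  obtain n :: nat where "(LINT x|cellM L. (f x - max (- real n) (min (real n) (f x)))\<^sup>2) < e / 9"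
    using truncation_approx[OF f, of "e / 9"] e by auto
  moreover define t where "t x = max (- real n) (min (real n) (f x))" for x
  ultimately have t: "(LINT x|cellM L. (f x - t x)\<^sup>2) < e / 9" by simp
  have tm: "t \<in> borel_measurable (cellM L)" unfolding t_def[abs_def] using fm by simp
  have tn: "\<bar>t x\<bar> \<le> real n" for x by (auto simp: t_def)
  obtain h where h: "continuous_on UNIV h" "\<forall>x. x \<notin> box (vec 0) (vec L) \<longrightarrow> h x = 0" "(LINT x|cellM L. (t x - h x)\<^sup>2) < e / 9"
    using continuous_approx_bounded[OF L tm tn, of "e / 9"] e by auto
  have hm: "h \<in> borel_measurable (cellM L)"
    by (intro measurable_cellM continuous_measurable_lebesgue h)
  define d where "d = sqrt (e / (9 * (L\<^sup>2 + 1)))"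
  have L2: "L\<^sup>2 + 1 > 0" by (simp add: add_nonneg_pos)
  have d: "d > 0" using e L2 by (simp add: d_def)
  obtain u where u: "trig_poly L u" "\<And>x. x \<in> cell L \<Longrightarrow> cmod (complex_of_real (h x) - u x) < d"
    using trig_poly_approx_uniform[OF L continuous_on_subset[OF h(1) subset_UNIV] _ d] h(2) by blast
  have um: "u \<in> borel_measurable (cellM L)"
    using u(1) plane_wave_measurable unfolding trig_poly_def by (auto intro!: borel_measurable_sum borel_measurable_times)
  have ud: "(cmod (complex_of_real (h x) - u x))\<^sup>2 \<le> d\<^sup>2" if "x \<in> cell L" for x
    using u(2)[OF that] by (intro power_mono) auto
  have i1: "integrable (cellM L) (\<lambda>x. (f x - t x)\<^sup>2)"
  proof (rule Bochner_Integration.integrable_bound[OF f2])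
    show "AE x in cellM L. norm ((f x - t x)\<^sup>2) \<le> norm ((f x)\<^sup>2)"
    proof (rule AE_I2)
      fix x
      have "\<bar>f x - t x\<bar> \<le> \<bar>f x\<bar>" by (auto simp: t_def)
      then show "norm ((f x - t x)\<^sup>2) \<le> norm ((f x)\<^sup>2)" by (simp add: abs_le_square_iff)
    qed
  qed (use fm tm in simp)
  have bh: "bounded (h ` cell L)"
    by (intro compact_imp_bounded compact_continuous_image continuous_on_subset[OF h(1)]) (auto simp: cell_def compact_cbox)
  then obtain K where K: "\<And>x. x \<in> cell L \<Longrightarrow> \<bar>h x\<bar> \<le> K" by (auto simp: bounded_real)
  have i2: "integrable (cellM L) (\<lambda>x. (t x - h x)\<^sup>2)"
  proof (rule integrable_cellM_bounded)
    show "norm ((t x - h x)\<^sup>2) \<le> (real n + K)\<^sup>2" if "x \<in> cell L" for x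
      using K[OF that] tn[of x] by (auto intro!: power2_le_iff_abs_le[THEN iffD2])
  qed (use tm hm in simp)
  have i3: "integrable (cellM L) (\<lambda>x. (cmod (complex_of_real (h x) - u x))\<^sup>2)"
    by (rule integrable_cellM_bounded[of _ _ "d\<^sup>2"]) (use ud hm um in auto)
  have "(LINT x|cellM L. (cmod (complex_of_real (h x) - u x))\<^sup>2) \<le> (LINT x|cellM L. d\<^sup>2)"
    by (rule integral_mono[OF i3 integrable_cellM_const]) (use ud in simp)
  also have "\<dots> = L\<^sup>2 / (L\<^sup>2 + 1) * (e / 9)"
    using L L2 e by (subst integral_cellM_const) (auto simp: d_def)
  also have "\<dots> \<le> 1 * (e / 9)"
    using e L2 by (intro mult_right_mono) (auto simp: divide_le_eq)
  finally have c3: "(LINT x|cellM L. (cmod (complex_of_real (h x) - u x))\<^sup>2) \<le> e / 9" by simp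
  let ?R = "\<lambda>x. 3 * ((f x - t x)\<^sup>2 + (t x - h x)\<^sup>2 + (cmod (complex_of_real (h x) - u x))\<^sup>2)"
  have iR: "integrable (cellM L) ?R" using i1 i2 i3 by simp
  have le: "(cmod (complex_of_real (f x) - u x))\<^sup>2 \<le> ?R x" for x
  proof -
    have "complex_of_real (f x) - u x = complex_of_real (f x - t x) + complex_of_real (t x - h x) + (complex_of_real (h x) - u x)" by simp
    also have "cmod \<dots> \<le> \<bar>f x - t x\<bar> + \<bar>t x - h x\<bar> + cmod (complex_of_real (h x) - u x)"
      by (intro norm_triangle_le add_mono order_refl) (simp_all only: norm_of_real order_refl)
    finally have "cmod (complex_of_real (f x) - u x) \<le> \<bar>f x - t x\<bar> + \<bar>t x - h x\<bar> + cmod (complex_of_real (h x) - u x)" .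
    then have "(cmod (complex_of_real (f x) - u x))\<^sup>2 \<le> (\<bar>f x - t x\<bar> + \<bar>t x - h x\<bar> + cmod (complex_of_real (h x) - u x))\<^sup>2"
      by (intro power_mono) auto
    also have "\<dots> \<le> ?R x" using square_sum3_le[of "\<bar>f x - t x\<bar>" "\<bar>t x - h x\<bar>" "cmod (complex_of_real (h x) - u x)"] by simp
    finally show ?thesis .
  qed
  have iu: "integrable (cellM L) (\<lambda>x. (cmod (complex_of_real (f x) - u x))\<^sup>2)"
    by (rule Bochner_Integration.integrable_bound[OF iR]) (use fm um le in \<open>auto intro: order.trans[OF _ abs_ge_self]\<close>)
  have "(LINT x|cellM L. (cmod (complex_of_real (f x) - u x))\<^sup>2) \<le> (LINT x|cellM L. ?R x)"
    by (rule integral_mono[OF iu iR le])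
  also have "\<dots> = 3 * ((LINT x|cellM L. (f x - t x)\<^sup>2) + (LINT x|cellM L. (t x - h x)\<^sup>2) + (LINT x|cellM L. (cmod (complex_of_real (h x) - u x))\<^sup>2))"
    using i1 i2 i3 by simp
  also have "\<dots> < e"
  proof -
    have "3 * (A + B + C) < e" if "A < e / 9" "B < e / 9" "C \<le> e / 9" for A B C :: real
    proof -
      have "A + B + C < e / 9 + e / 9 + e / 9" by (intro add_less_le_mono add_strict_mono that)
      then show ?thesis by (simp add: field_simps)
    qed
    from this[OF t h(3) c3] show ?thesis .
  qed
  finally show ?thesis using u(1) by blast
qed

section \<open>Parseval's identity and the Poincare inequality\<close>

text \<open>Bessel's inequality bounds every finite partial sum. Density provides one finite set
  whose partial sum is within e of the bound, and since the terms are nonnegative every larger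
  finite set does at least as well.\<close>

theorem parseval:
  assumes L: "L > 0" and f: "in_Lp 2 (cell L) f"
  shows "((\<lambda>k. (cmod (fourier_coeff L f k))\<^sup>2) has_sum (LINT x|cellM L. (f x)\<^sup>2) / L\<^sup>2) int_lattice"
proof -
  let ?S = "(LINT x|cellM L. (f x)\<^sup>2) / L\<^sup>2" and ?a = "\<lambda>k. (cmod (fourier_coeff L f k))\<^sup>2"
  have bessel: "sum ?a F \<le> ?S" if F: "finite F" "F \<subseteq> int_lattice" for F
  proof -
    have "0 \<le> (LINT x|cellM L. (cmod (complex_of_real (f x) - (\<Sum>k\<in>F. fourier_coeff L f k * plane_wave L k x)))\<^sup>2)"
      by (rule Bochner_Integration.integral_nonneg) simp
    then have "L\<^sup>2 * sum ?a F \<le> (LINT x|cellM L. (f x)\<^sup>2)"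
      unfolding integral_norm_diff_trig_poly[OF L f F] by simp
    then show ?thesis using L by (simp add: pos_le_divide_eq mult.commute)
  qed
  have "(sum ?a \<longlongrightarrow> ?S) (finite_subsets_at_top int_lattice)"
  proof (rule tendstoI)
    fix e :: real assume "e > 0"
    then have "L\<^sup>2 * e > 0" using L by simp
    from trig_poly_dense[OF L f this] obtain F c where F: "finite F" "F \<subseteq> int_lattice"
      and c: "(LINT x|cellM L. (cmod (complex_of_real (f x) - (\<Sum>k\<in>F. c k * plane_wave L k x)))\<^sup>2) < L\<^sup>2 * e"
      unfolding trig_poly_def by blast
    have "0 \<le> L\<^sup>2 * (\<Sum>k\<in>F. (cmod (c k - fourier_coeff L f k))\<^sup>2)" by (simp add: sum_nonneg)
    with c have "(LINT x|cellM L. (f x)\<^sup>2) - L\<^sup>2 * sum ?a F < L\<^sup>2 * e"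
      unfolding integral_norm_diff_trig_poly[OF L f F] by linarith
    then have "L\<^sup>2 * (?S - e) < L\<^sup>2 * sum ?a F" using L by (simp add: right_diff_distrib)
    then have 1: "?S - e < sum ?a F" using L by simp
    have "dist (sum ?a H) ?S < e" if "finite H" "F \<subseteq> H" "H \<subseteq> int_lattice" for H
      using 1 bessel[OF that(1,3)] sum_mono2[OF that(1,2), of ?a] by (simp add: dist_real_def)
    then show "eventually (\<lambda>H. dist (sum ?a H) ?S < e) (finite_subsets_at_top int_lattice)"
      unfolding eventually_finite_subsets_at_top using F by blast
  qed
  then show ?thesis by (simp add: has_sum_def)
qed

text \<open>Parseval for each component of G. The factor 4 pi^2 / L^2 from differentiating a wave
  cancels against the area L^2 of the cell, which is why L is absent from the result.\<close>

theorem parseval_weak_gradient: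
  assumes L: "L > 0" and v: "periodic_AE L v" "has_weak_gradient v G" and G: "in_Lp 2 (cell L) G"
  shows "((\<lambda>k. (norm k)\<^sup>2 * (cmod (fourier_coeff L v k))\<^sup>2) has_sum (LINT x|cellM L. (norm (G x))\<^sup>2) / (4 * pi\<^sup>2)) int_lattice"
proof -
  have Gm: "G \<in> borel_measurable (cellM L)" and G2: "integrable (cellM L) (\<lambda>x. (norm (G x))\<^sup>2)"
    using G by (auto simp: in_Lp_cell_iff)
  have Gj: "in_Lp 2 (cell L) (\<lambda>x. G x $ j)" for j
    unfolding in_Lp_cell_iff
  proof
    show m: "(\<lambda>x. G x $ j) \<in> borel_measurable (cellM L)"
      using borel_measurable_continuous_onI[OF linear_continuous_on[OF bounded_linear_vec_nth]] Gm by (rule measurable_compose[rotated])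
    have le: "norm (norm (G x $ j) ^ 2) \<le> norm ((norm (G x))\<^sup>2)" for x
      using power_mono[OF component_le_norm_cart[of "G x" j], of 2] by simp
    show "integrable (cellM L) (\<lambda>x. norm (G x $ j) ^ 2)"
      by (rule Bochner_Integration.integrable_bound[OF G2 _ AE_I2[OF le]]) (use m in simp)
  qed
  have norm2: "(norm x)\<^sup>2 = (x $ 1)\<^sup>2 + (x $ 2)\<^sup>2" for x :: "real^2"
    by (simp add: norm_vec_def L2_set_def sum_2 real_sqrt_pow2)
  have eq: "(cmod (fourier_coeff L (\<lambda>x. G x $ j) k))\<^sup>2 = 4 * pi\<^sup>2 / L\<^sup>2 * ((k $ j)\<^sup>2 * (cmod (fourier_coeff L v k))\<^sup>2)" if "k \<in> int_lattice" for j k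
    unfolding fourier_coeff_weak_gradient[OF L v that]
    by (simp add: norm_mult norm_divide power_mult_distrib power_divide)
  have "((\<lambda>k. (cmod (fourier_coeff L (\<lambda>x. G x $ 1) k))\<^sup>2 + (cmod (fourier_coeff L (\<lambda>x. G x $ 2) k))\<^sup>2)
      has_sum (LINT x|cellM L. (G x $ 1)\<^sup>2) / L\<^sup>2 + (LINT x|cellM L. (G x $ 2)\<^sup>2) / L\<^sup>2) int_lattice"
    by (intro has_sum_add parseval L Gj)
  also have "(LINT x|cellM L. (G x $ 1)\<^sup>2) / L\<^sup>2 + (LINT x|cellM L. (G x $ 2)\<^sup>2) / L\<^sup>2 = (LINT x|cellM L. (norm (G x))\<^sup>2) / L\<^sup>2"
    using Gj[of 1] Gj[of 2] by (simp add: in_Lp_cell_iff norm2 add_divide_distrib)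
  finally have "((\<lambda>k. L\<^sup>2 / (4 * pi\<^sup>2) * ((cmod (fourier_coeff L (\<lambda>x. G x $ 1) k))\<^sup>2 + (cmod (fourier_coeff L (\<lambda>x. G x $ 2) k))\<^sup>2))
      has_sum L\<^sup>2 / (4 * pi\<^sup>2) * ((LINT x|cellM L. (norm (G x))\<^sup>2) / L\<^sup>2)) int_lattice"
    by (rule has_sum_cmult_right)
  then have "((\<lambda>k. (norm k)\<^sup>2 * (cmod (fourier_coeff L v k))\<^sup>2)
      has_sum L\<^sup>2 / (4 * pi\<^sup>2) * ((LINT x|cellM L. (norm (G x))\<^sup>2) / L\<^sup>2)) int_lattice"
    by (rule has_sum_cong[THEN iffD1, rotated]) (use L in \<open>auto simp: eq norm2 field_simps\<close>)
  then show ?thesis using L by simp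
qed

text \<open>Compare the two Parseval sums term by term: the mean value 0 removes k = 0, and |k| is
  at least 1 for all other lattice points.\<close>

theorem poincare:
  assumes L: "L > 0" and v: "periodic_AE L v" "has_weak_gradient v G"
    and v2: "in_Lp 2 (cell L) v" and G: "in_Lp 2 (cell L) G" and mean: "(LINT x|cellM L. v x) = 0"
  shows "(LINT x|cellM L. (v x)\<^sup>2) \<le> L\<^sup>2 / (4 * pi\<^sup>2) * (LINT x|cellM L. (norm (G x))\<^sup>2)"
proof -
  have "(LINT x|cellM L. (v x)\<^sup>2) / L\<^sup>2 \<le> (LINT x|cellM L. (norm (G x))\<^sup>2) / (4 * pi\<^sup>2)"
  proof (rule has_sum_mono[OF parseval[OF L v2] parseval_weak_gradient[OF L v G]])
    fix k assume k: "k \<in> int_lattice"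
    show "(cmod (fourier_coeff L v k))\<^sup>2 \<le> (norm k)\<^sup>2 * (cmod (fourier_coeff L v k))\<^sup>2"
    proof (cases "k = 0")
      case True
      then show ?thesis by (simp add: fourier_coeff_eq mean)
    next
      case False
      then have "1 \<le> (norm k)\<^sup>2" using int_lattice_norm_ge_1[OF k] by (simp add: one_le_power)
      then show ?thesis using mult_right_mono[of 1 "(norm k)\<^sup>2"] by fastforce
    qed
  qed
  then show ?thesis using L by (simp add: field_simps)
qed

subsection \<open>The integrand\<close>

lemma gamma0_pos: "gamma0 c1 c2 > 0"
  by (simp add: gamma0_def)

lemma ln_gamma0: "c1 > 0 \<Longrightarrow> c1 * ln (gamma0 c1 c2) = - c2"
  by (simp add: gamma0_def)

text \<open>Write q = 3 c3 / c1 and g = gamma0. The convex function 1/(s + g) + q s has its critical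
  point at s = 1/sqrt q - g. The case distinction in \<open>beta\<close> asks whether this point is
  nonnegative; if not, the function increases on s >= 0 and its minimum is 1/g, at s = 0.\<close>

lemma beta_le:
  assumes c: "c1 > 0" "c3 > 0" and s: "s \<ge> 0"
  shows "beta c1 c2 c3 \<le> 1 / (s + gamma0 c1 c2) + 3 * c3 / c1 * s"
proof -
  define g where "g = gamma0 c1 c2"
  define q where "q = 3 * c3 / c1"
  have g: "g > 0" by (simp add: g_def gamma0_pos)
  have q: "q > 0" using c by (simp add: q_def)
  have sg: "s + g > 0" using s g by simp
  have iq: "c1 / (3 * c3) = 1 / q" by (simp add: q_def)
  show ?thesis
  proof (cases "sqrt (c1 / (3 * c3)) \<ge> g")
    case True
    have "(1 - r * t)\<^sup>2 / t = 1 / t - 2 * r + r\<^sup>2 * t" if "t > 0" for r t :: real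
      using that by (simp add: power2_eq_square field_simps)
    \<comment> \<open>The arithmetic-geometric mean inequality for 1/t and q t with t = s + g,
      written as a square divided by t.\<close>
    from this[OF sg, of "sqrt q"] have "(1 - sqrt q * (s + g))\<^sup>2 / (s + g) = 1 / (s + g) - 2 * sqrt q + q * (s + g)"
      using q by simp
    moreover have "0 \<le> (1 - sqrt q * (s + g))\<^sup>2 / (s + g)" using sg by simp
    ultimately have "0 \<le> 1 / (s + g) - 2 * sqrt q + q * (s + g)" by simp
    then have "2 * sqrt q - q * g \<le> 1 / (s + g) + q * s" by (simp add: algebra_simps)
    then show ?thesis using True by (simp add: beta_def flip: g_def q_def)
  next
    case False
    then have "(sqrt (1 / q))\<^sup>2 < g\<^sup>2" unfolding iq using q by (intro power_strict_mono) auto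
    then have "1 / q < g\<^sup>2" using q by simp
    also have "\<dots> \<le> g * (s + g)" using s g by (simp add: power2_eq_square)
    finally have "1 < g * (s + g) * q" using q by (simp only: pos_divide_less_eq)
    moreover have "g * (s + g) > 0" using g sg by simp
    ultimately have "1 / (g * (s + g)) \<le> q" by (simp only: pos_divide_le_eq mult.commute[of q])
    then have "0 \<le> s * (q - 1 / (g * (s + g)))" using s by simp
    also have "\<dots> = 1 / (s + g) + q * s - 1 / g"
    proof -
      have "s * (1 / (g * (s + g))) = 1 / g - 1 / (s + g)" using g sg by (simp add: field_simps)
      then show ?thesis by (simp add: right_diff_distrib)
    qed
    finally show ?thesis using False by (simp add: beta_def flip: g_def q_def)
  qed
qed

text \<open>In the first case gamma0 is at most 1/sqrt q, so the subtracted term is at most sqrt q,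
  half of the leading one. Positivity independent of L/a is what allows strong convexity to be used
  for existence as well.\<close>

lemma beta_pos:
  assumes c: "c1 > 0" "c3 > 0"
  shows "beta c1 c2 c3 > 0"
proof (cases "sqrt (c1 / (3 * c3)) \<ge> gamma0 c1 c2")
  case True
  define q where "q = 3 * c3 / c1"
  have q: "q > 0" using c by (simp add: q_def)
  have "q * gamma0 c1 c2 \<le> q * sqrt (1 / q)"
    using True q by (intro mult_left_mono) (auto simp: q_def)
  also have "\<dots> = sqrt q" using q by (simp add: real_sqrt_divide real_div_sqrt)
  also have "\<dots> < 2 * sqrt q" using q by simp
  finally show ?thesis using True by (simp add: beta_def flip: q_def)
next
  case False
  then show ?thesis by (simp add: beta_def gamma0_pos)
qed

text \<open>\<open>a * chi (norm p)\<close> is what remains of \<open>Psi\<close> after splitting off the quadratic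
  \<open>a c\<^sub>1 \<beta> |p|\<^sup>2 / 2\<close>.\<close>

definition chi :: "real \<Rightarrow> real \<Rightarrow> real \<Rightarrow> real \<Rightarrow> real"
  where "chi c1 c2 c3 s = c1 * s * ln (s + gamma0 c1 c2) + c2 * s + c3 * s ^ 3 - c1 * beta c1 c2 c3 / 2 * s\<^sup>2"

lemma Psi_eq_chi:
  "Psi a c1 c2 c3 p = a * chi c1 c2 c3 (norm p) + a * c1 * beta c1 c2 c3 / 2 * (norm p)\<^sup>2"
  by (simp add: Psi_def chi_def algebra_simps)

text \<open>Convexity alone would not survive composition with the norm, so monotonicity is proved
  too. The second derivative is nonnegative by \<open>beta_le\<close>. The first derivative is then
  nondecreasing, and it starts at c1 ln(gamma0) + c2 = 0.\<close>

lemma chi_convex_mono: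
  assumes c: "c1 > 0" "c3 > 0"
  shows "convex_on {0..} (chi c1 c2 c3)"
    and "0 \<le> s \<Longrightarrow> s \<le> t \<Longrightarrow> chi c1 c2 c3 s \<le> chi c1 c2 c3 t"
proof -
  define g where "g = gamma0 c1 c2"
  define b where "b = beta c1 c2 c3"
  have g: "g > 0" by (simp add: g_def gamma0_pos)
  have chi: "chi c1 c2 c3 = (\<lambda>s. c1 * s * ln (s + g) + c2 * s + c3 * s ^ 3 - c1 * b / 2 * s\<^sup>2)"
    by (simp add: chi_def fun_eq_iff g_def b_def)
  define d1 where "d1 s = c1 * ln (s + g) + c1 * s / (s + g) + (c2 + 3 * c3 * s\<^sup>2 - c1 * b * s)" for s
  define d2 where "d2 s = c1 / (s + g) + c1 * g / (s + g)\<^sup>2 + (6 * c3 * s - c1 * b)" for s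
  have D1: "(chi c1 c2 c3 has_real_derivative d1 s) (at s)" if "s \<ge> 0" for s
    unfolding chi d1_def using that g
    by (auto intro!: derivative_eq_intros simp: field_simps power2_eq_square)
  have D2: "(d1 has_real_derivative d2 s) (at s)" if "s \<ge> 0" for s
  proof -
    have "s + g > 0" using that g by simp
    moreover have "((\<lambda>s. c1 * s / (s + g)) has_real_derivative c1 * g / (s + g)\<^sup>2) (at s)"
      using \<open>s + g > 0\<close> by (auto intro!: derivative_eq_intros simp: field_simps power2_eq_square)
    moreover have "((\<lambda>s. c1 * ln (s + g)) has_real_derivative c1 / (s + g)) (at s)"
      using \<open>s + g > 0\<close> by (auto intro!: derivative_eq_intros)
    moreover have "((\<lambda>s. c2 + 3 * c3 * s\<^sup>2 - c1 * b * s) has_real_derivative 6 * c3 * s - c1 * b) (at s)"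
      by (auto intro!: derivative_eq_intros)
    ultimately show ?thesis
      unfolding d1_def[abs_def] d2_def by (intro DERIV_add)
  qed
  have d2: "d2 s \<ge> 0" if s: "s \<ge> 0" for s
  proof -
    have "c1 * b \<le> c1 * (1 / (s + g) + 3 * c3 / c1 * s)"
      using beta_le[OF c s, of c2] c by (intro mult_left_mono) (auto simp: b_def g_def)
    also have "\<dots> = c1 / (s + g) + 3 * c3 * s" using c by (simp add: field_simps)
    finally have "c1 * b \<le> c1 / (s + g) + 3 * c3 * s" .
    moreover have "0 \<le> c1 * g / (s + g)\<^sup>2" "0 \<le> 3 * c3 * s" using c g s by auto
    ultimately show ?thesis unfolding d2_def by linarith
  qed
  show "convex_on {0..} (chi c1 c2 c3)"
    by (rule f''_ge0_imp_convex[of _ _ d1 d2]) (use D1 D2 d2 in auto)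
  have "d1 0 = 0" using ln_gamma0[OF c(1), of c2] by (simp add: d1_def g_def)
  then have d1: "d1 s \<ge> 0" if "s \<ge> 0" for s
    using DERIV_nonneg_imp_nondecreasing[of 0 s d1] D2 d2 that by (metis (no_types, lifting))
  show "chi c1 c2 c3 s \<le> chi c1 c2 c3 t" if "0 \<le> s" "s \<le> t"
    using DERIV_nonneg_imp_nondecreasing[OF that(2), of "chi c1 c2 c3"] D1 d1 that by (meson order.trans)
qed

text \<open>A convex nondecreasing function of the norm is convex, which handles \<open>chi\<close>.
  The split-off quadratic a c1 beta |p|^2 / 2 obeys the parallelogram identity exactly, with defect
  |p - q|^2 / 4; this produces the factor 1/8.\<close>

lemma Psi_strongly_convex:
  assumes "a > 0" "c1 > 0" "c3 > 0"
  shows "Psi a c1 c2 c3 ((1/2) *\<^sub>R (p + q)) + a * c1 * beta c1 c2 c3 / 8 * (norm (p - q))\<^sup>2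
    \<le> (Psi a c1 c2 c3 p + Psi a c1 c2 c3 q) / 2"
proof -
  let ?x = "chi c1 c2 c3" and ?m = "(1/2) *\<^sub>R (p + q)"
  have "norm ?m \<le> (norm p + norm q) / 2" using norm_triangle_ineq[of p q] by simp
  then have "?x (norm ?m) \<le> ?x ((norm p + norm q) / 2)"
    by (intro chi_convex_mono(2)[OF assms(2,3)]) auto
  also have "(norm p + norm q) / 2 = (1 - 1/2) *\<^sub>R norm p + (1/2) *\<^sub>R norm q" by simp
  also have "?x \<dots> \<le> (1 - 1/2) * ?x (norm p) + (1/2) * ?x (norm q)"
    by (rule convex_onD[OF chi_convex_mono(1)[OF assms(2,3)]]) auto
  finally have 1: "a * ?x (norm ?m) \<le> a * ((?x (norm p) + ?x (norm q)) / 2)"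
    using assms(1) by (intro mult_left_mono) auto
  have 2: "(norm ?m)\<^sup>2 = ((norm p)\<^sup>2 + (norm q)\<^sup>2) / 2 - (norm (p - q))\<^sup>2 / 4"
    unfolding power2_norm_eq_inner by (simp add: inner_add_left inner_add_right inner_diff_left inner_diff_right inner_commute field_simps)
  show ?thesis unfolding Psi_eq_chi 2 using 1 by (simp add: field_simps)
qed

text \<open>The logarithm is at least its value at p = 0, and there c1 ln(gamma0) cancels c2; only
  the cubic term is left.\<close>

lemma Psi_lower:
  assumes "a > 0" "c1 > 0" "c3 > 0"
  shows "a * c3 * norm p ^ 3 \<le> Psi a c1 c2 c3 p"
proof -
  have "ln (gamma0 c1 c2) \<le> ln (norm p + gamma0 c1 c2)"
    using gamma0_pos[of c1 c2] by (intro ln_mono) (auto intro: add_nonneg_pos)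
  then have "c1 * ln (gamma0 c1 c2) \<le> c1 * ln (norm p + gamma0 c1 c2)"
    using assms(2) by (intro mult_left_mono) auto
  then have "0 \<le> c1 * ln (norm p + gamma0 c1 c2) + c2" using ln_gamma0[OF assms(2), of c2] by simp
  then have "0 \<le> a * norm p * (c1 * ln (norm p + gamma0 c1 c2) + c2)"
    using assms(1) by (intro mult_nonneg_nonneg) auto
  then show ?thesis by (simp add: Psi_def algebra_simps)
qed

lemma Psi_nonneg: "a > 0 \<Longrightarrow> c1 > 0 \<Longrightarrow> c3 > 0 \<Longrightarrow> 0 \<le> Psi a c1 c2 c3 p"
  by (rule order.trans[OF _ Psi_lower]) auto

text \<open>Estimates the logarithm by its argument. Together with \<open>Psi_lower\<close> this
  identifies integrability of \<open>Psi\<close> along a measurable field with membership of the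
  field in L^3 of the cell.\<close>

lemma Psi_upper:
  assumes "a > 0" "c1 > 0" "c3 > 0"
  shows "Psi a c1 c2 c3 p \<le> a * c1 * (norm p)\<^sup>2 + a * (c1 * gamma0 c1 c2 + \<bar>c2\<bar>) * norm p + a * c3 * norm p ^ 3"
proof -
  have pos: "norm p + gamma0 c1 c2 > 0" using gamma0_pos[of c1 c2] by (simp add: add_nonneg_pos)
  have "ln (norm p + gamma0 c1 c2) \<le> norm p + gamma0 c1 c2" using ln_less_self[OF pos] by simp
  then have "a * c1 * norm p * ln (norm p + gamma0 c1 c2) \<le> a * c1 * norm p * (norm p + gamma0 c1 c2)"
    using assms by (intro mult_left_mono) auto
  moreover have "a * c2 * norm p \<le> a * \<bar>c2\<bar> * norm p"
    using assms by (intro mult_left_mono mult_right_mono) auto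
  ultimately show ?thesis by (simp add: Psi_def power2_eq_square algebra_simps)
qed

lemma continuous_on_Psi: "continuous_on UNIV (Psi a c1 c2 c3)"
proof -
  have "norm p + gamma0 c1 c2 \<noteq> 0" for p :: "real^2"
    using gamma0_pos[of c1 c2] add_nonneg_pos[of "norm p" "gamma0 c1 c2"] by simp
  then show ?thesis unfolding Psi_def[abs_def] by (intro continuous_intros) auto
qed

lemma cubic_dominates_square:
  assumes "c > 0" "K \<ge> (0::real)"
  shows "\<exists>C. \<forall>p::real^2. K * (norm (p - B))\<^sup>2 \<le> c * norm p ^ 3 + C"
proof (intro exI allI)
  fix p :: "real^2"
  have "(norm (p - B))\<^sup>2 \<le> (norm p + norm B)\<^sup>2" by (intro power_mono norm_triangle_ineq4) auto
  also have "\<dots> \<le> 2 * (norm p)\<^sup>2 + 2 * (norm B)\<^sup>2" using sum_squares_bound[of "norm p" "norm B"] by (simp add: power2_sum)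
  finally have "K * (norm (p - B))\<^sup>2 \<le> K * (2 * (norm p)\<^sup>2 + 2 * (norm B)\<^sup>2)" using assms by (intro mult_left_mono)
  \<comment> \<open>The threshold 2K/c is the point where 2K s^2 and c s^3 are equal; below it the
    constant absorbs the square, above it the cubic does.\<close>
  moreover have "2 * K * (norm p)\<^sup>2 \<le> c * norm p ^ 3 + 2 * K * (2 * K / c)\<^sup>2"
  proof (cases "norm p \<le> 2 * K / c")
    case True
    then have "2 * K * (norm p)\<^sup>2 \<le> 2 * K * (2 * K / c)\<^sup>2" using assms by (intro mult_left_mono power_mono) auto
    moreover have "0 \<le> c * norm p ^ 3" using assms by simp
    ultimately show ?thesis by linarith
  next
    case False
    then have "2 * K \<le> c * norm p" using assms by (simp add: field_simps)
    then have "2 * K * (norm p)\<^sup>2 \<le> c * norm p * (norm p)\<^sup>2" by (intro mult_right_mono) auto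
    also have "\<dots> = c * norm p ^ 3" by (simp add: power3_eq_cube power2_eq_square)
    finally show ?thesis using assms by (simp add: add_increasing2)
  qed
  ultimately show "K * (norm (p - B))\<^sup>2 \<le> c * norm p ^ 3 + (2 * K * (2 * K / c)\<^sup>2 + 2 * K * (norm B)\<^sup>2)"
    by (simp add: algebra_simps)
qed

subsection \<open>Limits in \<open>L\<^sup>2\<close>\<close>

text \<open>Formulated with convergent upper bounds \<open>c n\<close>, since the applications bound
  the integrals without knowing that they converge; integrability of the limit is part of the
  conclusion.\<close>

lemma Fatou_integral:
  fixes f :: "nat \<Rightarrow> 'a \<Rightarrow> real"
  assumes f: "\<And>n. integrable M (f n)" "\<And>n x. 0 \<le> f n x" and g: "g \<in> borel_measurable M" "\<And>x. 0 \<le> g x"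
    and lim: "AE x in M. (\<lambda>n. f n x) \<longlonglongrightarrow> g x" and le: "\<And>n. (LINT x|M. f n x) \<le> c n" and c: "c \<longlonglongrightarrow> C"
  shows "integrable M g" "(LINT x|M. g x) \<le> C"
proof -
  have c0: "0 \<le> c n" for n
    using Bochner_Integration.integral_nonneg[of M "f n"] f(2) le[of n] by (metis order.trans)
  have C0: "0 \<le> C" using c c0 by (simp add: LIMSEQ_le_const)
  have "(\<integral>\<^sup>+x. ennreal (g x) \<partial>M) = (\<integral>\<^sup>+x. liminf (\<lambda>n. ennreal (f n x)) \<partial>M)"
  proof (rule nn_integral_cong_AE)
    show "AE x in M. ennreal (g x) = liminf (\<lambda>n. ennreal (f n x))"
      using lim
    proof eventually_elim
      case (elim x)
      then have "(\<lambda>n. ennreal (f n x)) \<longlonglongrightarrow> ennreal (g x)" by (rule tendsto_ennrealI)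
      then show ?case using lim_imp_Liminf[of sequentially] by (metis sequentially_bot)
    qed
  qed
  also have "\<dots> \<le> liminf (\<lambda>n. \<integral>\<^sup>+x. ennreal (f n x) \<partial>M)"
    by (rule nn_integral_liminf) (use f(1) in measurable)
  also have "\<dots> \<le> liminf (\<lambda>n. ennreal (c n))"
    by (intro Liminf_mono always_eventually allI)
       (simp add: nn_integral_eq_integral[OF f(1)] f(2) le ennreal_leI)
  also have "\<dots> = ennreal C"
    using lim_imp_Liminf[OF sequentially_bot tendsto_ennrealI[OF c]] .
  finally have le: "(\<integral>\<^sup>+x. ennreal (g x) \<partial>M) \<le> ennreal C" .
  then have "(\<integral>\<^sup>+x. ennreal (norm (g x)) \<partial>M) < \<infinity>"
    using g(2) by (simp add: le_less_trans[OF _ ennreal_less_top])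
  with g(1) show i: "integrable M g" by (simp add: integrable_iff_bounded)
  then have "ennreal (LINT x|M. g x) \<le> ennreal C"
    using le nn_integral_eq_integral[OF i] g(2) by simp
  then show "(LINT x|M. g x) \<le> C" using C0 by simp
qed

lemma norm_square_add_le:
  fixes x y :: "'a::real_normed_vector"
  shows "(norm (x + y))\<^sup>2 \<le> 2 * (norm x)\<^sup>2 + 2 * (norm y)\<^sup>2"
proof -
  have "(norm (x + y))\<^sup>2 \<le> (norm x + norm y)\<^sup>2" by (intro power_mono norm_triangle_ineq) auto
  also have "\<dots> \<le> 2 * (norm x)\<^sup>2 + 2 * (norm y)\<^sup>2" using sum_squares_bound[of "norm x" "norm y"] by (simp add: power2_sum)
  finally show ?thesis .
qed

lemma in_L2_add:
  fixes f g :: "real^2 \<Rightarrow> 'b::{banach, second_countable_topology}"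
  assumes "in_Lp 2 (cell L) f" "in_Lp 2 (cell L) g"
  shows "in_Lp 2 (cell L) (\<lambda>x. f x + g x)"
proof -
  have m: "(\<lambda>x. f x + g x) \<in> borel_measurable (cellM L)" using assms by (auto simp: in_Lp_cell_iff)
  have "integrable (cellM L) (\<lambda>x. 2 * (norm (f x))\<^sup>2 + 2 * (norm (g x))\<^sup>2)"
    using assms by (auto simp: in_Lp_cell_iff)
  then have "integrable (cellM L) (\<lambda>x. (norm (f x + g x))\<^sup>2)"
    by (rule Bochner_Integration.integrable_bound)
       (use m norm_square_add_le in \<open>auto intro!: AE_I2 order.trans[OF norm_square_add_le]\<close>)
  with m show ?thesis by (simp add: in_Lp_cell_iff)
qed

lemma in_L2_scaleR:
  fixes f :: "real^2 \<Rightarrow> 'b::{banach, second_countable_topology}"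
  assumes "in_Lp 2 (cell L) f"
  shows "in_Lp 2 (cell L) (\<lambda>x. c *\<^sub>R f x)"
  using assms by (auto simp: in_Lp_cell_iff power_mult_distrib)

lemma in_L2_diff:
  fixes f g :: "real^2 \<Rightarrow> 'b::{banach, second_countable_topology}"
  assumes "in_Lp 2 (cell L) f" "in_Lp 2 (cell L) g"
  shows "in_Lp 2 (cell L) (\<lambda>x. f x - g x)"
  using in_L2_add[OF assms(1) in_L2_scaleR[OF assms(2), of "-1"]] by simp

text \<open>Takes the place of the Cauchy--Schwarz inequality: pointwise s is at most t + s^2/t.
  With t = (1/2)^n, a squared norm of order (1/4)^n gives an L^1 norm of order (1/2)^n.\<close>

lemma integral_norm_le_L2:
  fixes f :: "real^2 \<Rightarrow> 'b::{banach, second_countable_topology}"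
  assumes L: "L > 0" and f: "in_Lp 2 (cell L) f" and t: "t > 0"
  shows "(LINT x|cellM L. norm (f x)) \<le> t * L\<^sup>2 + (LINT x|cellM L. (norm (f x))\<^sup>2) / t"
proof -
  have f2: "integrable (cellM L) (\<lambda>x. (norm (f x))\<^sup>2)" and f1: "integrable (cellM L) (\<lambda>x. norm (f x))"
    using f in_Lp_integrable[OF f] by (auto simp: in_Lp_cell_iff)
  have "norm (f x) \<le> t + (norm (f x))\<^sup>2 / t" for x
  proof (cases "norm (f x) \<le> t")
    case False
    then have "norm (f x) * t \<le> (norm (f x))\<^sup>2" by (simp add: power2_eq_square mult_left_mono)
    then have "norm (f x) \<le> (norm (f x))\<^sup>2 / t" using t by (simp add: pos_le_divide_eq)
    then show ?thesis using t by simp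
  qed (use t in \<open>simp add: add_increasing2\<close>)
  then have "(LINT x|cellM L. norm (f x)) \<le> (LINT x|cellM L. t + (norm (f x))\<^sup>2 / t)"
    using f1 f2 integrable_cellM_const[of L t] by (intro integral_mono) auto
  also have "\<dots> = t * L\<^sup>2 + (LINT x|cellM L. (norm (f x))\<^sup>2) / t"
    using f2 integrable_cellM_const[of L t] L by (simp add: measure_cellM)
  finally show ?thesis .
qed

text \<open>The rate makes the L^1 norms of consecutive differences summable, so the telescoping
  series converges absolutely almost everywhere; Fatou then gives the L^2 estimate. Defining g by
  \<open>lim\<close> at every point lets it inherit measurability and periodicity on the whole
  plane.\<close>

lemma L2_limit:
  fixes f :: "nat \<Rightarrow> real^2 \<Rightarrow> 'b::{banach, second_countable_topology}"
  assumes L: "L > 0" and f: "\<And>n. in_Lp 2 (cell L) (f n)"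
    and c: "\<And>m n. n \<le> m \<Longrightarrow> (LINT x|cellM L. (norm (f m x - f n x))\<^sup>2) \<le> (1/4) ^ n"
  defines "g \<equiv> \<lambda>x. lim (\<lambda>n. f n x)"
  shows "AE x in cellM L. (\<lambda>n. f n x) \<longlonglongrightarrow> g x"
    and "in_Lp 2 (cell L) g"
    and "(LINT x|cellM L. (norm (f n x - g x))\<^sup>2) \<le> (1/4) ^ n"
proof -
  have d: "in_Lp 2 (cell L) (\<lambda>x. f m x - f n x)" for m n by (rule in_L2_diff[OF f f])
  have fm: "f n \<in> borel_measurable (cellM L)" for n using f by (auto simp: in_Lp_cell_iff)
  have b1: "(LINT x|cellM L. norm (f (Suc n) x - f n x)) \<le> (L\<^sup>2 + 1) * (1/2) ^ n" for n
  proof -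
    have "(LINT x|cellM L. norm (f (Suc n) x - f n x)) \<le> (1/2) ^ n * L\<^sup>2 + (LINT x|cellM L. (norm (f (Suc n) x - f n x))\<^sup>2) / (1/2) ^ n"
      by (rule integral_norm_le_L2[OF L d]) simp
    also have "\<dots> \<le> (1/2) ^ n * L\<^sup>2 + (1/4) ^ n / (1/2) ^ n"
      using c[of n "Suc n"] by (intro add_left_mono divide_right_mono) auto
    also have "(1/4) ^ n / (1/2) ^ n = (1/2 :: real) ^ n" by (simp flip: power_divide)
    finally show ?thesis by (simp add: algebra_simps)
  qed
  have "(\<integral>\<^sup>+x. (\<Sum>n. ennreal (norm (f (Suc n) x - f n x))) \<partial>cellM L)
      = (\<Sum>n. \<integral>\<^sup>+x. ennreal (norm (f (Suc n) x - f n x)) \<partial>cellM L)"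
    by (rule nn_integral_suminf) (use fm in simp)
  also have "\<dots> \<le> (\<Sum>n. ennreal ((L\<^sup>2 + 1) * (1/2) ^ n))"
  proof (rule suminf_le)
    fix n
    have "integrable (cellM L) (\<lambda>x. norm (f (Suc n) x - f n x))"
      using in_Lp_integrable[OF d] by (intro integrable_norm) auto
    then show "(\<integral>\<^sup>+x. ennreal (norm (f (Suc n) x - f n x)) \<partial>cellM L) \<le> ennreal ((L\<^sup>2 + 1) * (1/2) ^ n)"
      using b1[of n] by (subst nn_integral_eq_integral) (auto intro: ennreal_leI)
  qed auto
  also have "\<dots> < \<infinity>"
  proof -
    have s: "summable (\<lambda>n. (L\<^sup>2 + 1) * (1/2 :: real) ^ n)" by (intro summable_mult summable_geometric) simp
    show ?thesis by (subst suminf_ennreal2[OF _ s]) auto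
  qed
  finally have fin: "(\<integral>\<^sup>+x. (\<Sum>n. ennreal (norm (f (Suc n) x - f n x))) \<partial>cellM L) \<noteq> \<infinity>" by simp
  have "AE x in cellM L. (\<Sum>n. ennreal (norm (f (Suc n) x - f n x))) \<noteq> \<infinity>"
    by (rule nn_integral_noteq_infinite[OF _ fin]) (use fm in measurable)
  then show lim: "AE x in cellM L. (\<lambda>n. f n x) \<longlonglongrightarrow> g x"
  proof eventually_elim
    case (elim x)
    then have "summable (\<lambda>n. norm (f (Suc n) x - f n x))"
      by (intro summable_suminf_not_top) auto
    then have "summable (\<lambda>n. f (Suc n) x - f n x)" by (rule summable_norm_cancel)
    then have "convergent (\<lambda>n. \<Sum>i<n. f (Suc i) x - f i x)" by (simp add: summable_iff_convergent)
    moreover have "(\<Sum>i<n. f (Suc i) x - f i x) = f n x - f 0 x" for n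
      by (rule sum_lessThan_telescope)
    ultimately have "convergent (\<lambda>n. f n x - f 0 x)" by simp
    then have "convergent (\<lambda>n. f n x)" by (simp add: convergent_diff_const_right_iff)
    then show ?case unfolding g_def by (simp add: convergent_LIMSEQ_iff)
  qed
  have gm: "g \<in> borel_measurable (cellM L)" unfolding g_def using fm by (rule borel_measurable_lim_metric)
  have F: "integrable (cellM L) (\<lambda>x. (norm (f n x - g x))\<^sup>2)" "(LINT x|cellM L. (norm (f n x - g x))\<^sup>2) \<le> (1/4) ^ n" for n
  proof -
    have 1: "integrable (cellM L) (\<lambda>x. (norm (f n x - f (m + n) x))\<^sup>2)" for m
      using d[of n "m + n"] by (simp add: in_Lp_cell_iff)
    have 2: "AE x in cellM L. (\<lambda>m. (norm (f n x - f (m + n) x))\<^sup>2) \<longlonglongrightarrow> (norm (f n x - g x))\<^sup>2"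
      using lim by eventually_elim (intro tendsto_intros LIMSEQ_ignore_initial_segment)
    have 3: "(LINT x|cellM L. (norm (f n x - f (m + n) x))\<^sup>2) \<le> (1/4) ^ n" for m
      using c[of n "m + n"] by (simp add: norm_minus_commute)
    have 4: "(\<lambda>x. (norm (f n x - g x))\<^sup>2) \<in> borel_measurable (cellM L)" using gm fm by simp
    from Fatou_integral[OF 1 _ 4 _ 2 3 tendsto_const]
    show "integrable (cellM L) (\<lambda>x. (norm (f n x - g x))\<^sup>2)" "(LINT x|cellM L. (norm (f n x - g x))\<^sup>2) \<le> (1/4) ^ n"
      by auto
  qed
  show "(LINT x|cellM L. (norm (f n x - g x))\<^sup>2) \<le> (1/4) ^ n" by (rule F(2))
  have "in_Lp 2 (cell L) (\<lambda>x. f 0 x - g x)"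
    using F(1)[of 0] gm fm[of 0] by (simp add: in_Lp_cell_iff)
  from in_L2_diff[OF f[of 0] this] show "in_Lp 2 (cell L) g" by simp
qed

lemma integral_cbox_periodic_le:
  fixes L :: real
  assumes L: "L > 0"
  shows "\<exists>N::nat. \<forall>f::real^2 \<Rightarrow> real. f \<in> borel_measurable lebesgue \<longrightarrow> periodic_AE L f \<longrightarrow> (\<forall>x. 0 \<le> f x) \<longrightarrow>
    integrable (cellM L) f \<longrightarrow> (LINT x:cbox a b|lebesgue. f x) \<le> real N * (LINT x|cellM L. f x)"
proof -
  obtain N :: nat where N: "\<And>f::real^2 \<Rightarrow> ennreal. f \<in> borel_measurable lebesgue \<Longrightarrow> periodic_AE L f \<Longrightarrow>
    (\<integral>\<^sup>+x\<in>cbox a b. f x \<partial>lebesgue) \<le> of_nat N * (\<integral>\<^sup>+x\<in>cell L. f x \<partial>lebesgue)"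
    using nn_integral_periodic_le[OF L, of a b] by blast
  have "(LINT x:cbox a b|lebesgue. f x) \<le> real N * (LINT x|cellM L. f x)"
    if f: "f \<in> borel_measurable lebesgue" "periodic_AE L f" "\<forall>x. 0 \<le> f x" "integrable (cellM L) f" for f
  proof -
    have s: "ennreal (LINT x:A|lebesgue. f x) = (\<integral>\<^sup>+x\<in>A. ennreal (f x) \<partial>lebesgue)" if "set_integrable lebesgue A f" for A
    proof -
      have "(\<integral>\<^sup>+x\<in>A. ennreal (f x) \<partial>lebesgue) = (\<integral>\<^sup>+x. ennreal (indicator A x *\<^sub>R f x) \<partial>lebesgue)"
        by (intro nn_integral_cong) (auto simp: indicator_def)
      also have "\<dots> = ennreal (LINT x:A|lebesgue. f x)"
        unfolding set_lebesgue_integral_def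
        by (rule nn_integral_eq_integral) (use that f(3) in \<open>auto simp: set_integrable_def\<close>)
      finally show ?thesis by simp
    qed
    have ic: "set_integrable lebesgue (cell L) f" using f(4) by (simp add: set_integrable_cell)
    have "ennreal (LINT x:cbox a b|lebesgue. f x) \<le> of_nat N * ennreal (LINT x:cell L|lebesgue. f x)"
      unfolding s[OF set_integrable_periodic[OF L f(1,2) ic]] s[OF ic]
      using f(1) periodic_AE_compose[OF f(2), of ennreal] by (intro N) auto
    also have "\<dots> = ennreal (real N * (LINT x|cellM L. f x))"
      by (simp add: set_lebesgue_integral_cell ennreal_mult' flip: ennreal_of_nat_eq_real_of_nat)
    finally show ?thesis
      using f(3) by (subst (asm) ennreal_le_iff) (auto intro!: mult_nonneg_nonneg Bochner_Integration.integral_nonneg)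
  qed
  then show ?thesis by blast
qed

lemma periodic_integrable_loc:
  fixes f :: "real^2 \<Rightarrow> 'b::{banach, second_countable_topology}"
  assumes "L > 0" "f \<in> borel_measurable lebesgue" "periodic_AE L f" "integrable (cellM L) f"
  shows "in_Lp_loc 1 f"
  unfolding in_Lp_loc_1_iff using set_integrable_periodic[OF assms(1-3)] assms(4) by (simp add: set_integrable_cell)

text \<open>A test function is bounded and supported in a box, whose integral is controlled by a
  fixed multiple of the integral over one cell. Hence L^1 convergence on the cell suffices.\<close>

lemma integral_test_function_limit:
  fixes f :: "nat \<Rightarrow> real^2 \<Rightarrow> real"
  assumes L: "L > 0" and f: "\<And>n. f n \<in> borel_measurable lebesgue" "\<And>n. periodic_AE L (f n)" "\<And>n. integrable (cellM L) (f n)"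
    and g: "g \<in> borel_measurable lebesgue" "periodic_AE L g" "integrable (cellM L) g"
    and lim: "(\<lambda>n. LINT x|cellM L. \<bar>f n x - g x\<bar>) \<longlonglongrightarrow> 0" and \<phi>: "test_function \<phi>"
  shows "(\<lambda>n. LINT x|lebesgue. f n x * \<phi> x) \<longlonglongrightarrow> (LINT x|lebesgue. g x * \<phi> x)"
proof -
  obtain a b where ab: "\<forall>x. x \<notin> cbox a b \<longrightarrow> \<phi> x = 0" using test_function_support[OF \<phi>] by blast
  obtain M where M: "\<forall>x. \<bar>\<phi> x\<bar> \<le> M" using test_function_bounded[OF \<phi>] by blast
  obtain N :: nat where N: "\<And>f::real^2 \<Rightarrow> real. f \<in> borel_measurable lebesgue \<Longrightarrow> periodic_AE L f \<Longrightarrow> (\<forall>x. 0 \<le> f x) \<Longrightarrow>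
    integrable (cellM L) f \<Longrightarrow> (LINT x:cbox a b|lebesgue. f x) \<le> real N * (LINT x|cellM L. f x)"
    using integral_cbox_periodic_le[OF L, of a b] by blast
  have M0: "M \<ge> 0" using M by (meson abs_ge_zero order.trans)
  have le: "\<bar>(LINT x|lebesgue. f n x * \<phi> x) - (LINT x|lebesgue. g x * \<phi> x)\<bar> \<le> M * (real N * (LINT x|cellM L. \<bar>f n x - g x\<bar>))" for n
  proof -
    have dm: "(\<lambda>x. \<bar>f n x - g x\<bar>) \<in> borel_measurable lebesgue" using f g by simp
    have dp: "periodic_AE L (\<lambda>x. \<bar>f n x - g x\<bar>)" by (rule periodic_AE_compose2[OF f(2) g(2)])
    have di: "integrable (cellM L) (\<lambda>x. \<bar>f n x - g x\<bar>)" using f(3) g(3) by simp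
    note i1 = integrable_mult_test_function[OF periodic_integrable_loc[OF L f] \<phi>]
    note i2 = integrable_mult_test_function[OF periodic_integrable_loc[OF L g] \<phi>]
    have i3: "integrable lebesgue (\<lambda>x. indicator (cbox a b) x *\<^sub>R \<bar>f n x - g x\<bar>)"
      using periodic_integrable_loc[OF L dm dp di] unfolding in_Lp_loc_1_iff set_integrable_def by blast
    have "\<bar>(LINT x|lebesgue. f n x * \<phi> x) - (LINT x|lebesgue. g x * \<phi> x)\<bar> = \<bar>LINT x|lebesgue. f n x * \<phi> x - g x * \<phi> x\<bar>"
      using i1 i2 by simp
    also have "\<dots> \<le> (LINT x|lebesgue. \<bar>f n x * \<phi> x - g x * \<phi> x\<bar>)"
      by (rule integral_abs_bound)
    also have "\<dots> \<le> (LINT x|lebesgue. M * (indicator (cbox a b) x *\<^sub>R \<bar>f n x - g x\<bar>))"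
    proof (rule integral_mono)
      show "integrable lebesgue (\<lambda>x. \<bar>f n x * \<phi> x - g x * \<phi> x\<bar>)" using i1 i2 by simp
      show "integrable lebesgue (\<lambda>x. M * (indicator (cbox a b) x *\<^sub>R \<bar>f n x - g x\<bar>))" using i3 by (rule integrable_mult_right)
      fix x
      have "\<bar>f n x * \<phi> x - g x * \<phi> x\<bar> = \<bar>\<phi> x\<bar> * \<bar>f n x - g x\<bar>" by (simp add: algebra_simps flip: abs_mult)
      then show "\<bar>f n x * \<phi> x - g x * \<phi> x\<bar> \<le> M * (indicator (cbox a b) x *\<^sub>R \<bar>f n x - g x\<bar>)"
        using M ab by (cases "x \<in> cbox a b") (auto intro: mult_right_mono)
    qed
    also have "\<dots> = M * (LINT x:cbox a b|lebesgue. \<bar>f n x - g x\<bar>)"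
      by (simp add: set_lebesgue_integral_def)
    also have "\<dots> \<le> M * (real N * (LINT x|cellM L. \<bar>f n x - g x\<bar>))"
      using M0 by (intro mult_left_mono N dm dp di) auto
    finally show ?thesis .
  qed
  have "(\<lambda>n. M * (real N * (LINT x|cellM L. \<bar>f n x - g x\<bar>))) \<longlonglongrightarrow> M * (real N * 0)"
    by (intro tendsto_intros lim)
  then have "(\<lambda>n. M * (real N * (LINT x|cellM L. \<bar>f n x - g x\<bar>))) \<longlonglongrightarrow> 0" by simp
  then have "(\<lambda>n. (LINT x|lebesgue. f n x * \<phi> x) - (LINT x|lebesgue. g x * \<phi> x)) \<longlonglongrightarrow> 0"
    by (rule Lim_null_comparison[rotated]) (simp add: le)
  then show ?thesis by (simp only: LIM_zero_iff)
qed

lemma weak_gradient_limit: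
  assumes L: "L > 0" and v: "\<And>n. periodic_AE L (v n)" "\<And>n. has_weak_gradient (v n) (G n)"
    and w: "w \<in> borel_measurable lebesgue" "periodic_AE L w" "integrable (cellM L) w"
    and H: "H \<in> borel_measurable lebesgue" "periodic_AE L H" "integrable (cellM L) H"
    and lim: "(\<lambda>n. LINT x|cellM L. \<bar>v n x - w x\<bar>) \<longlonglongrightarrow> 0" "(\<lambda>n. LINT x|cellM L. norm (G n x - H x)) \<longlonglongrightarrow> 0"
  shows "has_weak_gradient w H"
  unfolding has_weak_gradient_def
proof (intro conjI allI impI)
  show "in_Lp_loc 1 w" "in_Lp_loc 1 H" by (rule periodic_integrable_loc[OF L w], rule periodic_integrable_loc[OF L H])
  fix \<phi> :: "real^2 \<Rightarrow> real" and i assume \<phi>: "test_function \<phi>"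
  note D = has_weak_gradientD[OF v(2)]
  have Gp: "periodic_AE L (G n)" for n by (rule weak_gradient_periodic[OF v])
  have ni: "(\<lambda>x::real^2. x $ i) \<in> borel_measurable borel"
    by (intro borel_measurable_continuous_onI linear_continuous_on bounded_linear_vec_nth)
  have Gc: "integrable (cellM L) (G n)" for n
    using D(2)[of n] unfolding in_Lp_loc_1_iff cell_def set_integrable_cell[unfolded cell_def, symmetric] by blast
  have comp: "integrable (cellM L) (\<lambda>x. F x $ i)" if "integrable (cellM L) F" for F :: "real^2 \<Rightarrow> real^2"
    using integrable_bounded_linear[OF bounded_linear_vec_nth that] .
  have 1: "(\<lambda>n. LINT x|lebesgue. v n x * partial_deriv i \<phi> x) \<longlonglongrightarrow> (LINT x|lebesgue. w x * partial_deriv i \<phi> x)"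
    by (rule integral_test_function_limit[OF L in_Lp_loc_measurable[OF D(1)] v(1) has_weak_gradient_integrable_cell(1)[OF v(2)] w lim(1)
          test_function_partial_deriv[OF \<phi>]])
  have 2: "(\<lambda>n. LINT x|lebesgue. G n x $ i * \<phi> x) \<longlonglongrightarrow> (LINT x|lebesgue. H x $ i * \<phi> x)"
  proof (rule integral_test_function_limit[OF L _ _ _ _ _ _ _ \<phi>])
    show "(\<lambda>x. G n x $ i) \<in> borel_measurable lebesgue" for n
      using in_Lp_loc_measurable[OF D(2)] ni by (rule measurable_compose)
    show "(\<lambda>x. H x $ i) \<in> borel_measurable lebesgue" using H(1) ni by (rule measurable_compose)
    show "periodic_AE L (\<lambda>x. G n x $ i)" for n using Gp by (rule periodic_AE_compose)
    show "periodic_AE L (\<lambda>x. H x $ i)" using H(2) by (rule periodic_AE_compose)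
    show "integrable (cellM L) (\<lambda>x. G n x $ i)" for n by (rule comp[OF Gc])
    show "integrable (cellM L) (\<lambda>x. H x $ i)" by (rule comp[OF H(3)])
    show "(\<lambda>n. LINT x|cellM L. \<bar>G n x $ i - H x $ i\<bar>) \<longlonglongrightarrow> 0"
    proof (rule tendsto_sandwich[OF _ _ tendsto_const lim(2)])
      show "\<forall>\<^sub>F n in sequentially. 0 \<le> (LINT x|cellM L. \<bar>G n x $ i - H x $ i\<bar>)" by simp
      have "(LINT x|cellM L. \<bar>G n x $ i - H x $ i\<bar>) \<le> (LINT x|cellM L. norm (G n x - H x))" for n
        using component_le_norm_cart[of "G n _ - H _" i] comp[OF Gc[of n]] comp[OF H(3)] Gc[of n] H(3)
        by (intro integral_mono) auto
      then show "\<forall>\<^sub>F n in sequentially. (LINT x|cellM L. \<bar>G n x $ i - H x $ i\<bar>) \<le> (LINT x|cellM L. norm (G n x - H x))" by simp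
    qed
  qed
  from tendsto_minus[OF 2] have "(\<lambda>n. LINT x|lebesgue. v n x * partial_deriv i \<phi> x) \<longlonglongrightarrow> - (LINT x|lebesgue. H x $ i * \<phi> x)"
    using D(3)[OF \<phi>] by simp
  then show "(LINT x|lebesgue. w x * partial_deriv i \<phi> x) = - (LINT x|lebesgue. H x $ i * \<phi> x)"
    using 1 LIMSEQ_unique by blast
qed

subsection \<open>The \<open>H\<^sup>1\<^sup>/\<^sup>2\<close> seminorm\<close>

definition half_energy :: "real \<Rightarrow> (real^2 \<Rightarrow> real) \<Rightarrow> real"
  where "half_energy L f = (\<Sum>\<^sub>\<infinity>k\<in>int_lattice. norm k * (cmod (fourier_coeff L f k))\<^sup>2)"

lemma half_energy_nonneg: "0 \<le> half_energy L f"
  unfolding half_energy_def by (rule infsum_nonneg) simp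

lemma H_half_seminorm_square: "(H_half_seminorm L f)\<^sup>2 = half_energy L f"
  using half_energy_nonneg by (simp add: H_half_seminorm_def half_energy_def)

definition dirichlet :: "real \<Rightarrow> (real^2 \<Rightarrow> real^2) \<Rightarrow> real"
  where "dirichlet L G = (LINT x|cellM L. (norm (G x))\<^sup>2)"

lemma dirichlet_nonneg: "0 \<le> dirichlet L G"
  unfolding dirichlet_def by (rule Bochner_Integration.integral_nonneg) simp

lemma dirichlet_scaleR: "dirichlet L (\<lambda>x. c *\<^sub>R G x) = c\<^sup>2 * dirichlet L G"
  by (simp add: dirichlet_def power_mult_distrib)

text \<open>Carrying an explicit representative \<open>G\<close> of the gradient avoids the choice in
  \<open>weak_gradient\<close>.\<close>

definition V_pair :: "real \<Rightarrow> (real^2 \<Rightarrow> real) \<Rightarrow> (real^2 \<Rightarrow> real^2) \<Rightarrow> bool"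
  where "V_pair L v G \<longleftrightarrow> periodic_AE L v \<and> has_weak_gradient v G \<and>
    in_Lp 2 (cell L) v \<and> in_Lp 2 (cell L) G \<and> (LINT x|cellM L. v x) = 0"

lemma V_pairD:
  assumes "V_pair L v G"
  shows "periodic_AE L v" "has_weak_gradient v G" "in_Lp 2 (cell L) v" "in_Lp 2 (cell L) G"
    "(LINT x|cellM L. v x) = 0" "integrable (cellM L) v" "integrable (cellM L) (\<lambda>x. (norm (G x))\<^sup>2)"
    "v \<in> borel_measurable lebesgue" "G \<in> borel_measurable lebesgue" "G \<in> borel_measurable (cellM L)"
    "integrable (cellM L) G"
proof -
  show 1: "periodic_AE L v" "has_weak_gradient v G" "in_Lp 2 (cell L) v" "in_Lp 2 (cell L) G"
    "(LINT x|cellM L. v x) = 0"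
    using assms by (auto simp: V_pair_def)
  show "integrable (cellM L) v" "integrable (cellM L) G"
    by (rule in_Lp_integrable[OF 1(3)], simp, rule in_Lp_integrable[OF 1(4)], simp)
  show "integrable (cellM L) (\<lambda>x. (norm (G x))\<^sup>2)" "G \<in> borel_measurable (cellM L)"
    using 1(4) by (auto simp: in_Lp_cell_iff)
  show "v \<in> borel_measurable lebesgue" "G \<in> borel_measurable lebesgue"
    using has_weak_gradientD[OF 1(2)] in_Lp_loc_measurable by blast+
qed

lemma V_pair_lincomb:
  assumes "V_pair L v G" "V_pair L w H"
  shows "V_pair L (\<lambda>x. c * v x + d * w x) (\<lambda>x. c *\<^sub>R G x + d *\<^sub>R H x)"
proof -
  note v = V_pairD[OF assms(1)] and w = V_pairD[OF assms(2)]
  have "in_Lp 2 (cell L) (\<lambda>x. c * v x + d * w x)"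
    using in_L2_add[OF in_L2_scaleR[OF v(3), of c] in_L2_scaleR[OF w(3), of d]] by simp
  moreover have "(LINT x|cellM L. c * v x + d * w x) = 0" using v(5,6) w(5,6) by simp
  moreover have "in_Lp 2 (cell L) (\<lambda>x. c *\<^sub>R G x + d *\<^sub>R H x)"
    by (intro in_L2_add in_L2_scaleR v(4) w(4))
  moreover have "has_weak_gradient (\<lambda>x. c * v x + d * w x) (\<lambda>x. c *\<^sub>R G x + d *\<^sub>R H x)"
    by (intro has_weak_gradient_add has_weak_gradient_cmult v(2) w(2))
  moreover have "periodic_AE L (\<lambda>x. c * v x + d * w x)"
    by (rule periodic_AE_compose2[OF v(1) w(1)])
  ultimately show ?thesis unfolding V_pair_def by blast
qed

lemma V_pair_0: "V_pair L (\<lambda>x. 0) (\<lambda>x. 0)"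
  unfolding V_pair_def
  using has_weak_gradient_const[of 0] by (auto simp: periodic_AE_def in_Lp_cell_iff)

lemma fourier_coeff_lincomb:
  assumes "integrable (cellM L) v" "integrable (cellM L) w"
  shows "fourier_coeff L (\<lambda>x. c * v x + d * w x) k = of_real c * fourier_coeff L v k + of_real d * fourier_coeff L w k"
proof -
  note i = integrable_mult_plane_wave[OF assms(1), of "- k"] integrable_mult_plane_wave[OF assms(2), of "- k"]
  have "(LINT x|cellM L. complex_of_real (c * v x + d * w x) * plane_wave L (- k) x)
     = (LINT x|cellM L. of_real c * (complex_of_real (v x) * plane_wave L (- k) x) + of_real d * (complex_of_real (w x) * plane_wave L (- k) x))"
    by (simp add: algebra_simps)
  also have "\<dots> = of_real c * (LINT x|cellM L. complex_of_real (v x) * plane_wave L (- k) x)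
      + of_real d * (LINT x|cellM L. complex_of_real (w x) * plane_wave L (- k) x)"
    using i by simp
  finally show ?thesis by (simp add: fourier_coeff_eq add_divide_distrib)
qed

lemma int_lattice_norm_le_square: "k \<in> int_lattice \<Longrightarrow> norm k \<le> (norm k)\<^sup>2"
  using int_lattice_norm_ge_1[of k] by (cases "k = 0") (auto simp: power2_eq_square mult_le_cancel_left1)

context
  fixes L :: real assumes L: "L > 0"
begin

lemma half_energy_summable:
  assumes "V_pair L v G"
  shows "(\<lambda>k. norm k * (cmod (fourier_coeff L v k))\<^sup>2) summable_on int_lattice"
proof -
  have "(\<lambda>k. (norm k)\<^sup>2 * (cmod (fourier_coeff L v k))\<^sup>2) summable_on int_lattice"
    using parseval_weak_gradient[OF L V_pairD(1,2,4)[OF assms]] by (auto simp: summable_on_def)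
  then show ?thesis
    by (rule summable_on_comparison_test) (auto intro!: mult_right_mono int_lattice_norm_le_square)
qed

lemma half_energy_has_sum:
  assumes "V_pair L v G"
  shows "((\<lambda>k. norm k * (cmod (fourier_coeff L v k))\<^sup>2) has_sum half_energy L v) int_lattice"
  unfolding half_energy_def by (rule has_sum_infsum[OF half_energy_summable[OF assms]])

lemma dirichlet_has_sum:
  assumes "V_pair L v G"
  shows "((\<lambda>k. (norm k)\<^sup>2 * (cmod (fourier_coeff L v k))\<^sup>2) has_sum dirichlet L G / (4 * pi\<^sup>2)) int_lattice"
  unfolding dirichlet_def by (rule parseval_weak_gradient[OF L V_pairD(1,2,4)[OF assms]])

lemma half_energy_le:
  assumes "V_pair L v G"
  shows "half_energy L v \<le> dirichlet L G / (4 * pi\<^sup>2)"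
  by (rule has_sum_mono[OF half_energy_has_sum[OF assms] dirichlet_has_sum[OF assms]])
     (auto intro!: mult_right_mono int_lattice_norm_le_square)

text \<open>Fourier coefficients are linear in the function, so the identity for complex numbers
  holds term by term. The coefficients 1/2 and -1/2 match \<open>V_pair_lincomb\<close>.\<close>

lemma half_energy_parallelogram:
  assumes v: "V_pair L v G" and w: "V_pair L w H"
  shows "half_energy L (\<lambda>x. 1/2 * v x + 1/2 * w x) + half_energy L (\<lambda>x. 1/2 * v x + (-1/2) * w x)
    = (half_energy L v + half_energy L w) / 2"
proof (rule has_sum_unique)
  let ?f = "\<lambda>v k. norm k * (cmod (fourier_coeff L v k))\<^sup>2"
  show "((\<lambda>k. ?f (\<lambda>x. 1/2 * v x + 1/2 * w x) k + ?f (\<lambda>x. 1/2 * v x + (-1/2) * w x) k) has_sum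
    half_energy L (\<lambda>x. 1/2 * v x + 1/2 * w x) + half_energy L (\<lambda>x. 1/2 * v x + (-1/2) * w x)) int_lattice"
    by (intro has_sum_add half_energy_has_sum[OF V_pair_lincomb[OF v w]])
  have "((\<lambda>k. (?f v k + ?f w k) * (1/2)) has_sum (half_energy L v + half_energy L w) * (1/2)) int_lattice"
    by (intro has_sum_cmult_left has_sum_add half_energy_has_sum[OF v] half_energy_has_sum[OF w])
  moreover have eq: "(?f v k + ?f w k) * (1/2) = ?f (\<lambda>x. 1/2 * v x + 1/2 * w x) k + ?f (\<lambda>x. 1/2 * v x + (-1/2) * w x) k" for k
    unfolding fourier_coeff_lincomb[OF V_pairD(6)[OF v] V_pairD(6)[OF w]] cmod_power2
    by (simp add: power2_eq_square field_simps)
  ultimately show "((\<lambda>k. ?f (\<lambda>x. 1/2 * v x + 1/2 * w x) k + ?f (\<lambda>x. 1/2 * v x + (-1/2) * w x) k) has_sum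
    (half_energy L v + half_energy L w) / 2) int_lattice" unfolding eq by (simp only: times_divide_eq_right mult_1_right)
qed

text \<open>Weighted triangle inequality, from (e s - t)^2 / e >= 0. The weight e stays free: n
  tends to infinity while it is fixed, and only then does it tend to 0.\<close>

lemma half_energy_Young:
  assumes v: "V_pair L v G" and w: "V_pair L w H" and "e > 0"
  shows "half_energy L v \<le> (1 + e) * half_energy L w + (1 + 1/e) * half_energy L (\<lambda>x. 1 * v x + (-1) * w x)"
proof (rule has_sum_mono)
  let ?f = "\<lambda>v k. norm k * (cmod (fourier_coeff L v k))\<^sup>2"
  show "(?f v has_sum half_energy L v) int_lattice" by (rule half_energy_has_sum[OF v])
  show "((\<lambda>k. (1 + e) * ?f w k + (1 + 1/e) * ?f (\<lambda>x. 1 * v x + (-1) * w x) k) has_sum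
     (1 + e) * half_energy L w + (1 + 1/e) * half_energy L (\<lambda>x. 1 * v x + (-1) * w x)) int_lattice"
    by (intro has_sum_add has_sum_cmult_right half_energy_has_sum[OF w] half_energy_has_sum[OF V_pair_lincomb[OF v w]])
  fix k
  have Y: "(s + t)\<^sup>2 \<le> (1 + e) * s\<^sup>2 + (1 + 1/e) * t\<^sup>2" for s t :: real
  proof -
    have "0 \<le> (e * s - t)\<^sup>2 / e" using \<open>e > 0\<close> by simp
    also have "\<dots> = e * s\<^sup>2 - 2 * s * t + t\<^sup>2 / e" using \<open>e > 0\<close> by (simp add: power2_eq_square field_simps)
    finally show ?thesis by (simp add: power2_sum algebra_simps)
  qed
  let ?a = "fourier_coeff L v k" and ?b = "fourier_coeff L w k" and ?c = "fourier_coeff L (\<lambda>x. 1 * v x + (-1) * w x) k"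
  have "?a = ?b + ?c" by (subst fourier_coeff_lincomb[OF V_pairD(6)[OF v] V_pairD(6)[OF w]]) simp
  then have "(cmod ?a)\<^sup>2 \<le> (cmod ?b + cmod ?c)\<^sup>2" by (intro power_mono) (auto intro: norm_triangle_ineq)
  also have "\<dots> \<le> (1 + e) * (cmod ?b)\<^sup>2 + (1 + 1/e) * (cmod ?c)\<^sup>2" by (rule Y)
  finally have "norm k * (cmod ?a)\<^sup>2 \<le> norm k * ((1 + e) * (cmod ?b)\<^sup>2 + (1 + 1/e) * (cmod ?c)\<^sup>2)"
    by (intro mult_left_mono) auto
  then show "?f v k \<le> (1 + e) * ?f w k + (1 + 1/e) * ?f (\<lambda>x. 1 * v x + (-1) * w x) k"
    by (simp only: distrib_left mult.left_commute)
qed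

text \<open>For |k| > R one has |k| <= |k|^2 / R, so the high frequencies cost at most a fraction
  1/R of the Dirichlet energy. This is the compactness of the embedding of H^1 into H^(1/2), in
  quantitative form.\<close>

lemma half_energy_tail:
  assumes v: "V_pair L v G" and R: "R > 0"
  shows "half_energy L v \<le> (\<Sum>k\<in>{k\<in>int_lattice. norm k \<le> R}. norm k * (cmod (fourier_coeff L v k))\<^sup>2)
    + dirichlet L G / (4 * pi\<^sup>2) / R"
proof (rule has_sum_mono[OF half_energy_has_sum[OF v]])
  let ?F = "{k\<in>int_lattice. norm k \<le> R}" and ?f = "\<lambda>k. norm k * (cmod (fourier_coeff L v k))\<^sup>2"
  have "(?f has_sum sum ?f ?F) ?F" by (rule has_sum_finite[OF finite_int_lattice_norm_le])
  then have "((\<lambda>k. if k \<in> ?F then ?f k else 0) has_sum sum ?f ?F) int_lattice"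
    by (rule has_sum_cong_neutral[THEN iffD1, rotated -1]) auto
  then show "((\<lambda>k. (if k \<in> ?F then ?f k else 0) + (norm k)\<^sup>2 * (cmod (fourier_coeff L v k))\<^sup>2 / R) has_sum
     sum ?f ?F + dirichlet L G / (4 * pi\<^sup>2) / R) int_lattice"
    by (intro has_sum_add has_sum_divide_const dirichlet_has_sum[OF v])
  fix k assume k: "k \<in> int_lattice"
  show "?f k \<le> (if k \<in> ?F then ?f k else 0) + (norm k)\<^sup>2 * (cmod (fourier_coeff L v k))\<^sup>2 / R"
  proof (cases "norm k \<le> R")
    case True
    then show ?thesis using k R by simp
  next
    case False
    then have "R * norm k \<le> (norm k)\<^sup>2" by (simp add: power2_eq_square mult_right_mono)
    then have "norm k \<le> (norm k)\<^sup>2 / R" using R by (simp add: pos_le_divide_eq mult.commute)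
    then have "?f k \<le> (norm k)\<^sup>2 / R * (cmod (fourier_coeff L v k))\<^sup>2" by (intro mult_right_mono) auto
    then show ?thesis using False by simp
  qed
qed

text \<open>One term of the Parseval sum of the gradient; the bound feeds the diagonal argument for
  convergence of all coefficients.\<close>

lemma fourier_coeff_bound:
  assumes v: "V_pair L v G" and k: "k \<in> int_lattice"
  shows "(cmod (fourier_coeff L v k))\<^sup>2 \<le> dirichlet L G / (4 * pi\<^sup>2)"
proof (cases "k = 0")
  case True
  then show ?thesis using V_pairD(5)[OF v] dirichlet_nonneg[of L G] by (simp add: fourier_coeff_eq)
next
  case False
  then have "1 \<le> (norm k)\<^sup>2" using int_lattice_norm_ge_1[OF k] by (simp add: one_le_power)
  then have "(cmod (fourier_coeff L v k))\<^sup>2 \<le> (norm k)\<^sup>2 * (cmod (fourier_coeff L v k))\<^sup>2"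
    using mult_right_mono[of 1 "(norm k)\<^sup>2" "(cmod (fourier_coeff L v k))\<^sup>2"] by simp
  also have "\<dots> \<le> dirichlet L G / (4 * pi\<^sup>2)"
  proof (rule has_sum_mono2[OF _ dirichlet_has_sum[OF v]])
    show "((\<lambda>k. (norm k)\<^sup>2 * (cmod (fourier_coeff L v k))\<^sup>2) has_sum (norm k)\<^sup>2 * (cmod (fourier_coeff L v k))\<^sup>2) {k}"
      using has_sum_finite[of "{k}" "\<lambda>k. (norm k)\<^sup>2 * (cmod (fourier_coeff L v k))\<^sup>2"] by simp
  qed (use k in auto)
  finally show ?thesis .
qed

lemma V_pair_poincare:
  assumes "V_pair L v G"
  shows "(LINT x|cellM L. (v x)\<^sup>2) \<le> L\<^sup>2 / (4 * pi\<^sup>2) * dirichlet L G"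
  unfolding dirichlet_def by (rule poincare[OF L V_pairD(1-5)[OF assms]])

end

subsection \<open>The energy on gradients\<close>

lemma in_Lp_cong_AE:
  fixes f g :: "real^2 \<Rightarrow> 'b::{banach, second_countable_topology}"
  assumes "f \<in> borel_measurable lebesgue" "g \<in> borel_measurable lebesgue" "AE x in lebesgue. f x = g x"
    and "in_Lp p (cell L) f"
  shows "in_Lp p (cell L) g"
proof -
  have m: "f \<in> borel_measurable (cellM L)" "g \<in> borel_measurable (cellM L)"
    using assms(1,2) by (auto intro: measurable_cellM)
  have "AE x in cellM L. norm (f x) ^ p = norm (g x) ^ p"
    using AE_cellM[OF assms(3)] by eventually_elim simp
  then have "integrable (cellM L) (\<lambda>x. norm (g x) ^ p)"
    using assms(4) m integrable_cong_AE[of "\<lambda>x. norm (f x) ^ p" "cellM L" "\<lambda>x. norm (g x) ^ p"]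
    by (simp add: in_Lp_cell_iff)
  with m show ?thesis by (simp add: in_Lp_cell_iff)
qed

lemma has_weak_gradient_affine_plus:
  assumes "has_weak_gradient v G"
  shows "has_weak_gradient (\<lambda>x. B \<bullet> x + v x) (\<lambda>x. B + G x)"
  by (rule has_weak_gradient_add[OF has_weak_gradient_inner assms])

lemma square_integrable_loc:
  fixes f :: "real^2 \<Rightarrow> 'b::{banach, second_countable_topology}" and l :: "real^2 \<Rightarrow> 'b"
  assumes L: "L > 0" and l: "continuous_on UNIV l"
    and f: "f \<in> borel_measurable lebesgue" "periodic_AE L f" "in_Lp 2 (cell L) f"
  shows "in_Lp_loc 2 (\<lambda>x. l x + f x)"
  unfolding in_Lp_loc_iff
proof (intro conjI allI)
  show m: "(\<lambda>x. l x + f x) \<in> borel_measurable lebesgue"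
    by (intro borel_measurable_add continuous_measurable_lebesgue l f)
  fix a b :: "real^2"
  have 1: "set_integrable lebesgue (cbox a b) (\<lambda>x. (norm (f x))\<^sup>2)"
    using f by (intro set_integrable_periodic[OF L]) (auto simp: in_Lp_cell_iff set_integrable_cell intro: periodic_AE_compose)
  have "in_Lp_loc 1 (\<lambda>x. (norm (l x))\<^sup>2)" by (intro in_Lp_loc_1_continuous continuous_intros l)
  then have 2: "set_integrable lebesgue (cbox a b) (\<lambda>x. (norm (l x))\<^sup>2)" unfolding in_Lp_loc_1_iff by blast
  have 3: "set_integrable lebesgue (cbox a b) (\<lambda>x. 2 * (norm (l x))\<^sup>2 + 2 * (norm (f x))\<^sup>2)"
    by (intro set_integral_add set_integrable_mult_right 1 2)
  show "set_integrable lebesgue (cbox a b) (\<lambda>x. (norm (l x + f x))\<^sup>2)"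
    unfolding set_integrable_def
  proof (rule Bochner_Integration.integrable_bound[OF 3[unfolded set_integrable_def] _ AE_I2])
    show "(\<lambda>x. indicator (cbox a b) x *\<^sub>R (norm (l x + f x))\<^sup>2) \<in> borel_measurable lebesgue"
      by (intro borel_measurable_scaleR borel_measurable_indicator borel_measurable_power measurable_compose[OF m borel_measurable_norm]) simp
    show "norm (indicator (cbox a b) x *\<^sub>R (norm (l x + f x))\<^sup>2)
      \<le> norm (indicator (cbox a b) x *\<^sub>R (2 * (norm (l x))\<^sup>2 + 2 * (norm (f x))\<^sup>2))" for x
      using norm_square_add_le[of "l x" "f x"] by (simp add: indicator_def)
  qed
qed

text \<open>For the converse, local square integrability of h and of its gradient is recovered: the
  periodic parts spread from the cell to every box, and the affine part is continuous.\<close>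

lemma X_space_iff:
  assumes L: "L > 0"
  shows "h \<in> X_space L B \<longleftrightarrow> (\<exists>v G. V_pair L v G \<and> h = (\<lambda>x. B \<bullet> x + v x))"
proof
  assume "h \<in> X_space L B"
  then have "tilt B h \<in> V_space L" by (simp add: X_space_def)
  then obtain G where "cell_periodic L (tilt B h)" "in_Lp 2 (cell L) (tilt B h)"
    "has_weak_gradient (tilt B h) G" "in_Lp 2 (cell L) G" "(LINT x:cell L|lebesgue. tilt B h x) = 0"
    by (auto simp: V_space_def H1_per_def)
  then have "V_pair L (tilt B h) G"
    by (simp add: V_pair_def cell_periodic_eq set_lebesgue_integral_cell)
  moreover have "h = (\<lambda>x. B \<bullet> x + tilt B h x)" by (simp add: tilt_def)
  ultimately show "\<exists>v G. V_pair L v G \<and> h = (\<lambda>x. B \<bullet> x + v x)" by blast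
next
  assume "\<exists>v G. V_pair L v G \<and> h = (\<lambda>x. B \<bullet> x + v x)"
  then obtain v G where vG: "V_pair L v G" and h: "h = (\<lambda>x. B \<bullet> x + v x)" by blast
  note D = V_pairD[OF vG]
  have t: "tilt B h = v" by (simp add: tilt_def h fun_eq_iff)
  have "in_Lp_loc 2 h" unfolding h
    by (rule square_integrable_loc[OF L _ D(8,1,3)]) (intro continuous_intros)
  moreover have "in_Lp_loc 2 (\<lambda>x. B + G x)"
    by (rule square_integrable_loc[OF L _ D(9) weak_gradient_periodic[OF D(1,2)] D(4)]) (intro continuous_intros)
  moreover have "has_weak_gradient h (\<lambda>x. B + G x)"
    unfolding h by (rule has_weak_gradient_affine_plus[OF D(2)])
  ultimately have "h \<in> H1_loc" by (auto simp: H1_loc_def)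
  moreover have "v \<in> V_space L"
    using D(1-5) by (auto simp: V_space_def H1_per_def cell_periodic_eq set_lebesgue_integral_cell)
  ultimately show "h \<in> X_space L B" by (simp add: X_space_def t)
qed

locale film =
  fixes L a c1 c2 c3 :: real and B :: "real^2"
  assumes L: "L > 0" and a: "a > 0" and c1: "c1 > 0" and c3: "c3 > 0"
begin

abbreviation "\<Psi> \<equiv> Psi a c1 c2 c3"
abbreviation "b \<equiv> beta c1 c2 c3"

definition pair_energy :: "(real^2 \<Rightarrow> real) \<Rightarrow> (real^2 \<Rightarrow> real^2) \<Rightarrow> real"
  where "pair_energy v G = - 2 * c1 * pi\<^sup>2 * L * half_energy L v + (LINT x|cellM L. \<Psi> (B + G x))"

definition finite_energy :: "(real^2 \<Rightarrow> real) \<Rightarrow> (real^2 \<Rightarrow> real^2) \<Rightarrow> bool"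
  where "finite_energy v G \<longleftrightarrow> V_pair L v G \<and> in_Lp 3 (cell L) (\<lambda>x. B + G x)"

lemma measurable_Psi: "F \<in> borel_measurable M \<Longrightarrow> (\<lambda>x. \<Psi> (F x)) \<in> borel_measurable M"
  by (rule measurable_compose[OF _ borel_measurable_continuous_onI[OF continuous_on_Psi]])

text \<open>Weak gradients agree almost everywhere, so both the L^3 test and the integral may use B
  + G in place of the gradient selected by \<open>weak_gradient\<close>.\<close>

lemma energy_eq:
  assumes vG: "V_pair L v G"
  shows "energy L a c1 c2 c3 B (\<lambda>x. B \<bullet> x + v x) = (if finite_energy v G then ereal (pair_energy v G) else \<infinity>)"
proof -
  let ?h = "\<lambda>x. B \<bullet> x + v x"
  note D = V_pairD[OF vG]
  have g: "has_weak_gradient ?h (\<lambda>x. B + G x)" by (rule has_weak_gradient_affine_plus[OF D(2)])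
  have w: "has_weak_gradient ?h (weak_gradient ?h)" by (rule has_weak_gradient_weak_gradient[OF g])
  have m: "weak_gradient ?h \<in> borel_measurable lebesgue" "(\<lambda>x. B + G x) \<in> borel_measurable lebesgue"
    using has_weak_gradientD(2)[OF w] has_weak_gradientD(2)[OF g] in_Lp_loc_measurable by blast+
  have ae: "AE x in lebesgue. weak_gradient ?h x = B + G x" by (rule weak_gradient_unique[OF w g])
  then have ae': "AE x in lebesgue. B + G x = weak_gradient ?h x" by eventually_elim simp
  have 1: "in_Lp 3 (cell L) (weak_gradient ?h) \<longleftrightarrow> in_Lp 3 (cell L) (\<lambda>x. B + G x)"
    using in_Lp_cong_AE[OF m ae] in_Lp_cong_AE[OF m(2,1) ae'] by blast
  have 2: "(LINT x|cellM L. \<Psi> (weak_gradient ?h x)) = (LINT x|cellM L. \<Psi> (B + G x))"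
  proof (rule integral_cong_AE)
    show "(\<lambda>x. \<Psi> (weak_gradient ?h x)) \<in> borel_measurable (cellM L)" "(\<lambda>x. \<Psi> (B + G x)) \<in> borel_measurable (cellM L)"
      by (intro measurable_Psi measurable_cellM m)+
    show "AE x in cellM L. \<Psi> (weak_gradient ?h x) = \<Psi> (B + G x)"
      using AE_cellM[OF ae] by eventually_elim simp
  qed
  have t: "tilt B ?h = v" by (simp add: tilt_def fun_eq_iff)
  show ?thesis
    unfolding energy_def 1 t H_half_seminorm_square set_lebesgue_integral_cell 2 pair_energy_def finite_energy_def
    using vG by simp
qed

lemma integrable_Psi:
  assumes F: "in_Lp 3 (cell L) F"
  shows "integrable (cellM L) (\<lambda>x. \<Psi> (F x))"
proof -
  have "integrable (cellM L) (\<lambda>x. norm (F x) ^ 1)" "integrable (cellM L) (\<lambda>x. norm (F x) ^ 2)" "integrable (cellM L) (\<lambda>x. norm (F x) ^ 3)"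
    using in_Lp_le[OF F, of 1] in_Lp_le[OF F, of 2] F unfolding in_Lp_cell_iff by simp_all
  then have "integrable (cellM L) (\<lambda>x. a * c1 * (norm (F x))\<^sup>2 + a * (c1 * gamma0 c1 c2 + \<bar>c2\<bar>) * norm (F x) + a * c3 * norm (F x) ^ 3)"
    by simp
  then show ?thesis
  proof (rule Bochner_Integration.integrable_bound)
    show "(\<lambda>x. \<Psi> (F x)) \<in> borel_measurable (cellM L)" using F by (intro measurable_Psi) (simp add: in_Lp_cell_iff)
    show "AE x in cellM L. norm (\<Psi> (F x)) \<le> norm (a * c1 * (norm (F x))\<^sup>2 + a * (c1 * gamma0 c1 c2 + \<bar>c2\<bar>) * norm (F x) + a * c3 * norm (F x) ^ 3)"
    proof (rule AE_I2)
      fix x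
      show "norm (\<Psi> (F x)) \<le> norm (a * c1 * (norm (F x))\<^sup>2 + a * (c1 * gamma0 c1 c2 + \<bar>c2\<bar>) * norm (F x) + a * c3 * norm (F x) ^ 3)"
        using Psi_upper[OF a c1 c3, of c2 "F x"] Psi_nonneg[OF a c1 c3, of c2 "F x"] by simp
    qed
  qed
qed

lemma in_L3_if_integrable_Psi:
  assumes m: "F \<in> borel_measurable (cellM L)" and i: "integrable (cellM L) (\<lambda>x. \<Psi> (F x))"
  shows "in_Lp 3 (cell L) F"
proof -
  have "integrable (cellM L) (\<lambda>x. norm (F x) ^ 3)"
  proof (rule Bochner_Integration.integrable_bound)
    show "integrable (cellM L) (\<lambda>x. \<Psi> (F x) / (a * c3))" using i by simp
    show "AE x in cellM L. norm (norm (F x) ^ 3) \<le> norm (\<Psi> (F x) / (a * c3))"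
    proof (rule AE_I2)
      fix x
      show "norm (norm (F x) ^ 3) \<le> norm (\<Psi> (F x) / (a * c3))"
        using Psi_lower[OF a c1 c3, of "F x" c2] Psi_nonneg[OF a c1 c3, of c2 "F x"] a c3
        by (simp add: field_simps)
    qed
  qed (use m in simp)
  with m show ?thesis by (simp add: in_Lp_cell_iff)
qed

lemma finite_energyD:
  assumes "finite_energy v G"
  shows "V_pair L v G" "in_Lp 3 (cell L) (\<lambda>x. B + G x)" "integrable (cellM L) (\<lambda>x. \<Psi> (B + G x))"
  using assms integrable_Psi by (auto simp: finite_energy_def)

text \<open>The factor is 1/8 rather than 1/2 because \<open>dirichlet\<close> is taken of G - H,
  which is twice the gradient of the half difference. The seminorm enters the energy with a negative
  sign, so its parallelogram defect appears as a positive error.\<close>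

lemma pair_energy_midpoint:
  assumes v: "finite_energy v G" and w: "finite_energy w H"
  defines "m \<equiv> \<lambda>x. 1/2 * v x + 1/2 * w x" and "M \<equiv> \<lambda>x. (1/2) *\<^sub>R G x + (1/2) *\<^sub>R H x"
  shows "finite_energy m M"
    and "pair_energy m M \<le> (pair_energy v G + pair_energy w H) / 2
      + 2 * c1 * pi\<^sup>2 * L * half_energy L (\<lambda>x. 1/2 * v x + (-1/2) * w x)
      - a * c1 * b / 8 * dirichlet L (\<lambda>x. G x - H x)"
proof -
  note V = finite_energyD[OF v] and W = finite_energyD[OF w]
  have mM: "V_pair L m M" unfolding m_def M_def by (rule V_pair_lincomb[OF V(1) W(1)])
  have mid: "B + M x = (1/2) *\<^sub>R ((B + G x) + (B + H x))" for x
    by (simp add: M_def scaleR_add_right flip: scaleR_left_distrib)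
  have L3: "in_Lp 3 (cell L) (\<lambda>x. B + M x)"
  proof -
    have m: "(\<lambda>x. B + M x) \<in> borel_measurable (cellM L)" using V_pairD(10)[OF mM] by simp
    have "norm (B + M x) ^ 3 \<le> norm (B + G x) ^ 3 + norm (B + H x) ^ 3" for x
    proof -
      let ?s = "norm (B + G x)" and ?t = "norm (B + H x)"
      have "norm (B + M x) \<le> (?s + ?t) / 2" unfolding mid using norm_triangle_ineq[of "B + G x" "B + H x"] by simp
      also have "\<dots> \<le> max ?s ?t" by simp
      finally have "norm (B + M x) ^ 3 \<le> max ?s ?t ^ 3" by (intro power_mono) auto
      also have "\<dots> \<le> ?s ^ 3 + ?t ^ 3" by (simp add: max_def)
      finally show ?thesis .
    qed
    moreover have "integrable (cellM L) (\<lambda>x. norm (B + G x) ^ 3 + norm (B + H x) ^ 3)"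
      using V(2) W(2) by (simp add: in_Lp_cell_iff)
    ultimately have "integrable (cellM L) (\<lambda>x. norm (B + M x) ^ 3)"
      using m by (auto intro!: Bochner_Integration.integrable_bound[where f = "\<lambda>x. norm (B + G x) ^ 3 + norm (B + H x) ^ 3"])
    with m show ?thesis by (simp add: in_Lp_cell_iff)
  qed
  with mM show f: "finite_energy m M" by (simp add: finite_energy_def)
  have dG: "integrable (cellM L) (\<lambda>x. (norm (G x - H x))\<^sup>2)"
    using in_L2_diff[OF V_pairD(4)[OF V(1)] V_pairD(4)[OF W(1)]] by (simp add: in_Lp_cell_iff)
  have "(LINT x|cellM L. \<Psi> (B + M x) + a * c1 * b / 8 * (norm (G x - H x))\<^sup>2)
    \<le> (LINT x|cellM L. (\<Psi> (B + G x) + \<Psi> (B + H x)) / 2)"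
  proof (rule integral_mono)
    show "integrable (cellM L) (\<lambda>x. \<Psi> (B + M x) + a * c1 * b / 8 * (norm (G x - H x))\<^sup>2)"
      by (intro Bochner_Integration.integrable_add integrable_mult_right finite_energyD(3)[OF f] dG)
    show "integrable (cellM L) (\<lambda>x. (\<Psi> (B + G x) + \<Psi> (B + H x)) / 2)" using V(3) W(3) by simp
    show "\<Psi> (B + M x) + a * c1 * b / 8 * (norm (G x - H x))\<^sup>2 \<le> (\<Psi> (B + G x) + \<Psi> (B + H x)) / 2" for x
      using Psi_strongly_convex[OF a c1 c3, of c2 "B + G x" "B + H x"] unfolding mid by simp
  qed
  then have 1: "(LINT x|cellM L. \<Psi> (B + M x)) + a * c1 * b / 8 * dirichlet L (\<lambda>x. G x - H x)
    \<le> ((LINT x|cellM L. \<Psi> (B + G x)) + (LINT x|cellM L. \<Psi> (B + H x))) / 2"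
    using finite_energyD(3)[OF f] dG V(3) W(3) by (simp add: dirichlet_def)
  have 2: "half_energy L m = (half_energy L v + half_energy L w) / 2 - half_energy L (\<lambda>x. 1/2 * v x + (-1/2) * w x)"
    using half_energy_parallelogram[OF L V(1) W(1)] unfolding m_def by linarith
  show "pair_energy m M \<le> (pair_energy v G + pair_energy w H) / 2
      + 2 * c1 * pi\<^sup>2 * L * half_energy L (\<lambda>x. 1/2 * v x + (-1/2) * w x)
      - a * c1 * b / 8 * dirichlet L (\<lambda>x. G x - H x)"
    unfolding pair_energy_def 2 using 1 by (simp add: algebra_simps add_divide_distrib diff_divide_distrib)
qed

lemma half_energy_half_diff_le:
  assumes v: "V_pair L v G" and w: "V_pair L w H"
  shows "half_energy L (\<lambda>x. 1/2 * v x + (-1/2) * w x) \<le> dirichlet L (\<lambda>x. G x - H x) / (16 * pi\<^sup>2)"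
proof -
  have "(\<lambda>x. (1/2) *\<^sub>R G x + (-1/2) *\<^sub>R H x) = (\<lambda>x. (1/2) *\<^sub>R (G x - H x))"
    by (simp add: scaleR_diff_right)
  then have "dirichlet L (\<lambda>x. (1/2) *\<^sub>R G x + (-1/2) *\<^sub>R H x) = dirichlet L (\<lambda>x. G x - H x) / 4"
    by (simp only: dirichlet_scaleR) (simp add: power2_eq_square)
  with half_energy_le[OF L V_pair_lincomb[OF v w, of "1/2" "-1/2"]]
  have "half_energy L (\<lambda>x. 1/2 * v x + (-1/2) * w x) \<le> dirichlet L (\<lambda>x. G x - H x) / 4 / (4 * pi\<^sup>2)"
    by (simp only:)
  then show ?thesis by (simp only: divide_divide_eq_left)
qed

lemma pair_energy_coercive: "\<exists>C. \<forall>v G. finite_energy v G \<longrightarrow> dirichlet L G \<le> pair_energy v G + C"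
proof -
  \<comment> \<open>The part c1 L / 2 pays for the concave term, since 2 c1 pi^2 L / (4 pi^2) = c1 L
    / 2; the remaining 1 is the factor of the Dirichlet energy in the claim.\<close>
  let ?K = "1 + c1 * L / 2"
  obtain C where C: "\<And>p::real^2. ?K * (norm (p - B))\<^sup>2 \<le> a * c3 * norm p ^ 3 + C"
    using cubic_dominates_square[of "a * c3" ?K B] a c3 c1 L by auto
  have "dirichlet L G \<le> pair_energy v G + L\<^sup>2 * C" if f: "finite_energy v G" for v G
  proof -
    note F = finite_energyD[OF f]
    have "?K * dirichlet L G = (LINT x|cellM L. ?K * (norm (G x))\<^sup>2)" by (simp add: dirichlet_def)
    also have "\<dots> \<le> (LINT x|cellM L. \<Psi> (B + G x) + C)"
    proof (rule integral_mono)
      show "integrable (cellM L) (\<lambda>x. ?K * (norm (G x))\<^sup>2)" by (intro integrable_mult_right V_pairD(7)[OF F(1)])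
      show "integrable (cellM L) (\<lambda>x. \<Psi> (B + G x) + C)" by (intro Bochner_Integration.integrable_add F(3) integrable_cellM_const)
      show "?K * (norm (G x))\<^sup>2 \<le> \<Psi> (B + G x) + C" for x
        using C[of "B + G x"] Psi_lower[OF a c1 c3, of "B + G x" c2] by simp
    qed
    also have "\<dots> = (LINT x|cellM L. \<Psi> (B + G x)) + (LINT x|cellM L. C)"
      by (rule Bochner_Integration.integral_add[OF F(3) integrable_cellM_const])
    also have "(LINT x|cellM L. C) = L\<^sup>2 * C" using L by (intro integral_cellM_const) simp
    finally have 1: "?K * dirichlet L G \<le> (LINT x|cellM L. \<Psi> (B + G x)) + L\<^sup>2 * C" .
    have "2 * c1 * pi\<^sup>2 * L * half_energy L v \<le> 2 * c1 * pi\<^sup>2 * L * (dirichlet L G / (4 * pi\<^sup>2))"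
      using half_energy_le[OF L F(1)] c1 L by (intro mult_left_mono) auto
    also have "\<dots> = c1 * L / 2 * dirichlet L G" by simp
    finally show ?thesis using 1 unfolding pair_energy_def by (simp add: algebra_simps)
  qed
  then show ?thesis by blast
qed

lemma finite_energy_0: "finite_energy (\<lambda>x. 0) (\<lambda>x. 0)"
  by (simp add: finite_energy_def V_pair_0 in_Lp_cell_iff integrable_cellM_const)

section \<open>Uniqueness when L/a < beta\<close>

text \<open>The affine function B \<bullet> x has finite energy, so a minimizer has finite energy
  too, and the comparison can be carried out in the reals.\<close>

lemma energy_minimizer_pair:
  assumes "energy_minimizer L a c1 c2 c3 B h"
  obtains v G where "finite_energy v G" "h = (\<lambda>x. B \<bullet> x + v x)"
    "\<And>w H. finite_energy w H \<Longrightarrow> pair_energy v G \<le> pair_energy w H"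
proof -
  have "h \<in> X_space L B" and min: "\<And>g. g \<in> X_space L B \<Longrightarrow> energy L a c1 c2 c3 B h \<le> energy L a c1 c2 c3 B g"
    using assms by (auto simp: energy_minimizer_def)
  then obtain v G where v: "V_pair L v G" and h: "h = (\<lambda>x. B \<bullet> x + v x)" using X_space_iff[OF L] by blast
  have le: "energy L a c1 c2 c3 B h \<le> ereal (pair_energy w H)" if "finite_energy w H" for w H
  proof -
    have "(\<lambda>x. B \<bullet> x + w x) \<in> X_space L B" using X_space_iff[OF L] finite_energyD(1)[OF that] by blast
    from min[OF this] show ?thesis using energy_eq[OF finite_energyD(1)[OF that]] that by simp
  qed
  from le[OF finite_energy_0] have f: "finite_energy v G"
    unfolding h energy_eq[OF v] by (auto split: if_splits)
  show thesis
  proof (rule that[OF f h])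
    show "pair_energy v G \<le> pair_energy w H" if "finite_energy w H" for w H
      using le[OF that] f unfolding h energy_eq[OF v] by simp
  qed
qed

text \<open>Equality on the cell spreads to the plane: by \<open>nn_integral_periodic_le\<close> the
  integral of |v - w| over each box is at most a multiple of 0, and countably many boxes exhaust the
  plane.\<close>

lemma AE_eq_if_cell_integral_0:
  assumes v: "V_pair L v G" and w: "V_pair L w H" and 0: "(LINT x|cellM L. (v x - w x)\<^sup>2) = 0"
  shows "AE x in lebesgue. v x = w x"
proof -
  note V = V_pairD[OF v] and W = V_pairD[OF w]
  have "integrable (cellM L) (\<lambda>x. (v x - w x)\<^sup>2)"
    using in_L2_diff[OF V(3) W(3)] by (simp add: in_Lp_cell_iff)
  with 0 have "AE x in cellM L. (v x - w x)\<^sup>2 = 0"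
    by (subst (asm) integral_nonneg_eq_0_iff_AE) auto
  then have ae: "AE x in lebesgue. x \<in> cell L \<longrightarrow> v x = w x"
    by (subst (asm) AE_restrict_space_iff) auto
  define f where "f x = ennreal \<bar>v x - w x\<bar>" for x
  have f: "f \<in> borel_measurable lebesgue" unfolding f_def using V(8) W(8) by simp
  have p: "periodic_AE L f" unfolding f_def by (rule periodic_AE_compose2[OF V(1) W(1)])
  have "(\<integral>\<^sup>+x\<in>cell L. f x \<partial>lebesgue) = (\<integral>\<^sup>+x. 0 \<partial>(lebesgue :: (real^2) measure))"
  proof (rule nn_integral_cong_AE)
    show "AE x in lebesgue. f x * indicator (cell L) x = 0"
      using ae by eventually_elim (auto simp: f_def indicator_def)
  qed
  then have z: "(\<integral>\<^sup>+x\<in>cbox a b. f x \<partial>lebesgue) = 0" for a b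
    using nn_integral_periodic_le[OF L, of a b] f p by fastforce
  have "AE x in lebesgue. f x * indicator (cbox (- real n *\<^sub>R One) (real n *\<^sub>R One)) x = 0" for n
    using z[of "- real n *\<^sub>R One" "real n *\<^sub>R One"] f
    by (subst (asm) nn_integral_0_iff_AE) (auto intro!: borel_measurable_times_ennreal borel_measurable_indicator)
  then have "AE x in lebesgue. \<forall>n::nat. f x * indicator (cbox (- real n *\<^sub>R One) (real n *\<^sub>R One)) x = 0"
    by (simp only: AE_all_countable simp_thms)
  then show ?thesis
  proof eventually_elim
    case (elim x)
    obtain n :: nat where n: "norm x \<le> n" using real_arch_simple by blast
    have "\<bar>x \<bullet> i\<bar> \<le> real n" if "i \<in> Basis" for i
      using Basis_le_norm[OF that, of x] n by linarith
    then have "x \<in> cbox (- real n *\<^sub>R One) (real n *\<^sub>R One)" by (auto simp: mem_box abs_le_iff minus_le_iff)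
    with elim[rule_format, of n] show ?case by (simp add: f_def)
  qed
qed

theorem minimizer_unique:
  assumes small: "L / a < b" and h: "energy_minimizer L a c1 c2 c3 B h1" "energy_minimizer L a c1 c2 c3 B h2"
  shows "AE x in lebesgue. h1 x = h2 x"
proof -
  obtain v G where v: "finite_energy v G" "h1 = (\<lambda>x. B \<bullet> x + v x)"
    and vmin: "\<And>w H. finite_energy w H \<Longrightarrow> pair_energy v G \<le> pair_energy w H"
    using energy_minimizer_pair[OF h(1)] by blast
  obtain w H where w: "finite_energy w H" "h2 = (\<lambda>x. B \<bullet> x + w x)"
    and wmin: "\<And>v G. finite_energy v G \<Longrightarrow> pair_energy w H \<le> pair_energy v G"
    using energy_minimizer_pair[OF h(2)] by blast
  note V = finite_energyD(1)[OF v(1)] and W = finite_energyD(1)[OF w(1)]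
  define D where "D = dirichlet L (\<lambda>x. G x - H x)"
  have "pair_energy w H = pair_energy v G" using vmin[OF w(1)] wmin[OF v(1)] by simp
  \<comment> \<open>The midpoint cannot have less energy than the common minimum, so the strong
    convexity term is bounded by the seminorm term.\<close>
  with pair_energy_midpoint(2)[OF v(1) w(1)] vmin[OF pair_energy_midpoint(1)[OF v(1) w(1)]]
  have "a * c1 * b / 8 * D \<le> 2 * c1 * pi\<^sup>2 * L * half_energy L (\<lambda>x. 1/2 * v x + (-1/2) * w x)"
    unfolding D_def by simp
  also have "\<dots> \<le> 2 * c1 * pi\<^sup>2 * L * (D / (16 * pi\<^sup>2))"
    unfolding D_def using half_energy_half_diff_le[OF V W] c1 L by (intro mult_left_mono) auto
  also have "\<dots> = c1 * L / 8 * D" by simp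
  \<comment> \<open>Both sides were brought to the factor c1/8, which leaves a beta on one side and
    L on the other: the threshold for L/a.\<close>
  finally have "c1 * (a * b - L) * D \<le> 0" by (simp add: algebra_simps)
  moreover have "c1 * (a * b - L) > 0" using small a c1 by (simp add: field_simps)
  ultimately have "\<not> 0 < D" using mult_pos_pos[of "c1 * (a * b - L)" D] by linarith
  then have D0: "D = 0" using dirichlet_nonneg[of L "\<lambda>x. G x - H x"] by (simp add: D_def)
  have "(LINT x|cellM L. (v x - w x)\<^sup>2) \<le> 0"
    using V_pair_poincare[OF L V_pair_lincomb[OF V W, of 1 "-1"]] D0 by (simp add: D_def)
  moreover have "0 \<le> (LINT x|cellM L. (v x - w x)\<^sup>2)" by (rule Bochner_Integration.integral_nonneg) simp
  ultimately have "AE x in lebesgue. v x = w x"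
    by (intro AE_eq_if_cell_integral_0[OF V W]) simp
  then show ?thesis unfolding v(2) w(2) by eventually_elim simp
qed

section \<open>Strong compactness of minimizing sequences and lower semicontinuity\<close>

text \<open>The midpoint of two members has energy at least \<open>I\<close>, so \<mu> times the
  Dirichlet distance is bounded by three errors, each made at most \<mu> \<epsilon> / 4: the excess
  energies, the low frequencies, where coefficients converge, and the tail beyond radius R.\<close>

lemma minimizing_sequence_Cauchy:
  assumes fe: "\<And>n::nat. finite_energy (v n) (G n)"
    and lower: "\<And>w H. finite_energy w H \<Longrightarrow> I \<le> pair_energy w H"
    and upper: "\<And>n. pair_energy (v n) (G n) \<le> I + e n" and e: "e \<longlonglongrightarrow> 0"
    and bound: "\<And>n. dirichlet L (G n) \<le> R0"
    and conv: "\<And>k. k \<in> int_lattice \<Longrightarrow> (\<lambda>n. fourier_coeff L (v n) k) \<longlonglongrightarrow> l k"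
    and "\<epsilon> > 0"
  shows "\<exists>N. \<forall>m\<ge>N. \<forall>n\<ge>N. dirichlet L (\<lambda>x. G m x - G n x) < \<epsilon>"
proof -
  define \<mu> where "\<mu> = a * c1 * b / 8"
  define \<kappa> where "\<kappa> = 2 * c1 * pi\<^sup>2 * L"
  have \<mu>: "\<mu> > 0" using a c1 beta_pos[OF c1 c3, of c2] by (simp add: \<mu>_def)
  have \<kappa>: "\<kappa> > 0" using c1 L by (simp add: \<kappa>_def)
  have R0: "R0 \<ge> 0" using dirichlet_nonneg bound order.trans by blast
  define A where "A = \<kappa> * (R0 / (4 * pi\<^sup>2))"
  have A: "A \<ge> 0" using \<kappa> R0 by (simp add: A_def)
  have \<mu>\<epsilon>: "\<mu> * \<epsilon> > 0" using \<mu> \<open>\<epsilon> > 0\<close> by simp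
  \<comment> \<open>Chosen so that the tail contribution A / R is at most \<mu> \<epsilon> / 4; the
    added 1 keeps R positive when A = 0.\<close>
  define R where "R = A * 4 / (\<mu> * \<epsilon>) + 1"
  have R: "R > 0" using A \<mu>\<epsilon> by (simp add: R_def add_nonneg_pos)
  have AR: "A / R \<le> \<mu> * \<epsilon> / 4"
  proof -
    have "A * 4 / (\<mu> * \<epsilon>) \<le> R" by (simp add: R_def)
    then have "A * 4 \<le> R * (\<mu> * \<epsilon>)" using \<mu>\<epsilon> by (simp only: pos_divide_le_eq)
    then show ?thesis using R by (simp add: field_simps)
  qed
  define F where "F = {k\<in>int_lattice. norm k \<le> R}"
  define S where "S n = (\<Sum>k\<in>F. norm k * (cmod (fourier_coeff L (v n) k - l k))\<^sup>2)" for n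
  have "S \<longlonglongrightarrow> (\<Sum>k\<in>F. norm k * (cmod (l k - l k))\<^sup>2)"
    unfolding S_def by (intro tendsto_intros conv) (auto simp: F_def)
  then have S: "S \<longlonglongrightarrow> 0" by simp
  have "eventually (\<lambda>n. S n < \<mu> * \<epsilon> / (4 * \<kappa>)) sequentially"
    using \<mu>\<epsilon> \<kappa> by (intro order_tendstoD(2)[OF S]) simp
  moreover have "eventually (\<lambda>n. e n < \<mu> * \<epsilon> / 4) sequentially"
    using \<mu>\<epsilon> by (intro order_tendstoD(2)[OF e]) simp
  ultimately have "eventually (\<lambda>n. S n < \<mu> * \<epsilon> / (4 * \<kappa>) \<and> e n < \<mu> * \<epsilon> / 4) sequentially"
    by eventually_elim simp
  then obtain N where "\<And>n. n \<ge> N \<Longrightarrow> S n < \<mu> * \<epsilon> / (4 * \<kappa>)" and eN: "\<And>n. n \<ge> N \<Longrightarrow> e n < \<mu> * \<epsilon> / 4"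
    by (auto simp: eventually_sequentially)
  then have SN: "\<kappa> * S n < \<mu> * \<epsilon> / 4" if "n \<ge> N" for n
    using that \<kappa> by (fastforce simp: field_simps)
  have "dirichlet L (\<lambda>x. G m x - G n x) < \<epsilon>" if mn: "m \<ge> N" "n \<ge> N" for m n
  proof -
    note M = finite_energyD(1)[OF fe[of m]] and N' = finite_energyD(1)[OF fe[of n]]
    let ?u = "\<lambda>x. 1/2 * v m x + (-1/2) * v n x" and ?U = "\<lambda>x. (1/2) *\<^sub>R G m x + (-1/2) *\<^sub>R G n x"
    have U: "V_pair L ?u ?U" by (rule V_pair_lincomb[OF M N'])
    have "dirichlet L ?U \<le> (LINT x|cellM L. ((norm (G m x))\<^sup>2 + (norm (G n x))\<^sup>2) / 2)"
      unfolding dirichlet_def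
    proof (rule integral_mono)
      show "integrable (cellM L) (\<lambda>x. (norm (?U x))\<^sup>2)" by (rule V_pairD(7)[OF U])
      show "integrable (cellM L) (\<lambda>x. ((norm (G m x))\<^sup>2 + (norm (G n x))\<^sup>2) / 2)"
        using V_pairD(7)[OF M] V_pairD(7)[OF N'] by simp
      show "(norm (?U x))\<^sup>2 \<le> ((norm (G m x))\<^sup>2 + (norm (G n x))\<^sup>2) / 2" for x
        using norm_square_add_le[of "(1/2) *\<^sub>R G m x" "(-1/2) *\<^sub>R G n x"] by (simp add: power_divide)
    qed
    also have "\<dots> = (dirichlet L (G m) + dirichlet L (G n)) / 2"
      using V_pairD(7)[OF M] V_pairD(7)[OF N'] by (simp add: dirichlet_def)
    also have "\<dots> \<le> R0" using bound[of m] bound[of n] by simp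
    finally have UR: "dirichlet L ?U / (4 * pi\<^sup>2) / R \<le> R0 / (4 * pi\<^sup>2) / R"
      using R by (intro divide_right_mono) auto
    have "(\<Sum>k\<in>F. norm k * (cmod (fourier_coeff L ?u k))\<^sup>2)
      \<le> (\<Sum>k\<in>F. (norm k * (cmod (fourier_coeff L (v m) k - l k))\<^sup>2 + norm k * (cmod (fourier_coeff L (v n) k - l k))\<^sup>2) / 2)"
    proof (rule sum_mono)
      fix k
      let ?p = "fourier_coeff L (v m) k - l k" and ?q = "fourier_coeff L (v n) k - l k"
      have "fourier_coeff L ?u k = ?p / 2 + (- ?q / 2)"
        unfolding fourier_coeff_lincomb[OF V_pairD(6)[OF M] V_pairD(6)[OF N']] by (simp add: field_simps)
      then have "(cmod (fourier_coeff L ?u k))\<^sup>2 \<le> 2 * (cmod (?p / 2))\<^sup>2 + 2 * (cmod (- ?q / 2))\<^sup>2"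
        by (simp only: norm_square_add_le)
      also have "\<dots> = ((cmod ?p)\<^sup>2 + (cmod ?q)\<^sup>2) / 2"
        by (simp only: norm_divide norm_minus_cancel power_divide) (simp add: field_simps)
      finally have "norm k * (cmod (fourier_coeff L ?u k))\<^sup>2 \<le> norm k * (((cmod ?p)\<^sup>2 + (cmod ?q)\<^sup>2) / 2)"
        by (intro mult_left_mono) auto
      then show "norm k * (cmod (fourier_coeff L ?u k))\<^sup>2 \<le> (norm k * (cmod ?p)\<^sup>2 + norm k * (cmod ?q)\<^sup>2) / 2"
        by (simp only: distrib_left times_divide_eq_right)
    qed
    also have "\<dots> = (S m + S n) / 2"
      by (simp only: S_def sum.distrib sum_divide_distrib[symmetric])
    finally have "half_energy L ?u \<le> (S m + S n) / 2 + R0 / (4 * pi\<^sup>2) / R"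
      using half_energy_tail[OF L U R] UR unfolding F_def by linarith
    then have "\<kappa> * half_energy L ?u \<le> \<kappa> * ((S m + S n) / 2 + R0 / (4 * pi\<^sup>2) / R)"
      using \<kappa> by (intro mult_left_mono) auto
    also have "\<dots> = (\<kappa> * S m + \<kappa> * S n) / 2 + A / R" by (simp add: A_def algebra_simps add_divide_distrib)
    finally have h: "\<kappa> * half_energy L ?u \<le> (\<kappa> * S m + \<kappa> * S n) / 2 + A / R" .
    have "I \<le> (pair_energy (v m) (G m) + pair_energy (v n) (G n)) / 2 + \<kappa> * half_energy L ?u
        - \<mu> * dirichlet L (\<lambda>x. G m x - G n x)"
      using order.trans[OF lower[OF pair_energy_midpoint(1)[OF fe fe]] pair_energy_midpoint(2)[OF fe fe]]
      unfolding \<kappa>_def \<mu>_def .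
    then have "\<mu> * dirichlet L (\<lambda>x. G m x - G n x) < \<mu> * \<epsilon>"
      using upper[of m] upper[of n] h AR SN[OF mn(1)] SN[OF mn(2)] eN[OF mn(1)] eN[OF mn(2)] \<mu>\<epsilon> by argo
    then show ?thesis using \<mu> by simp
  qed
  then show ?thesis by blast
qed

text \<open>Fatou bounds the integral of \<open>Psi\<close> from the correct side, but the seminorm
  has a negative sign and needs an upper bound along the sequence. It comes from strong convergence
  of the gradients through \<open>half_energy_Young\<close>, which is why almost everywhere
  convergence alone does not suffice here.\<close>

lemma pair_energy_lower_limit:
  assumes w: "V_pair L w H" and fe: "\<And>n. finite_energy (v n) (G n)"
    and lim: "AE x in cellM L. (\<lambda>n. G n x) \<longlonglongrightarrow> H x"
    and D: "\<And>n. dirichlet L (\<lambda>x. G n x - H x) \<le> (1/4) ^ n"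
    and upper: "\<And>n. pair_energy (v n) (G n) \<le> I + e n" and e: "e \<longlonglongrightarrow> 0"
  shows "finite_energy w H" "pair_energy w H \<le> I"
proof -
  define \<kappa> where "\<kappa> = 2 * c1 * pi\<^sup>2 * L"
  have \<kappa>: "\<kappa> > 0" using c1 L by (simp add: \<kappa>_def)
  define c where "c \<epsilon> n = I + e n + \<kappa> * ((1 + \<epsilon>) * half_energy L w + (1 + 1/\<epsilon>) * ((1/4) ^ n / (4 * pi\<^sup>2)))" for \<epsilon> :: real and n
  have Hm: "(\<lambda>x. B + H x) \<in> borel_measurable (cellM L)" using V_pairD(10)[OF w] by simp
  have lim': "AE x in cellM L. (\<lambda>n. \<Psi> (B + G n x)) \<longlonglongrightarrow> \<Psi> (B + H x)"
    using lim
  proof eventually_elim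
    case (elim x)
    have "isCont \<Psi> (B + H x)" using continuous_on_Psi continuous_on_eq_continuous_at open_UNIV by blast
    then show ?case by (rule isCont_tendsto_compose) (intro tendsto_intros elim)
  qed
  have le: "(LINT x|cellM L. \<Psi> (B + G n x)) \<le> c \<epsilon> n" if "\<epsilon> > 0" for \<epsilon> n
  proof -
    note V = finite_energyD(1)[OF fe[of n]]
    have "half_energy L (\<lambda>x. 1 * v n x + (-1) * w x) \<le> dirichlet L (\<lambda>x. 1 *\<^sub>R G n x + (-1) *\<^sub>R H x) / (4 * pi\<^sup>2)"
      by (rule half_energy_le[OF L V_pair_lincomb[OF V w]])
    also have "\<dots> \<le> (1/4) ^ n / (4 * pi\<^sup>2)"
      using D[of n] by (intro divide_right_mono) auto
    finally have "(1 + 1/\<epsilon>) * half_energy L (\<lambda>x. 1 * v n x + (-1) * w x) \<le> (1 + 1/\<epsilon>) * ((1/4) ^ n / (4 * pi\<^sup>2))"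
      using that by (intro mult_left_mono) auto
    then have "half_energy L (v n) \<le> (1 + \<epsilon>) * half_energy L w + (1 + 1/\<epsilon>) * ((1/4) ^ n / (4 * pi\<^sup>2))"
      using half_energy_Young[OF L V w that] by linarith
    then have "\<kappa> * half_energy L (v n) \<le> \<kappa> * ((1 + \<epsilon>) * half_energy L w + (1 + 1/\<epsilon>) * ((1/4) ^ n / (4 * pi\<^sup>2)))"
      using \<kappa> by (intro mult_left_mono) auto
    then show ?thesis using upper[of n] unfolding pair_energy_def c_def \<kappa>_def by simp
  qed
  have c: "c \<epsilon> \<longlonglongrightarrow> I + 0 + \<kappa> * ((1 + \<epsilon>) * half_energy L w + (1 + 1/\<epsilon>) * (0 / (4 * pi\<^sup>2)))" for \<epsilon>
    unfolding c_def by (intro tendsto_intros e LIMSEQ_power_zero) auto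
  have F: "integrable (cellM L) (\<lambda>x. \<Psi> (B + H x))"
    "(LINT x|cellM L. \<Psi> (B + H x)) \<le> I + \<kappa> * ((1 + \<epsilon>) * half_energy L w)" if "\<epsilon> > 0" for \<epsilon>
    using Fatou_integral[OF finite_energyD(3)[OF fe] Psi_nonneg[OF a c1 c3] measurable_Psi[OF Hm] Psi_nonneg[OF a c1 c3] lim' le[OF that] c[of \<epsilon>]]
    by simp_all
  show "finite_energy w H"
    using w in_L3_if_integrable_Psi[OF Hm F(1)[of 1]] by (simp add: finite_energy_def)
  show "pair_energy w H \<le> I"
  proof (rule field_le_epsilon)
    fix \<delta> :: real assume "\<delta> > 0"
    \<comment> \<open>With the weight \<delta> / s in Young's inequality the surplus is \<delta>
      times a quotient below 1; the added 1 makes s positive even if the seminorm vanishes.\<close>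
    define s where "s = \<kappa> * half_energy L w + 1"
    have s: "s > 0" using \<kappa> half_energy_nonneg[of L w] by (simp add: s_def add_nonneg_pos)
    have "(LINT x|cellM L. \<Psi> (B + H x)) \<le> I + \<kappa> * ((1 + \<delta> / s) * half_energy L w)"
      using \<open>\<delta> > 0\<close> s by (intro F(2)) simp
    also have "\<dots> = I + \<kappa> * half_energy L w + \<delta> / s * (\<kappa> * half_energy L w)" by (simp add: algebra_simps)
    also have "\<delta> / s * (\<kappa> * half_energy L w) \<le> \<delta> / s * s"
      using \<open>\<delta> > 0\<close> s by (intro mult_left_mono) (auto simp: s_def)
    also have "\<delta> / s * s = \<delta>" using s by simp
    finally show "pair_energy w H \<le> I + \<delta>" unfolding pair_energy_def \<kappa>_def by simp
  qed
qed

end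

text \<open>The index r n = n + N 0 + ... + N n is strictly increasing and at least N n. Nothing
  metric about d enters, so \<open>dirichlet\<close> of a difference can be inserted
  directly.\<close>

lemma fast_subsequence:
  fixes d :: "nat \<Rightarrow> nat \<Rightarrow> real"
  assumes d: "\<And>e. e > 0 \<Longrightarrow> \<exists>N. \<forall>m\<ge>N. \<forall>n\<ge>N. d m n < e" and "c > 0"
  shows "\<exists>r. strict_mono r \<and> (\<forall>n m. n \<le> m \<longrightarrow> d (r m) (r n) \<le> c * (1/4) ^ n)"
proof -
  have "\<exists>N. \<forall>m\<ge>N. \<forall>n\<ge>N. d m n < c * (1/4) ^ j" for j :: nat
    using \<open>c > 0\<close> by (intro d) simp
  then obtain N where N: "\<And>j m n. m \<ge> N j \<Longrightarrow> n \<ge> N j \<Longrightarrow> d m n < c * (1/4) ^ j" by metis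
  define r where "r n = n + (\<Sum>i\<le>n. N i)" for n
  have r: "strict_mono r" by (rule strict_monoI_Suc) (simp add: r_def)
  have rN: "N n \<le> r n" for n
    unfolding r_def using member_le_sum[of n "{..n}" N] by simp
  have "d (r m) (r n) \<le> c * (1/4) ^ n" if "n \<le> m" for n m
    using N[of n "r m" "r n"] rN[of n] strict_mono_leD[OF r that] by simp
  with r show ?thesis by blast
qed

text \<open>The constant in the rate serves two purposes: the 1 gives gradients the rate (1/4)^n
  required by \<open>L2_limit\<close>, and 4 pi^2 / L^2 cancels the Poincare constant, so that the
  functions have the same rate.\<close>

lemma V_pair_limit:
  assumes L: "L > 0" and V: "\<And>n. V_pair L (v n) (G n)"
    and D: "\<And>n m. n \<le> m \<Longrightarrow> dirichlet L (\<lambda>x. G m x - G n x) \<le> min 1 (4 * pi\<^sup>2 / L\<^sup>2) * (1/4) ^ n"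
  shows "\<exists>w H. V_pair L w H \<and> (AE x in cellM L. (\<lambda>n. G n x) \<longlonglongrightarrow> H x) \<and>
    (\<forall>n. dirichlet L (\<lambda>x. G n x - H x) \<le> (1/4) ^ n)"
proof -
  define w where "w x = lim (\<lambda>n. v n x)" for x
  define H where "H x = lim (\<lambda>n. G n x)" for x
  have DG: "(LINT x|cellM L. (norm (G m x - G n x))\<^sup>2) \<le> (1/4) ^ n" if "n \<le> m" for m n
  proof -
    have "(LINT x|cellM L. (norm (G m x - G n x))\<^sup>2) \<le> min 1 (4 * pi\<^sup>2 / L\<^sup>2) * (1/4) ^ n"
      using D[OF that] by (simp add: dirichlet_def)
    also have "\<dots> \<le> 1 * (1/4) ^ n" by (intro mult_right_mono) auto
    finally show ?thesis by simp
  qed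
  have Dv: "(LINT x|cellM L. (norm (v m x - v n x))\<^sup>2) \<le> (1/4) ^ n" if "n \<le> m" for m n
  proof -
    have "(LINT x|cellM L. (norm (v m x - v n x))\<^sup>2) \<le> L\<^sup>2 / (4 * pi\<^sup>2) * dirichlet L (\<lambda>x. G m x - G n x)"
      using V_pair_poincare[OF L V_pair_lincomb[OF V[of m] V[of n], of 1 "-1"]] by simp
    also have "\<dots> \<le> L\<^sup>2 / (4 * pi\<^sup>2) * (4 * pi\<^sup>2 / L\<^sup>2 * (1/4) ^ n)"
      by (intro mult_left_mono order.trans[OF D[OF that]] mult_right_mono) auto
    also have "\<dots> = (1/4) ^ n" using L by simp
    finally show ?thesis .
  qed
  note Lv = L2_limit[OF L V_pairD(3)[OF V] Dv, folded w_def]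
  note LG = L2_limit[OF L V_pairD(4)[OF V] DG, folded H_def]
  have L1: "(\<lambda>n. LINT x|cellM L. norm (f n x - g x)) \<longlonglongrightarrow> 0"
    if "\<And>n. in_Lp 2 (cell L) (\<lambda>x. f n x - g x)" "\<And>n. (LINT x|cellM L. (norm (f n x - g x))\<^sup>2) \<le> (1/4) ^ n"
    for f :: "nat \<Rightarrow> real^2 \<Rightarrow> 'b::{banach, second_countable_topology}" and g
  proof (rule Lim_null_comparison)
    show "\<forall>\<^sub>F n in sequentially. norm (LINT x|cellM L. norm (f n x - g x)) \<le> (L\<^sup>2 + 1) * (1/2) ^ n"
    proof (intro always_eventually allI)
      fix n
      have "(LINT x|cellM L. norm (f n x - g x)) \<le> (1/2) ^ n * L\<^sup>2 + (LINT x|cellM L. (norm (f n x - g x))\<^sup>2) / (1/2) ^ n"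
        by (rule integral_norm_le_L2[OF L that(1)]) simp
      also have "\<dots> \<le> (1/2) ^ n * L\<^sup>2 + (1/4) ^ n / (1/2) ^ n"
        using that(2)[of n] by (intro add_left_mono divide_right_mono) auto
      also have "(1/4) ^ n / (1/2) ^ n = (1/2 :: real) ^ n" by (simp flip: power_divide)
      finally show "norm (LINT x|cellM L. norm (f n x - g x)) \<le> (L\<^sup>2 + 1) * (1/2) ^ n"
        by (simp add: algebra_simps)
    qed
    have "(\<lambda>n. (L\<^sup>2 + 1) * (1/2) ^ n) \<longlonglongrightarrow> (L\<^sup>2 + 1) * 0"
      by (intro tendsto_intros LIMSEQ_power_zero) simp
    then show "(\<lambda>n. (L\<^sup>2 + 1) * (1/2) ^ n) \<longlonglongrightarrow> 0" by simp
  qed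
  have v1: "(\<lambda>n. LINT x|cellM L. \<bar>v n x - w x\<bar>) \<longlonglongrightarrow> 0"
    using L1[OF in_L2_diff[OF V_pairD(3)[OF V] Lv(2)] Lv(3)] by simp
  have G1: "(\<lambda>n. LINT x|cellM L. norm (G n x - H x)) \<longlonglongrightarrow> 0"
    by (rule L1[OF in_L2_diff[OF V_pairD(4)[OF V] LG(2)] LG(3)])
  have m: "w \<in> borel_measurable lebesgue" "H \<in> borel_measurable lebesgue"
    unfolding w_def[abs_def] H_def[abs_def]
    using V_pairD(8)[OF V] V_pairD(9)[OF V] by (auto intro!: borel_measurable_lim_metric)
  \<comment> \<open>Outside one null set the sequences at x and at the shifted point coincide, so
    \<open>lim\<close> agrees there even where the sequence diverges.\<close>
  have per: "periodic_AE L (\<lambda>x. lim (\<lambda>n. f n x))" if "\<And>n. periodic_AE L (f n)" for f :: "nat \<Rightarrow> real^2 \<Rightarrow> 'b::t2_space"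
    unfolding periodic_AE_def
  proof
    fix i
    have "AE x in lebesgue. \<forall>n. f n (x + L *\<^sub>R axis i 1) = f n x"
      using that by (simp add: periodic_AE_def AE_all_countable)
    then show "AE x in lebesgue. lim (\<lambda>n. f n (x + L *\<^sub>R axis i 1)) = lim (\<lambda>n. f n x)"
      by eventually_elim simp
  qed
  have p: "periodic_AE L w" "periodic_AE L H"
    unfolding w_def[abs_def] H_def[abs_def]
    by (intro per V_pairD(1)[OF V], intro per weak_gradient_periodic[OF V_pairD(1)[OF V] V_pairD(2)[OF V]])
  have i: "integrable (cellM L) w" "integrable (cellM L) H"
    using in_Lp_integrable[OF Lv(2)] in_Lp_integrable[OF LG(2)] by simp_all
  have g: "has_weak_gradient w H"
    by (rule weak_gradient_limit[OF L V_pairD(1)[OF V] V_pairD(2)[OF V] m(1) p(1) i(1) m(2) p(2) i(2) v1 G1])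
  have mean: "(LINT x|cellM L. w x) = 0"
  proof -
    have "\<bar>LINT x|cellM L. w x\<bar> \<le> (LINT x|cellM L. \<bar>v n x - w x\<bar>)" for n
    proof -
      have "(LINT x|cellM L. v n x - w x) = - (LINT x|cellM L. w x)"
        using V_pairD(5,6)[OF V[of n]] i(1) by simp
      then show ?thesis using integral_abs_bound[of "cellM L" "\<lambda>x. v n x - w x"] by simp
    qed
    then have "\<bar>LINT x|cellM L. w x\<bar> \<le> 0" using v1 by (intro LIMSEQ_le_const) auto
    then show ?thesis by simp
  qed
  have "V_pair L w H" unfolding V_pair_def using p(1) g Lv(2) LG(2) mean by blast
  then show ?thesis using LG(1,3) by (auto simp: dirichlet_def)
qed

context film
begin

theorem minimizer_exists: "\<exists>h. energy_minimizer L a c1 c2 c3 B h"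
proof -
  \<comment> \<open>Only finite-energy pairs enter, so the infimum is taken in the reals, where
    coercivity bounds it from below; infinite values are compared only at the very end.\<close>
  define E where "E = {pair_energy v G | v G. finite_energy v G}"
  define I where "I = Inf E"
  obtain C where C: "\<And>v G. finite_energy v G \<Longrightarrow> dirichlet L G \<le> pair_energy v G + C"
    using pair_energy_coercive by blast
  have bdd: "bdd_below E"
  proof (rule bdd_belowI)
    fix y assume "y \<in> E"
    then obtain v G where "y = pair_energy v G" "finite_energy v G" by (auto simp: E_def)
    then show "- C \<le> y" using C[of v G] dirichlet_nonneg[of L G] by linarith
  qed
  have ne: "E \<noteq> {}" using finite_energy_0 by (auto simp: E_def)
  have lower: "I \<le> pair_energy w H" if "finite_energy w H" for w H
    unfolding I_def using that by (intro cInf_lower bdd) (auto simp: E_def)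
  have "\<exists>v G. finite_energy v G \<and> pair_energy v G < I + inverse (real (Suc n))" for n
  proof -
    have "Inf E < I + inverse (real (Suc n))" by (simp add: I_def)
    from cInf_lessD[OF ne this] show ?thesis by (auto simp: E_def)
  qed
  then obtain v G where fe: "\<And>n. finite_energy (v n) (G n)"
    and up: "\<And>n. pair_energy (v n) (G n) < I + inverse (real (Suc n))" by metis
  define R0 where "R0 = I + 1 + C"
  have bound: "dirichlet L (G n) \<le> R0" for n
  proof -
    have "inverse (real (Suc n)) \<le> 1" by (simp add: inverse_le_1_iff)
    then show ?thesis using C[OF fe[of n]] up[of n] by (simp add: R0_def)
  qed
  have coeff: "cmod (fourier_coeff L (v n) k) \<le> sqrt (R0 / (4 * pi\<^sup>2))" if "k \<in> int_lattice" for n k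
  proof (rule real_le_rsqrt)
    have "(cmod (fourier_coeff L (v n) k))\<^sup>2 \<le> dirichlet L (G n) / (4 * pi\<^sup>2)"
      by (rule fourier_coeff_bound[OF L finite_energyD(1)[OF fe] that])
    also have "\<dots> \<le> R0 / (4 * pi\<^sup>2)" using bound by (intro divide_right_mono) auto
    finally show "(cmod (fourier_coeff L (v n) k))\<^sup>2 \<le> R0 / (4 * pi\<^sup>2)" .
  qed
  \<comment> \<open>Diagonal argument over the countable lattice: one subsequence along which every
    Fourier coefficient converges.\<close>
  obtain q where q: "strict_mono (q :: nat \<Rightarrow> nat)"
    and "\<And>k. k \<in> int_lattice \<Longrightarrow> \<exists>l. (\<lambda>n. fourier_coeff L (v (q n)) k) \<longlonglongrightarrow> l"
    using function_convergent_subsequence[where f = "\<lambda>n k. fourier_coeff L (v n) k", OF countable_int_lattice coeff] by blast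
  then obtain l where l: "\<And>k. k \<in> int_lattice \<Longrightarrow> (\<lambda>n. fourier_coeff L (v (q n)) k) \<longlonglongrightarrow> l k"
    by metis
  have up': "pair_energy (v (q n)) (G (q n)) \<le> I + inverse (real (Suc (q n)))" for n
    using up[of "q n"] by simp
  have e: "(\<lambda>n. inverse (real (Suc (q n)))) \<longlonglongrightarrow> 0"
    using LIMSEQ_subseq_LIMSEQ[OF LIMSEQ_inverse_real_of_nat q] by (simp add: o_def)
  have "\<exists>N. \<forall>m\<ge>N. \<forall>n\<ge>N. dirichlet L (\<lambda>x. G (q m) x - G (q n) x) < \<epsilon>" if "\<epsilon> > 0" for \<epsilon>
    using minimizing_sequence_Cauchy[of "\<lambda>n. v (q n)" "\<lambda>n. G (q n)", OF fe lower up' e bound l that] by blast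
  moreover have "min 1 (4 * pi\<^sup>2 / L\<^sup>2) > 0" using L by simp
  ultimately obtain r where r: "strict_mono r"
    and D: "\<And>n m. n \<le> m \<Longrightarrow> dirichlet L (\<lambda>x. G (q (r m)) x - G (q (r n)) x) \<le> min 1 (4 * pi\<^sup>2 / L\<^sup>2) * (1/4) ^ n"
    using fast_subsequence[of "\<lambda>m n. dirichlet L (\<lambda>x. G (q m) x - G (q n) x)"] by blast
  have "\<exists>w H. V_pair L w H \<and> (AE x in cellM L. (\<lambda>n. G (q (r n)) x) \<longlonglongrightarrow> H x) \<and>
    (\<forall>n. dirichlet L (\<lambda>x. G (q (r n)) x - H x) \<le> (1/4) ^ n)"
    by (rule V_pair_limit[of L "\<lambda>n. v (q (r n))" "\<lambda>n. G (q (r n))", OF L finite_energyD(1)[OF fe] D])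
  then obtain w H where w: "V_pair L w H" "AE x in cellM L. (\<lambda>n. G (q (r n)) x) \<longlonglongrightarrow> H x"
    and wD: "\<forall>n. dirichlet L (\<lambda>x. G (q (r n)) x - H x) \<le> (1/4) ^ n"
    by (elim exE conjE)
  have e': "(\<lambda>n. inverse (real (Suc (q (r n))))) \<longlonglongrightarrow> 0"
    using LIMSEQ_subseq_LIMSEQ[OF e r] by (simp add: o_def)
  note lim = pair_energy_lower_limit[OF w(1) fe w(2) wD[rule_format] up' e']
  have min: "energy L a c1 c2 c3 B (\<lambda>x. B \<bullet> x + w x) \<le> energy L a c1 c2 c3 B g" if g: "g \<in> X_space L B" for g
  proof -
    obtain u U where u: "V_pair L u U" "g = (\<lambda>x. B \<bullet> x + u x)"
      using g[unfolded X_space_iff[OF L]] by blast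
    have "pair_energy w H \<le> pair_energy u U" if "finite_energy u U"
      using lim(2) lower[OF that] by simp
    then show ?thesis
      unfolding u(2) energy_eq[OF u(1)] energy_eq[OF w(1)] using lim(1) by simp
  qed
  moreover have "(\<lambda>x. B \<bullet> x + w x) \<in> X_space L B" using w(1) X_space_iff[OF L] by blast
  ultimately show ?thesis by (auto simp: energy_minimizer_def)
qed

end

theorem theorem1:
  fixes L a c1 c2 c3 :: real and B :: "real^2"
  assumes "L > 0" and "a > 0" and "c1 > 0" and "c3 > 0"
  shows "(\<exists>h. energy_minimizer L a c1 c2 c3 B h) \<and>
    (L / a < beta c1 c2 c3 \<longrightarrow>
      (\<forall>h1 h2. energy_minimizer L a c1 c2 c3 B h1 \<and> energy_minimizer L a c1 c2 c3 B h2 \<longrightarrow>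
        (AE x in lebesgue. h1 x = h2 x)))"
proof -
  interpret film L a c1 c2 c3 B by unfold_locales (fact assms)+
  show ?thesis using minimizer_exists minimizer_unique by blast
qed

end
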